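(* Let $(M,\omega=d\lambda)$ be an exact symplectic manifold with $\omega$-compatible almost complex structure $J$ and metric $g=\omega(\cdot,J\cdot)$, and let $H\in C^\infty(M,\mathbb{R})$ have $0$ as a regular value. Let $\mathscr{L}M=W^{1,p}(\mathbb{S}^1,M)$ with $p>1$. Then for $(\gamma,\tau)\in\mathscr{L}M\times\mathbb{R}$: $(\gamma,\tau)\in\operatorname{crit}(\mathcal{A}^H)$ if and only if $\gamma\in\operatorname{crit}(\mathfrak{a}^H)$ and $\tau=\chi(\gamma)$.
   Context: $\mathbb{S}^1=\mathbb{R}/\mathbb{Z}$. $\nabla H$ is the gradient with respect to $g$. On $\mathscr{L}M$ (a Banach manifold with $T_\gamma\mathscr{L}M=W^{1,p}(\mathbb{S}^1,\gamma^*TM)$) set $\mathfrak{a}(\gamma)=-\int_{\mathbb{S}^1}\gamma^*\lambda$ and $h(\gamma)=\int_0^1H(\gamma(t))\,dt$, with differentials $d\mathfrak{a}_\gamma(X)=\int_0^1\omega(\partial_t\gamma,X)\,dt$ and $dh_\gamma(X)=\int_0^1dH(X)\,dt$. The constrained loop space $\mathcal{H}=h^{-1}(0)$ is a codimension one Banach submanifold of $\mathscr{L}M$ with $T_\gamma\mathcal{H}=\ker dh_\gamma$, the constrained action functional is $\mathfrak{a}^H=\mathfrak{a}|_{\mathcal{H}}$, with critical points $\operatorname{crit}(\mathfrak{a}^H)=\{\gamma\in\mathcal{H}: d\mathfrak{a}^H_\gamma=0\}$, and the constraint factor is $\chi(\gamma)=-\dfrac{d\mathfrak{a}_\gamma(\nabla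 H|_\gamma)}{dh_\gamma(\nabla H|_\gamma)}$ for $\gamma\in\mathcal{H}$ (the denominator is positive). The Rabinowitz action functional is $\mathcal{A}^H:\mathscr{L}M\times\mathbb{R}\to\mathbb{R}$, $(\gamma,\tau)\mapsto\mathfrak{a}(\gamma)+\tau h(\gamma)$, with differential $d\mathcal{A}^H_{(\gamma,\tau)}(X,\ell)=d\mathfrak{a}_\gamma(X)+\tau\,dh_\gamma(X)+h(\gamma)\ell$, and $\operatorname{crit}(\mathcal{A}^H)$ is its set of critical points. *)

theory Defs
  imports "HOL-Analysis.Analysis"
begin

section \<open>Smooth manifolds\<close>

text \<open>Both notions are meant for open sets \<open>S\<close> and finite-dimensional domains.\<close>

primrec Ck_on :: "nat \<Rightarrow> 'e::real_normed_vector set \<Rightarrow> ('e \<Rightarrow> 'f::real_normed_vector) \<Rightarrow> bool" where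
  "Ck_on 0 S f \<longleftrightarrow> continuous_on S f"
| "Ck_on (Suc k) S f \<longleftrightarrow> (\<forall>x\<in>S. f differentiable (at x)) \<and>
     (\<forall>v. Ck_on k S (\<lambda>x. frechet_derivative f (at x) v))"

definition smooth_on :: "'e::real_normed_vector set \<Rightarrow> ('e \<Rightarrow> 'f::real_normed_vector) \<Rightarrow> bool" where
  "smooth_on S f \<longleftrightarrow> (\<forall>k. Ck_on k S f)"

text \<open>The manifold \<open>M\<close> is the whole type \<open>'a\<close>; a chart is a pair of an open domain and a
  coordinate map into the model space \<open>'e\<close>.\<close>

type_synonym ('a, 'e) chart = "'a set \<times> ('a \<Rightarrow> 'e)"

abbreviation cdom :: "('a, 'e) chart \<Rightarrow> 'a set" where "cdom c \<equiv> fst c"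
abbreviation cmap :: "('a, 'e) chart \<Rightarrow> 'a \<Rightarrow> 'e" where "cmap c \<equiv> snd c"
abbreviation cimg :: "('a, 'e) chart \<Rightarrow> 'e set" where "cimg c \<equiv> cmap c ` cdom c"
abbreviation cinv :: "('a, 'e) chart \<Rightarrow> 'e \<Rightarrow> 'a" where "cinv c \<equiv> inv_into (cdom c) (cmap c)"

definition smooth_atlas :: "('a::topological_space, 'e::euclidean_space) chart set \<Rightarrow> bool" where
  "smooth_atlas A \<longleftrightarrow>
     (\<Union>c\<in>A. cdom c) = UNIV \<and>
     (\<forall>c\<in>A. open (cdom c) \<and> open (cimg c) \<and> homeomorphism (cdom c) (cimg c) (cmap c) (cinv c)) \<and>
     (\<forall>c\<in>A. \<forall>d\<in>A. smooth_on (cmap c ` (cdom c \<inter> cdom d)) (cmap d \<circ> cinv c))"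

definition charts_at :: "('a, 'e) chart set \<Rightarrow> 'a \<Rightarrow> ('a, 'e) chart set" where
  "charts_at A x = {c \<in> A. x \<in> cdom c}"

definition smooth_fun :: "('a, 'e::euclidean_space) chart set \<Rightarrow> ('a \<Rightarrow> real) \<Rightarrow> bool" where
  "smooth_fun A f \<longleftrightarrow> (\<forall>c\<in>A. smooth_on (cimg c) (f \<circ> cinv c))"

text \<open>A tangent vector at \<open>x\<close> is the family of its coordinate vectors in all charts at \<open>x\<close>,
  related by the derivatives of the coordinate changes (and \<open>0\<close> at irrelevant charts).  The vector
  space operations are the pointwise ones.\<close>

type_synonym ('a, 'e) tvec = "('a, 'e) chart \<Rightarrow> 'e"

definition coord_change :: "'a \<Rightarrow> ('a, 'e::euclidean_space) chart \<Rightarrow> ('a, 'e) chart \<Rightarrow> 'e \<Rightarrow> 'e" where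
  "coord_change x c d = frechet_derivative (cmap d \<circ> cinv c) (at (cmap c x))"

definition tangent_space :: "('a, 'e::euclidean_space) chart set \<Rightarrow> 'a \<Rightarrow> ('a, 'e) tvec set" where
  "tangent_space A x = {v. (\<forall>c. c \<notin> charts_at A x \<longrightarrow> v c = 0) \<and>
     (\<forall>c\<in>charts_at A x. \<forall>d\<in>charts_at A x. v d = coord_change x c d (v c))}"

text \<open>The tangent vector at \<open>x\<close> with coordinate vector \<open>v\<close> in the chart \<open>c\<close>; \<open>v \<mapsto> tvec_of A c x v\<close>
  is the linear isomorphism from \<open>'e\<close> onto the tangent space, so linearity and smoothness of tensors
  can be expressed through it.\<close>

definition tvec_of :: "('a, 'e::euclidean_space) chart set \<Rightarrow> ('a, 'e) chart \<Rightarrow> 'a \<Rightarrow> 'e \<Rightarrow> ('a, 'e) tvec" where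
  "tvec_of A c x v = (\<lambda>d. if d \<in> charts_at A x then coord_change x c d v else 0)"

definition dfun :: "('a, 'e::euclidean_space) chart set \<Rightarrow> ('a \<Rightarrow> real) \<Rightarrow> 'a \<Rightarrow> ('a, 'e) tvec \<Rightarrow> real" where
  "dfun A f x v = (let c = SOME c. c \<in> charts_at A x
     in frechet_derivative (f \<circ> cinv c) (at (cmap c x)) (v c))"

definition regular_value :: "('a, 'e::euclidean_space) chart set \<Rightarrow> ('a \<Rightarrow> real) \<Rightarrow> real \<Rightarrow> bool" where
  "regular_value A f y \<longleftrightarrow> (\<forall>x. f x = y \<longrightarrow> (\<exists>v\<in>tangent_space A x. dfun A f x v \<noteq> 0))"


section \<open>Exact symplectic manifolds and compatible almost complex structures\<close>

type_synonym ('a, 'e) one_form = "'a \<Rightarrow> ('a, 'e) tvec \<Rightarrow> real"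
type_synonym ('a, 'e) two_form = "'a \<Rightarrow> ('a, 'e) tvec \<Rightarrow> ('a, 'e) tvec \<Rightarrow> real"
type_synonym ('a, 'e) endo_field = "'a \<Rightarrow> ('a, 'e) tvec \<Rightarrow> ('a, 'e) tvec"

definition smooth_one_form :: "('a, 'e::euclidean_space) chart set \<Rightarrow> ('a, 'e) one_form \<Rightarrow> bool" where
  "smooth_one_form A lam \<longleftrightarrow> (\<forall>c\<in>A.
     (\<forall>x\<in>cdom c. linear (\<lambda>v. lam x (tvec_of A c x v))) \<and>
     (\<forall>v. smooth_on (cimg c) (\<lambda>y. lam (cinv c y) (tvec_of A c (cinv c y) v))))"

definition smooth_two_form :: "('a, 'e::euclidean_space) chart set \<Rightarrow> ('a, 'e) two_form \<Rightarrow> bool" where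
  "smooth_two_form A om \<longleftrightarrow>
     (\<forall>c\<in>A.
       (\<forall>x\<in>cdom c. \<forall>w. linear (\<lambda>v. om x (tvec_of A c x v) (tvec_of A c x w))) \<and>
       (\<forall>v w. smooth_on (cimg c)
          (\<lambda>y. om (cinv c y) (tvec_of A c (cinv c y) v) (tvec_of A c (cinv c y) w)))) \<and>
     (\<forall>x. \<forall>v\<in>tangent_space A x. \<forall>w\<in>tangent_space A x. om x v w = - om x w v)"

text \<open>\<open>om = d lam\<close>: in every chart, for constant coordinate fields \<open>v\<close>, \<open>w\<close>,
  \<open>(d lam)(v, w) = v (lam w) - w (lam v)\<close>.\<close>

definition is_exterior_derivative ::
    "('a, 'e::euclidean_space) chart set \<Rightarrow> ('a, 'e) one_form \<Rightarrow> ('a, 'e) two_form \<Rightarrow> bool" where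
  "is_exterior_derivative A lam om \<longleftrightarrow> (\<forall>c\<in>A. \<forall>x\<in>cdom c. \<forall>v w.
     om x (tvec_of A c x v) (tvec_of A c x w) =
       frechet_derivative (\<lambda>y. lam (cinv c y) (tvec_of A c (cinv c y) w)) (at (cmap c x)) v
     - frechet_derivative (\<lambda>y. lam (cinv c y) (tvec_of A c (cinv c y) v)) (at (cmap c x)) w)"

definition nondegenerate :: "('a, 'e::euclidean_space) chart set \<Rightarrow> ('a, 'e) two_form \<Rightarrow> bool" where
  "nondegenerate A om \<longleftrightarrow> (\<forall>x. \<forall>v\<in>tangent_space A x.
     (\<forall>w\<in>tangent_space A x. om x v w = 0) \<longrightarrow> v = (\<lambda>_. 0))"

definition exact_symplectic ::
    "('a, 'e::euclidean_space) chart set \<Rightarrow> ('a, 'e) one_form \<Rightarrow> ('a, 'e) two_form \<Rightarrow> bool" where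
  "exact_symplectic A lam om \<longleftrightarrow> smooth_one_form A lam \<and> smooth_two_form A om \<and>
     is_exterior_derivative A lam om \<and> nondegenerate A om"

definition almost_complex :: "('a, 'e::euclidean_space) chart set \<Rightarrow> ('a, 'e) endo_field \<Rightarrow> bool" where
  "almost_complex A J \<longleftrightarrow>
     (\<forall>x. \<forall>v\<in>tangent_space A x. J x v \<in> tangent_space A x \<and> J x (J x v) = (\<lambda>c. - v c)) \<and>
     (\<forall>c\<in>A.
       (\<forall>x\<in>cdom c. linear (\<lambda>v. J x (tvec_of A c x v) c)) \<and>
       (\<forall>v. smooth_on (cimg c) (\<lambda>y. J (cinv c y) (tvec_of A c (cinv c y) v) c)))"

definition compatible ::
    "('a, 'e::euclidean_space) chart set \<Rightarrow> ('a, 'e) two_form \<Rightarrow> ('a, 'e) endo_field \<Rightarrow> bool" where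
  "compatible A om J \<longleftrightarrow> (\<forall>x.
     (\<forall>v\<in>tangent_space A x. \<forall>w\<in>tangent_space A x. om x (J x v) (J x w) = om x v w) \<and>
     (\<forall>v\<in>tangent_space A x. v \<noteq> (\<lambda>_. 0) \<longrightarrow> om x v (J x v) > 0))"

definition compatible_metric ::
    "('a, 'e) two_form \<Rightarrow> ('a, 'e) endo_field \<Rightarrow> 'a \<Rightarrow> ('a, 'e) tvec \<Rightarrow> ('a, 'e) tvec \<Rightarrow> real" where
  "compatible_metric om J x v w = om x v (J x w)"

definition gradient :: "('a, 'e::euclidean_space) chart set \<Rightarrow>
    ('a \<Rightarrow> ('a, 'e) tvec \<Rightarrow> ('a, 'e) tvec \<Rightarrow> real) \<Rightarrow> ('a \<Rightarrow> real) \<Rightarrow> 'a \<Rightarrow> ('a, 'e) tvec" where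
  "gradient A g f x = (THE v. v \<in> tangent_space A x \<and>
     (\<forall>w\<in>tangent_space A x. g x v w = dfun A f x w))"


section \<open>The loop space\<close>

definition Lp_on :: "real \<Rightarrow> real \<Rightarrow> real \<Rightarrow> (real \<Rightarrow> 'e::euclidean_space) \<Rightarrow> bool" where
  "Lp_on p a b g \<longleftrightarrow> g \<in> borel_measurable (lebesgue_on {a..b}) \<and>
     integrable (lebesgue_on {a..b}) (\<lambda>t. norm (g t) powr p)"

text \<open>\<open>W\<^sup>1\<^sup>,\<^sup>p([a,b])\<close> for \<open>p \<ge> 1\<close>, as the space of absolutely continuous functions with derivative in
  \<open>L\<^sup>p\<close> (every Sobolev class in one dimension has exactly one continuous representative).\<close>

definition sobolev_on :: "real \<Rightarrow> real \<Rightarrow> real \<Rightarrow> (real \<Rightarrow> 'e::euclidean_space) \<Rightarrow> bool" where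
  "sobolev_on p a b u \<longleftrightarrow>
     (AE t in lebesgue_on {a..b}. u differentiable (at t)) \<and>
     Lp_on p a b (\<lambda>t. vector_derivative u (at t)) \<and>
     (\<forall>t\<in>{a..b}. u t = u a + integral {a..t} (\<lambda>r. vector_derivative u (at r)))"

definition sobolev_norm :: "real \<Rightarrow> real \<Rightarrow> real \<Rightarrow> (real \<Rightarrow> 'e::euclidean_space) \<Rightarrow> real" where
  "sobolev_norm p a b u =
     (integral {a..b} (\<lambda>t. norm (u t) powr p + norm (vector_derivative u (at t)) powr p)) powr (1 / p)"

text \<open>Loops on \<open>\<real>/\<int>\<close> are \<open>1\<close>-periodic functions on \<open>\<real>\<close>.\<close>

definition loop_space ::
    "('a::topological_space, 'e::euclidean_space) chart set \<Rightarrow> real \<Rightarrow> (real \<Rightarrow> 'a) set" where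
  "loop_space A p = {\<gamma>. continuous_on UNIV \<gamma> \<and> (\<forall>t. \<gamma> (t + 1) = \<gamma> t) \<and>
     (\<forall>c\<in>A. \<forall>a b. a < b \<and> \<gamma> ` {a..b} \<subseteq> cdom c \<longrightarrow> sobolev_on p a b (\<lambda>t. cmap c (\<gamma> t)))}"

text \<open>The fibre \<open>W\<^sup>1\<^sup>,\<^sup>p(S\<^sup>1, \<gamma>\<^sup>*TM)\<close>.\<close>

definition loop_tangent :: "('a, 'e::euclidean_space) chart set \<Rightarrow> real \<Rightarrow> (real \<Rightarrow> 'a) \<Rightarrow>
    (real \<Rightarrow> ('a, 'e) tvec) set" where
  "loop_tangent A p \<gamma> = {X. (\<forall>t. X t \<in> tangent_space A (\<gamma> t)) \<and> (\<forall>t. X (t + 1) = X t) \<and>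
     (\<forall>c\<in>A. \<forall>a b. a < b \<and> \<gamma> ` {a..b} \<subseteq> cdom c \<longrightarrow> sobolev_on p a b (\<lambda>t. X t c))}"

definition loop_velocity :: "('a, 'e::euclidean_space) chart set \<Rightarrow> (real \<Rightarrow> 'a) \<Rightarrow> real \<Rightarrow> ('a, 'e) tvec" where
  "loop_velocity A \<gamma> t =
     (\<lambda>c. if c \<in> charts_at A (\<gamma> t) then vector_derivative (\<lambda>r. cmap c (\<gamma> r)) (at t) else 0)"

text \<open>\<open>s \<mapsto> \<sigma> s\<close> is a path of loops (defined near \<open>s = 0\<close>) through \<open>\<sigma> 0 = \<gamma>\<close> that is differentiable
  at \<open>s = 0\<close>, with derivative \<open>X\<close>, with respect to the Banach manifold structure of the loop space:
  locally in \<open>t\<close> and in a chart of \<open>M\<close>, the difference quotients converge to \<open>X\<close> in \<open>W\<^sup>1\<^sup>,\<^sup>p\<close>.\<close>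

definition loop_path :: "('a::topological_space, 'e::euclidean_space) chart set \<Rightarrow> real \<Rightarrow>
    (real \<Rightarrow> real \<Rightarrow> 'a) \<Rightarrow> (real \<Rightarrow> 'a) \<Rightarrow> (real \<Rightarrow> ('a, 'e) tvec) \<Rightarrow> bool" where
  "loop_path A p \<sigma> \<gamma> X \<longleftrightarrow>
     \<sigma> 0 = \<gamma> \<and> \<gamma> \<in> loop_space A p \<and> X \<in> loop_tangent A p \<gamma> \<and>
     (\<forall>\<^sub>F s in at 0. \<sigma> s \<in> loop_space A p) \<and>
     (\<forall>t. \<exists>c\<in>A. \<exists>a b. a < t \<and> t < b \<and> \<gamma> ` {a..b} \<subseteq> cdom c \<and>
        (\<forall>\<^sub>F s in at 0. \<sigma> s ` {a..b} \<subseteq> cdom c) \<and>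
        ((\<lambda>s. sobolev_norm p a b (\<lambda>r. (cmap c (\<sigma> s r) - cmap c (\<gamma> r)) /\<^sub>R s - X r c)) \<longlongrightarrow> 0) (at 0))"

text \<open>\<open>L = dF\<^sub>\<gamma>\<close>: the linear form on the tangent space at \<open>\<gamma>\<close> computing the derivative of \<open>F\<close> along all
  such paths.  It is unique on \<open>loop_tangent A p \<gamma>\<close> and, for Frechet differentiable \<open>F\<close>, it is the
  Frechet derivative; boundedness therefore need not be demanded separately.\<close>

definition has_loop_differential :: "('a::topological_space, 'e::euclidean_space) chart set \<Rightarrow> real \<Rightarrow>
    ((real \<Rightarrow> 'a) \<Rightarrow> real) \<Rightarrow> (real \<Rightarrow> 'a) \<Rightarrow> ((real \<Rightarrow> ('a, 'e) tvec) \<Rightarrow> real) \<Rightarrow> bool" where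
  "has_loop_differential A p F \<gamma> L \<longleftrightarrow>
     (\<forall>X\<in>loop_tangent A p \<gamma>. \<forall>Y\<in>loop_tangent A p \<gamma>. \<forall>a b.
        L (\<lambda>t c. a *\<^sub>R X t c + b *\<^sub>R Y t c) = a * L X + b * L Y) \<and>
     (\<forall>\<sigma> X. loop_path A p \<sigma> \<gamma> X \<longrightarrow> ((\<lambda>s. F (\<sigma> s)) has_real_derivative L X) (at 0))"

definition loop_differential :: "('a::topological_space, 'e::euclidean_space) chart set \<Rightarrow> real \<Rightarrow>
    ((real \<Rightarrow> 'a) \<Rightarrow> real) \<Rightarrow> (real \<Rightarrow> 'a) \<Rightarrow> (real \<Rightarrow> ('a, 'e) tvec) \<Rightarrow> real" where
  "loop_differential A p F \<gamma> = (SOME L. has_loop_differential A p F \<gamma> L)"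

text \<open>The same for functionals on the product of the loop space with \<open>\<real>\<close>.\<close>

definition has_ext_differential :: "('a::topological_space, 'e::euclidean_space) chart set \<Rightarrow> real \<Rightarrow>
    ((real \<Rightarrow> 'a) \<times> real \<Rightarrow> real) \<Rightarrow> (real \<Rightarrow> 'a) \<times> real \<Rightarrow>
    ((real \<Rightarrow> ('a, 'e) tvec) \<times> real \<Rightarrow> real) \<Rightarrow> bool" where
  "has_ext_differential A p F z L \<longleftrightarrow>
     (\<forall>X\<in>loop_tangent A p (fst z). \<forall>Y\<in>loop_tangent A p (fst z). \<forall>k l a b.
        L (\<lambda>t c. a *\<^sub>R X t c + b *\<^sub>R Y t c, a * k + b * l) = a * L (X, k) + b * L (Y, l)) \<and>
     (\<forall>\<sigma> X \<theta> l. loop_path A p \<sigma> (fst z) X \<and> \<theta> 0 = snd z \<and> (\<theta> has_real_derivative l) (at 0) \<longrightarrow>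
        ((\<lambda>s. F (\<sigma> s, \<theta> s)) has_real_derivative L (X, l)) (at 0))"

definition ext_differential :: "('a::topological_space, 'e::euclidean_space) chart set \<Rightarrow> real \<Rightarrow>
    ((real \<Rightarrow> 'a) \<times> real \<Rightarrow> real) \<Rightarrow> (real \<Rightarrow> 'a) \<times> real \<Rightarrow>
    (real \<Rightarrow> ('a, 'e) tvec) \<times> real \<Rightarrow> real" where
  "ext_differential A p F z = (SOME L. has_ext_differential A p F z L)"


section \<open>The action functionals\<close>

definition action :: "('a, 'e::euclidean_space) chart set \<Rightarrow> ('a, 'e) one_form \<Rightarrow> (real \<Rightarrow> 'a) \<Rightarrow> real" where
  "action A lam \<gamma> = - integral {0..1} (\<lambda>t. lam (\<gamma> t) (loop_velocity A \<gamma> t))"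

definition mean_energy :: "('a \<Rightarrow> real) \<Rightarrow> (real \<Rightarrow> 'a) \<Rightarrow> real" where
  "mean_energy H \<gamma> = integral {0..1} (\<lambda>t. H (\<gamma> t))"

definition constrained_loops :: "('a::topological_space, 'e::euclidean_space) chart set \<Rightarrow> real \<Rightarrow>
    ('a \<Rightarrow> real) \<Rightarrow> (real \<Rightarrow> 'a) set" where
  "constrained_loops A p H = {\<gamma> \<in> loop_space A p. mean_energy H \<gamma> = 0}"

definition constrained_tangent :: "('a::topological_space, 'e::euclidean_space) chart set \<Rightarrow> real \<Rightarrow>
    ('a \<Rightarrow> real) \<Rightarrow> (real \<Rightarrow> 'a) \<Rightarrow> (real \<Rightarrow> ('a, 'e) tvec) set" where
  "constrained_tangent A p H \<gamma> =
     {X \<in> loop_tangent A p \<gamma>. loop_differential A p (mean_energy H) \<gamma> X = 0}"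

text \<open>The differential of the restriction of the action to the constrained loop space is the
  restriction of its differential to the tangent space of the latter.\<close>

definition crit_constrained :: "('a::topological_space, 'e::euclidean_space) chart set \<Rightarrow> real \<Rightarrow>
    ('a, 'e) one_form \<Rightarrow> ('a \<Rightarrow> real) \<Rightarrow> (real \<Rightarrow> 'a) set" where
  "crit_constrained A p lam H = {\<gamma> \<in> constrained_loops A p H.
     \<forall>X\<in>constrained_tangent A p H \<gamma>. loop_differential A p (action A lam) \<gamma> X = 0}"

definition constraint_factor :: "('a::topological_space, 'e::euclidean_space) chart set \<Rightarrow> real \<Rightarrow>
    ('a, 'e) one_form \<Rightarrow> ('a, 'e) two_form \<Rightarrow> ('a, 'e) endo_field \<Rightarrow> ('a \<Rightarrow> real) \<Rightarrow>
    (real \<Rightarrow> 'a) \<Rightarrow> real" where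
  "constraint_factor A p lam om J H \<gamma> =
     (let gradH = (\<lambda>t. gradient A (compatible_metric om J) H (\<gamma> t))
      in - loop_differential A p (action A lam) \<gamma> gradH
           / loop_differential A p (mean_energy H) \<gamma> gradH)"

definition rabinowitz_action :: "('a, 'e::euclidean_space) chart set \<Rightarrow> ('a, 'e) one_form \<Rightarrow>
    ('a \<Rightarrow> real) \<Rightarrow> (real \<Rightarrow> 'a) \<times> real \<Rightarrow> real" where
  "rabinowitz_action A lam H = (\<lambda>(\<gamma>, \<tau>). action A lam \<gamma> + \<tau> * mean_energy H \<gamma>)"

definition crit_rabinowitz :: "('a::topological_space, 'e::euclidean_space) chart set \<Rightarrow> real \<Rightarrow>
    ('a, 'e) one_form \<Rightarrow> ('a \<Rightarrow> real) \<Rightarrow> ((real \<Rightarrow> 'a) \<times> real) set" where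
  "crit_rabinowitz A p lam H = {(\<gamma>, \<tau>). \<gamma> \<in> loop_space A p \<and>
     (\<forall>X\<in>loop_tangent A p \<gamma>. \<forall>l.
        ext_differential A p (rabinowitz_action A lam H) (\<gamma>, \<tau>) (X, l) = 0)}"

end

(* On loops, d a (X) = int om(gamma', X) and d h (X) = int dH(X), and d A (X, l) = d a (X) + tau d h (X) + h l.
   A critical point (gamma, tau) therefore satisfies h = 0 and d a = - tau d h; in particular d a vanishes on the
   kernel of d h, and evaluation at grad H, where d h is positive because 0 is a regular value attained by H along
   gamma, determines tau. Conversely, every X is the sum of a multiple of grad H and an element of ker d h.

   The differentials are characterised by derivatives along paths of loops. They are unique because a partition
   of unity on the circle writes every X as a sum of fields supported in one chart, and such a field is the
   velocity of a straight line in that chart. They exist by a computation in charts on short intervals, where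
   Stokes' formula for d lam = om leaves boundary terms that telescope around the circle. That grad H is an
   admissible field along gamma follows from its C^1 regularity, obtained from that of the metric and dH. *)
theory Submission
  imports Defs
begin

section \<open>Calculus of continuously differentiable and Sobolev functions\<close>

text \<open>\<open>loop_differential\<close> and \<open>ext_differential\<close> are choices by
  \<open>SOME\<close>: nothing is known of them until one functional with the defining property is
  exhibited and all such functionals are shown to agree on \<open>loop_tangent\<close>. Only then do
  the critical point conditions become conditions on explicit integrals, and the equivalence is
  linear algebra. Two obstacles shape the analysis. A loop lies in no single chart, and its velocity
  exists only almost everywhere. The first is met by Bolzano's bisection principle: a property of
  intervals that passes to the union of adjacent intervals and holds on all short intervals around
  each point holds on every interval. Sobolev regularity, the chain rule, integrability and the
  derivatives of both functionals are glued in this way. The second is met by carrying a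
  representative of the weak derivative separately from the function (\<open>sobolev_deriv\<close>)
  and by changing integrands on null sets.\<close>

definition C1_on :: "'e::euclidean_space set \<Rightarrow> ('e \<Rightarrow> 'f::real_normed_vector) \<Rightarrow> ('e \<Rightarrow> 'e \<Rightarrow> 'f) \<Rightarrow> bool" where
  "C1_on S f f' \<longleftrightarrow> (\<forall>x\<in>S. (f has_derivative f' x) (at x)) \<and> (\<forall>v. continuous_on S (\<lambda>x. f' x v))"

lemma smooth_on_imp_C1_on:
  assumes "smooth_on S f"
  shows "C1_on S f (\<lambda>x. frechet_derivative f (at x))"
proof -
  have "Ck_on (Suc 0) S f" using assms by (auto simp: smooth_on_def simp del: Ck_on.simps)
  then show ?thesis by (simp add: C1_on_def frechet_derivative_works)
qed

lemma smooth_on_frechet_derivative: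
  assumes "smooth_on S f"
  shows "smooth_on S (\<lambda>x. frechet_derivative f (at x) v)"
  unfolding smooth_on_def
proof
  fix k
  have "Ck_on (Suc k) S f" using assms by (auto simp: smooth_on_def simp del: Ck_on.simps)
  then show "Ck_on k S (\<lambda>x. frechet_derivative f (at x) v)" by simp
qed

lemma C1_on_linear: "C1_on S f f' \<Longrightarrow> x \<in> S \<Longrightarrow> linear (f' x)"
  unfolding C1_on_def using has_derivative_linear by blast

lemma C1_on_imp_continuous_on: "C1_on S f f' \<Longrightarrow> continuous_on S f"
  by (meson C1_on_def continuous_at_imp_continuous_on has_derivative_continuous)

text \<open>\<open>Ck_on\<close> supplies continuity of the derivative one direction at a time. In
  finite dimension this is continuity into the normed space of bounded linear maps, where
  compactness gives operator bounds and uniform continuity.\<close>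

lemma C1_on_blinfun:
  fixes f :: "'e::euclidean_space \<Rightarrow> 'f::real_normed_vector"
  assumes "C1_on S f f'"
  shows "\<And>x. x \<in> S \<Longrightarrow> blinfun_apply (Blinfun (f' x)) = f' x"
    and "continuous_on S (\<lambda>x. Blinfun (f' x))"
proof -
  show *: "blinfun_apply (Blinfun (f' x)) = f' x" if "x \<in> S" for x
    using assms that by (intro bounded_linear_Blinfun_apply) (auto simp: C1_on_def has_derivative_bounded_linear)
  show "continuous_on S (\<lambda>x. Blinfun (f' x))"
  proof (rule continuous_on_blinfun_componentwise)
    fix i :: 'e assume "i \<in> Basis"
    have "continuous_on S (\<lambda>x. f' x i)" using assms by (simp add: C1_on_def)
    then show "continuous_on S (\<lambda>x. blinfun_apply (Blinfun (f' x)) i)"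
      by (subst continuous_on_cong[OF refl, where g = "\<lambda>x. f' x i"]) (auto simp: *)
  qed
qed

lemma C1_on_continuous_derivative:
  assumes "C1_on S f f'" "continuous_on T g" "continuous_on T h" "g ` T \<subseteq> S"
  shows "continuous_on T (\<lambda>t. f' (g t) (h t))"
proof -
  have "continuous_on T (\<lambda>t. blinfun_apply (Blinfun (f' (g t))) (h t))"
    by (intro continuous_intros assms continuous_on_compose2[OF C1_on_blinfun(2)[OF assms(1)]])
  then show ?thesis
    using C1_on_blinfun(1)[OF assms(1)] assms(4)
    by (subst continuous_on_cong[OF refl, where g = "\<lambda>t. blinfun_apply (Blinfun (f' (g t))) (h t)"]) auto
qed

text \<open>The derivative is uniformly continuous on a compact neighbourhood of \<open>K\<close>
  inside \<open>S\<close>; the mean value inequality on small balls turns this into a first-order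
  Taylor estimate whose radius \<open>d\<close> does not depend on the base point.\<close>

lemma C1_on_uniform_derivative:
  fixes f :: "'e::euclidean_space \<Rightarrow> 'f::real_normed_vector"
  assumes C1: "C1_on S f f'" and S: "open S" and K: "compact K" "K \<subseteq> S" and e: "e > 0"
  obtains d where "d > 0"
    "\<And>y z. y \<in> K \<Longrightarrow> dist z y < d \<Longrightarrow> z \<in> S \<and> norm (f z - f y - f' y (z - y)) \<le> e * norm (z - y)"
proof -
  obtain r where r: "r > 0" "(\<Union>x\<in>K. cball x r) \<subseteq> S"
    using compact_subset_open_imp_cball_epsilon_subset[OF K(1) S K(2)] .
  \<comment> \<open>The closed \<open>r\<close>-neighbourhood of \<open>K\<close>, written as a sum
    of two compact sets so that it is visibly compact.\<close>
  define K' where "K' = {x + y |x y. x \<in> K \<and> y \<in> cball 0 r}"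
  have K': "compact K'" unfolding K'_def by (intro compact_sums K compact_cball)
  have inK': "z \<in> K'" if "y \<in> K" "dist z y \<le> r" for y z
  proof -
    have "z = y + (z - y) \<and> y \<in> K \<and> z - y \<in> cball 0 r" using that by (simp add: dist_norm norm_minus_commute)
    then show ?thesis unfolding K'_def by blast
  qed
  have "K' \<subseteq> S"
  proof
    fix z assume "z \<in> K'"
    then obtain x y where "z = x + y" "x \<in> K" "norm y \<le> r" by (auto simp: K'_def)
    then have "z \<in> cball x r" by (simp add: dist_norm)
    then show "z \<in> S" using r \<open>x \<in> K\<close> by blast
  qed
  let ?F = "\<lambda>x. Blinfun (f' x)"
  have "uniformly_continuous_on K' ?F"
    using compact_uniformly_continuous[OF continuous_on_subset[OF C1_on_blinfun(2)[OF C1] \<open>K' \<subseteq> S\<close>] K'] .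
  then obtain d where d: "d > 0" "\<And>x y. x \<in> K' \<Longrightarrow> y \<in> K' \<Longrightarrow> dist y x < d \<Longrightarrow> dist (?F y) (?F x) < e"
    unfolding uniformly_continuous_on_def using e by meson
  show ?thesis
  proof (rule that[of "min d r"])
    show "min d r > 0" using d r by simp
    fix y z assume y: "y \<in> K" and z: "dist z y < min d r"
    have "z \<in> K'" using inK' y z by simp
    moreover have "norm (f z - f y - f' y (z - y)) \<le> norm (z - y) * e"
    proof (rule differentiable_bound_linearization[where S = "ball y (min d r)"])
      show "y + t *\<^sub>R (z - y) \<in> ball y (min d r)" if "t \<in> {0..1}" for t
      proof -
        have "norm (t *\<^sub>R (z - y)) \<le> norm (z - y)" using that by (simp add: mult_left_le_one_le)
        then show ?thesis using z by (simp add: dist_norm norm_minus_commute)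
      qed
      show "y \<in> ball y (min d r)" using d r by simp
      fix x assume x: "x \<in> ball y (min d r)"
      then have xK: "x \<in> K'" using inK' y by (simp add: dist_commute)
      have yK: "y \<in> K'" using inK' y r by simp
      show "(f has_derivative f' x) (at x within ball y (min d r))"
        using C1 xK \<open>K' \<subseteq> S\<close> by (auto simp: C1_on_def intro: has_derivative_at_withinI)
      have "norm (?F x - ?F y) < e" using d(2)[OF yK xK] x by (simp add: dist_norm norm_minus_commute)
      then have "onorm (blinfun_apply (?F x - ?F y)) \<le> e"
        by (simp add: norm_blinfun.rep_eq)
      moreover have "blinfun_apply (?F x - ?F y) = f' x - f' y"
        using C1_on_blinfun(1)[OF C1 subsetD[OF \<open>K' \<subseteq> S\<close> xK]] C1_on_blinfun(1)[OF C1 subsetD[OF \<open>K' \<subseteq> S\<close> yK]]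
        by (simp add: blinfun.diff_left fun_eq_iff)
      ultimately show "onorm (f' x - f' y) \<le> e" by simp
    qed
    ultimately show "z \<in> S \<and> norm (f z - f y - f' y (z - y)) \<le> e * norm (z - y)"
      using \<open>K' \<subseteq> S\<close> by (auto simp: mult.commute)
  qed
qed

text \<open>\<open>sobolev_on\<close> with an arbitrary representative \<open>g\<close> of the weak derivative instead of
  \<open>vector_derivative\<close>, whose values on the exceptional null set are junk.\<close>

definition sobolev_deriv :: "real \<Rightarrow> real \<Rightarrow> real \<Rightarrow> (real \<Rightarrow> 'e::euclidean_space) \<Rightarrow> (real \<Rightarrow> 'e) \<Rightarrow> bool" where
  "sobolev_deriv p a b u g \<longleftrightarrow>
     (\<exists>N. negligible N \<and> (\<forall>t\<in>{a..b} - N. (u has_vector_derivative g t) (at t))) \<and>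
     g absolutely_integrable_on {a..b} \<and> (\<lambda>t. norm (g t) powr p) integrable_on {a..b} \<and>
     (\<forall>t\<in>{a..b}. u t = u a + integral {a..t} g)"

section \<open>Sobolev functions on an interval: representatives, restriction and gluing\<close>

lemma AE_lebesgue_on_iff:
  "(AE t in lebesgue_on {a..b::real}. P t) \<longleftrightarrow> (\<exists>N. negligible N \<and> (\<forall>t\<in>{a..b} - N. P t))"
proof -
  have "(AE t in lebesgue_on {a..b}. P t) \<longleftrightarrow> {t. t \<in> {a..b} \<and> \<not> P t} \<in> null_sets lebesgue"
    by (subst AE_restrict_space_iff) (auto simp: completion.AE_iff_null_sets)
  also have "\<dots> \<longleftrightarrow> negligible {t. t \<in> {a..b} \<and> \<not> P t}" by (simp add: negligible_iff_null_sets)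
  also have "\<dots> \<longleftrightarrow> (\<exists>N. negligible N \<and> (\<forall>t\<in>{a..b} - N. P t))"
    by (rule iffI, blast) (auto elim!: negligible_subset)
  finally show ?thesis .
qed

lemma powr_ge_id: "1 \<le> p \<Longrightarrow> 0 \<le> x \<Longrightarrow> x \<le> 1 + x powr p" for x p :: real
proof (cases "x \<ge> 1")
  case True
  assume "1 \<le> p"
  then have "x powr 1 \<le> x powr p" using True by (intro powr_mono) auto
  then show ?thesis using True by simp
qed (auto intro: add_increasing2)

text \<open>On a bounded interval L^p lies in L^1, because x \<le> 1 + x powr p. This moves the
  Lebesgue condition \<open>Lp_on\<close> to the gauge integral, in which the fundamental theorem
  clause of \<open>sobolev_on\<close> is stated.\<close>

lemma Lp_on_iff:
  fixes g :: "real \<Rightarrow> 'e::euclidean_space"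
  assumes p: "p \<ge> 1"
  shows "Lp_on p a b g \<longleftrightarrow> g absolutely_integrable_on {a..b} \<and> (\<lambda>t. norm (g t) powr p) integrable_on {a..b}"
proof
  assume L: "Lp_on p a b g"
  then have i: "(\<lambda>t. norm (g t) powr p) integrable_on {a..b}"
    unfolding Lp_on_def by (intro integrable_on_lebesgue_on) auto
  have "g absolutely_integrable_on {a..b}"
  proof (rule measurable_bounded_by_integrable_imp_absolutely_integrable)
    show "(\<lambda>t. 1 + norm (g t) powr p) integrable_on {a..b}"
      using i by (intro integrable_add) (auto intro: integrable_const_ivl)
    show "norm (g x) \<le> 1 + norm (g x) powr p" for x using powr_ge_id[OF p] by simp
  qed (use L in \<open>auto simp: Lp_on_def\<close>)
  then show "g absolutely_integrable_on {a..b} \<and> (\<lambda>t. norm (g t) powr p) integrable_on {a..b}" using i by simp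
next
  assume R: "g absolutely_integrable_on {a..b} \<and> (\<lambda>t. norm (g t) powr p) integrable_on {a..b}"
  then have m: "g \<in> borel_measurable (lebesgue_on {a..b})"
    by (simp add: absolutely_integrable_imp_borel_measurable)
  have "(\<lambda>t. norm (g t) powr p) absolutely_integrable_on {a..b}"
    using R by (intro nonnegative_absolutely_integrable_1) auto
  then have "integrable (lebesgue_on {a..b}) (\<lambda>t. norm (g t) powr p)"
    by (intro absolutely_integrable_imp_integrable) auto
  with m show "Lp_on p a b g" by (simp add: Lp_on_def)
qed

lemma sobolev_deriv_eq:
  "sobolev_deriv p a b u g \<Longrightarrow> t \<in> {a..b} \<Longrightarrow> u t = u a + integral {a..t} g"
  unfolding sobolev_deriv_def by blast

lemma sobolev_deriv_cong_deriv:
  assumes "sobolev_deriv p a b u g" "negligible N" "\<And>t. t \<in> {a..b} - N \<Longrightarrow> h t = g t"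
  shows "sobolev_deriv p a b u h"
  unfolding sobolev_deriv_def
proof (intro conjI)
  obtain N' where N': "negligible N'" "\<forall>t\<in>{a..b} - N'. (u has_vector_derivative g t) (at t)"
    using assms(1) unfolding sobolev_deriv_def by blast
  show "\<exists>N. negligible N \<and> (\<forall>t\<in>{a..b} - N. (u has_vector_derivative h t) (at t))"
    using N' assms(2,3) by (intro exI[of _ "N \<union> N'"]) (auto intro: negligible_Un)
  show "h absolutely_integrable_on {a..b}"
    using assms by (auto simp: sobolev_deriv_def intro: absolutely_integrable_spike)
  show "(\<lambda>t. norm (h t) powr p) integrable_on {a..b}"
    using assms(1) unfolding sobolev_deriv_def
    by (auto intro!: integrable_spike[of "\<lambda>t. norm (g t) powr p" _ N "\<lambda>t. norm (h t) powr p"] assms(2) arg_cong[where f = "\<lambda>x. norm x powr p"] assms(3))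
  have "integral {a..t} g = integral {a..t} h" if "t \<in> {a..b}" for t
    using assms(2,3) that by (intro integral_spike) auto
  then show "\<forall>t\<in>{a..b}. u t = u a + integral {a..t} h"
    using sobolev_deriv_eq[OF assms(1)] by metis
qed

lemma sobolev_on_iff:
  assumes p: "p \<ge> 1"
  shows "sobolev_on p a b u \<longleftrightarrow> sobolev_deriv p a b u (\<lambda>t. vector_derivative u (at t))"
  unfolding sobolev_on_def sobolev_deriv_def Lp_on_iff[OF p] AE_lebesgue_on_iff
  by (auto simp: vector_derivative_works)

text \<open>Off a null set a representative \<open>g\<close> equals
  \<open>vector_derivative u\<close>, so membership in the Sobolev space may be proved with
  whichever \<open>g\<close> a construction produces.\<close>

lemma sobolev_deriv_imp_sobolev_on:
  assumes p: "p \<ge> 1" and "sobolev_deriv p a b u g"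
  shows "sobolev_on p a b u"
proof -
  obtain N where N: "negligible N" "\<forall>t\<in>{a..b} - N. (u has_vector_derivative g t) (at t)"
    using assms(2) unfolding sobolev_deriv_def by blast
  show ?thesis unfolding sobolev_on_iff[OF p]
    by (rule sobolev_deriv_cong_deriv[OF assms(2) N(1)]) (use N in \<open>auto simp: vector_derivative_at\<close>)
qed

lemma sobolev_deriv_integrable:
  assumes "sobolev_deriv p a b u g"
  shows "g integrable_on {a..b}" "(\<lambda>t. norm (g t)) integrable_on {a..b}"
  using assms unfolding sobolev_deriv_def absolutely_integrable_on_def by blast+

lemma sobolev_deriv_powr_integrable:
  "sobolev_deriv p a b u g \<Longrightarrow> (\<lambda>t. norm (g t) powr p) integrable_on {a..b}"
  unfolding sobolev_deriv_def by blast

lemma sobolev_deriv_increment: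
  assumes "sobolev_deriv p a b u g" "a \<le> s" "s \<le> t" "t \<le> b"
  shows "u t - u s = integral {s..t} g"
proof -
  have "integral {a..s} g + integral {s..t} g = integral {a..t} g"
    using assms sobolev_deriv_integrable(1)[OF assms(1)]
    by (intro Henstock_Kurzweil_Integration.integral_combine) (auto intro: integrable_subinterval_real)
  moreover have "u s = u a + integral {a..s} g" "u t = u a + integral {a..t} g"
    by (rule sobolev_deriv_eq[OF assms(1)], use assms(2-) in simp)+
  ultimately show ?thesis by (metis add_diff_cancel_left add_diff_cancel_left')
qed

lemma sobolev_deriv_continuous_on:
  assumes "sobolev_deriv p a b u g"
  shows "continuous_on {a..b} u"
proof -
  have "continuous_on {a..b} (\<lambda>t. u a + integral {a..t} g)"
    by (intro continuous_intros indefinite_integral_continuous_1 sobolev_deriv_integrable[OF assms])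
  then show ?thesis
    by (subst continuous_on_cong[OF refl, where g = "\<lambda>t. u a + integral {a..t} g"])
      (use sobolev_deriv_eq[OF assms] in blast)+
qed

lemma sobolev_deriv_subinterval:
  assumes "sobolev_deriv p a b u g" "a \<le> c" "d \<le> b"
  shows "sobolev_deriv p c d u g"
  unfolding sobolev_deriv_def
proof (intro conjI)
  have sub: "{c..d} \<subseteq> {a..b}" using assms by auto
  show "\<exists>N. negligible N \<and> (\<forall>t\<in>{c..d} - N. (u has_vector_derivative g t) (at t))"
    using assms(1) sub unfolding sobolev_deriv_def by blast
  show "g absolutely_integrable_on {c..d}"
    using assms(1) sub by (auto simp: sobolev_deriv_def intro: absolutely_integrable_on_subinterval)
  show "(\<lambda>t. norm (g t) powr p) integrable_on {c..d}"
    using assms(1) sub by (auto simp: sobolev_deriv_def intro: integrable_subinterval_real)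
  show "\<forall>t\<in>{c..d}. u t = u c + integral {c..t} g"
  proof
    fix t assume "t \<in> {c..d}"
    then show "u t = u c + integral {c..t} g"
      using sobolev_deriv_increment[OF assms(1,2), of t] assms(3) by (simp add: algebra_simps)
  qed
qed

lemma sobolev_deriv_join:
  assumes "sobolev_deriv p a b u g" "sobolev_deriv p b c u g" "a \<le> b" "b \<le> c"
  shows "sobolev_deriv p a c u g"
  unfolding sobolev_deriv_def
proof (intro conjI)
  obtain N1 where N1: "negligible N1" "\<forall>t\<in>{a..b} - N1. (u has_vector_derivative g t) (at t)"
    using assms unfolding sobolev_deriv_def by blast
  obtain N2 where N2: "negligible N2" "\<forall>t\<in>{b..c} - N2. (u has_vector_derivative g t) (at t)"
    using assms unfolding sobolev_deriv_def by blast
  have eq: "{a..c} = {a..b} \<union> {b..c}" using assms by auto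
  show "\<exists>N. negligible N \<and> (\<forall>t\<in>{a..c} - N. (u has_vector_derivative g t) (at t))"
    using N1 N2 unfolding eq by (intro exI[of _ "N1 \<union> N2"]) (auto intro: negligible_Un)
  have gi: "g integrable_on {a..c}" "(\<lambda>t. norm (g t)) integrable_on {a..c}"
    using assms by (auto intro: Henstock_Kurzweil_Integration.integrable_combine[of a b c] sobolev_deriv_integrable)
  then show "g absolutely_integrable_on {a..c}" by (simp add: absolutely_integrable_on_def)
  show "(\<lambda>t. norm (g t) powr p) integrable_on {a..c}"
    using assms by (auto intro: Henstock_Kurzweil_Integration.integrable_combine[of a b c] sobolev_deriv_powr_integrable)
  show "\<forall>t\<in>{a..c}. u t = u a + integral {a..t} g"
  proof
    fix t assume t: "t \<in> {a..c}"
    show "u t = u a + integral {a..t} g"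
    proof (cases "t \<le> b")
      case True
      with t show ?thesis by (intro sobolev_deriv_eq[OF assms(1)]) auto
    next
      case False
      have "integral {a..b} g + integral {b..t} g = integral {a..t} g"
        using False t gi(1) assms by (intro Henstock_Kurzweil_Integration.integral_combine) (auto intro: integrable_subinterval_real)
      moreover have "u t = u b + integral {b..t} g"
        by (rule sobolev_deriv_eq[OF assms(2)]) (use False t in simp)
      moreover have "u b = u a + integral {a..b} g"
        by (rule sobolev_deriv_eq[OF assms(1)]) (use assms(3) in simp)
      ultimately show ?thesis by (metis add.assoc)
    qed
  qed
qed

text \<open>The representative \<open>vector_derivative u\<close> does not depend on the interval,
  so adjacent pieces join and Bolzano's principle applies. The test intervals are cut off at
  \<open>a\<close> and \<open>b\<close> because nothing is assumed beyond them.\<close>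

lemma sobolev_on_local:
  fixes u :: "real \<Rightarrow> 'e::euclidean_space"
  assumes p: "p \<ge> 1" and ab: "a \<le> b"
    and loc: "\<And>x. x \<in> {a..b} \<Longrightarrow> \<exists>d>0. sobolev_on p (max a (x - d)) (min b (x + d)) u"
  shows "sobolev_on p a b u"
proof -
  have "a \<le> a \<longrightarrow> b \<le> b \<longrightarrow> sobolev_deriv p a b u (\<lambda>t. vector_derivative u (at t))"
  \<comment> \<open>Bolzano's principle ranges over all real intervals; the two guards confine it to
    subintervals of {a..b}.\<close>
  proof (rule Bolzano[OF ab, where P = "\<lambda>s t. a \<le> s \<longrightarrow> t \<le> b \<longrightarrow> sobolev_deriv p s t u (\<lambda>t. vector_derivative u (at t))"])
    fix x assume "a \<le> x" "x \<le> b"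
    then obtain d where d: "d > 0" "sobolev_on p (max a (x - d)) (min b (x + d)) u" using loc by auto
    then have *: "sobolev_deriv p (max a (x - d)) (min b (x + d)) u (\<lambda>t. vector_derivative u (at t))"
      by (simp add: sobolev_on_iff[OF p])
    show "\<exists>d>0. \<forall>s t. s \<le> x \<and> x \<le> t \<and> t - s < d \<longrightarrow> a \<le> s \<longrightarrow> t \<le> b \<longrightarrow>
         sobolev_deriv p s t u (\<lambda>t. vector_derivative u (at t))"
      using d(1) by (intro exI[of _ d]) (auto intro!: sobolev_deriv_subinterval[OF *])
  qed (auto intro: sobolev_deriv_join)
  then show ?thesis by (simp add: sobolev_on_iff[OF p])
qed

lemma sobolev_deriv_cong:
  assumes "sobolev_deriv p a b u g" "\<And>t. t \<in> {a..b} \<Longrightarrow> v t = u t"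
  shows "sobolev_deriv p a b v g"
proof (cases "a \<le> b")
  case True
  obtain N where N: "negligible N" "\<forall>t\<in>{a..b} - N. (u has_vector_derivative g t) (at t)"
    using assms unfolding sobolev_deriv_def by blast
  \<comment> \<open>The derivative \<open>at t\<close> is two-sided, and agreement on the closed
    interval says nothing about it at the endpoints; these join the null set.\<close>
  have "(v has_vector_derivative g t) (at t)" if "t \<in> {a..b} - (N \<union> {a,b})" for t
  proof (rule has_vector_derivative_transform_within_open[where S = "{a<..<b}"])
    show "(u has_vector_derivative g t) (at t)" using N that by auto
    show "u x = v x" if "x \<in> {a<..<b}" for x using assms that by auto
  qed (use that in auto)
  moreover have "negligible (N \<union> {a,b})" using N by (intro negligible_Un) auto
  moreover have "v t = v a + integral {a..t} g" if "t \<in> {a..b}" for t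
    using sobolev_deriv_eq[OF assms(1) that] assms(2)[OF that] assms(2)[of a] True
    by (metis atLeastAtMost_iff order_refl)
  ultimately show ?thesis using assms(1) unfolding sobolev_deriv_def by blast
qed (auto simp: sobolev_deriv_def)

lemma sobolev_on_cong:
  assumes p: "p \<ge> 1" and "\<And>t. t \<in> {a..b} \<Longrightarrow> v t = u t"
  shows "sobolev_on p a b v \<longleftrightarrow> sobolev_on p a b u"
proof
  assume "sobolev_on p a b v"
  then have "sobolev_deriv p a b v (\<lambda>t. vector_derivative v (at t))" by (simp only: sobolev_on_iff[OF p])
  then have "sobolev_deriv p a b u (\<lambda>t. vector_derivative v (at t))"
    by (rule sobolev_deriv_cong) (rule assms(2)[symmetric])
  then show "sobolev_on p a b u" by (rule sobolev_deriv_imp_sobolev_on[OF p])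
next
  assume "sobolev_on p a b u"
  then have "sobolev_deriv p a b u (\<lambda>t. vector_derivative u (at t))" by (simp only: sobolev_on_iff[OF p])
  then have "sobolev_deriv p a b v (\<lambda>t. vector_derivative u (at t))"
    by (rule sobolev_deriv_cong) (rule assms(2))
  then show "sobolev_on p a b v" by (rule sobolev_deriv_imp_sobolev_on[OF p])
qed

lemma powr_add_le:
  assumes "0 \<le> x" "0 \<le> y" "0 \<le> (p::real)"
  shows "(x + y) powr p \<le> 2 powr p * (x powr p + y powr p)"
proof -
  have "(x + y) powr p \<le> (2 * max x y) powr p" using assms by (intro powr_mono2) auto
  also have "\<dots> = 2 powr p * max x y powr p" using assms by (simp add: powr_mult)
  also have "max x y powr p \<le> x powr p + y powr p" by (simp add: max_def)
  finally show ?thesis by simp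
qed

lemma powr_integrable_bound:
  fixes h :: "real \<Rightarrow> 'e::euclidean_space"
  assumes "h absolutely_integrable_on {a..b}" "k integrable_on {a..b}"
    and "\<And>t. t \<in> {a..b} \<Longrightarrow> norm (h t) powr p \<le> k t"
  shows "(\<lambda>t. norm (h t) powr p) integrable_on {a..b}"
proof (rule measurable_bounded_by_integrable_imp_integrable)
  show "(\<lambda>t. norm (h t) powr p) \<in> borel_measurable (lebesgue_on {a..b})"
    using absolutely_integrable_imp_borel_measurable[OF assms(1)] by (intro powr_real_measurable) auto
qed (use assms in auto)

section \<open>The chain rule for Sobolev functions and its consequences\<close>

lemma has_vector_derivative_compose_has_derivative:
  fixes u :: "real \<Rightarrow> 'e::real_normed_vector"
  assumes "(u has_vector_derivative g) (at t)" "(\<phi> has_derivative D) (at (u t))"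
  shows "((\<lambda>t. \<phi> (u t)) has_vector_derivative D g) (at t)"
proof -
  have "((\<lambda>t. \<phi> (u t)) has_derivative (\<lambda>h. D (h *\<^sub>R g))) (at t)"
    by (rule has_derivative_compose[OF assms(1)[unfolded has_vector_derivative_def] assms(2)])
  then show ?thesis
    by (simp only: has_vector_derivative_def linear_scale[OF has_derivative_linear[OF assms(2)]])
qed

text \<open>Expanding \<open>g t\<close> in the basis gives a finite sum of integrable scalars times
  continuous, hence bounded, vectors. The constant of the second claim bounds the operator norms
  over the compact interval.\<close>

lemma C1_on_derivative_along:
  fixes u :: "real \<Rightarrow> 'e::euclidean_space" and \<phi> :: "'e \<Rightarrow> 'f::euclidean_space"
  assumes C1: "C1_on S \<phi> \<phi>'" and u: "continuous_on {a..b} u" "u ` {a..b} \<subseteq> S"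
    and g: "g absolutely_integrable_on {a..b}"
  shows "(\<lambda>t. \<phi>' (u t) (g t)) absolutely_integrable_on {a..b}"
    and "\<exists>C\<ge>0. \<forall>t\<in>{a..b}. \<forall>v. norm (\<phi>' (u t) v) \<le> C * norm v"
proof -
  let ?F = "\<lambda>t. Blinfun (\<phi>' (u t))"
  have F: "continuous_on {a..b} ?F"
    by (rule continuous_on_compose2[OF C1_on_blinfun(2)[OF C1] u(1) u(2)])
  have app: "blinfun_apply (?F t) = \<phi>' (u t)" if "t \<in> {a..b}" for t
    using C1_on_blinfun(1)[OF C1] u(2) that by blast
  have "bounded (?F ` {a..b})" by (intro compact_imp_bounded compact_continuous_image F) auto
  then obtain C where C: "C > 0" "\<And>t. t \<in> {a..b} \<Longrightarrow> norm (?F t) \<le> C"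
    by (auto simp: bounded_pos)
  have "norm (\<phi>' (u t) v) \<le> C * norm v" if "t \<in> {a..b}" for t v
    using norm_blinfun[of "?F t" v] app[OF that] C(2)[OF that]
    by (metis mult_right_mono norm_ge_zero order_trans)
  then show "\<exists>C\<ge>0. \<forall>t\<in>{a..b}. \<forall>v. norm (\<phi>' (u t) v) \<le> C * norm v" using C by (intro exI[of _ C]) auto
  have "(\<lambda>t. \<Sum>i\<in>Basis. (g t \<bullet> i) *\<^sub>R \<phi>' (u t) i) absolutely_integrable_on {a..b}"
  proof (rule absolutely_integrable_sum)
    fix i :: 'e assume i: "i \<in> Basis"
    have gi: "(\<lambda>t. g t \<bullet> i) absolutely_integrable_on {a..b}"
      using absolutely_integrable_linear[OF g bounded_linear_inner_left] by (simp add: o_def)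
    have c: "continuous_on {a..b} (\<lambda>t. \<phi>' (u t) i)"
      by (rule C1_on_continuous_derivative[OF C1 u(1) continuous_on_const u(2)])
    have bil: "bilinear (\<lambda>(x::'f) (y::real). y *\<^sub>R x)"
      by (auto simp: bilinear_def algebra_simps intro!: linearI)
    show "(\<lambda>t. (g t \<bullet> i) *\<^sub>R \<phi>' (u t) i) absolutely_integrable_on {a..b}"
      by (rule absolutely_integrable_bounded_measurable_product[OF bil _ _ _ gi])
        (auto intro!: continuous_imp_measurable_on_sets_lebesgue c compact_imp_bounded compact_continuous_image)
  qed simp
  moreover have "(\<Sum>i\<in>Basis. (g t \<bullet> i) *\<^sub>R \<phi>' (u t) i) = \<phi>' (u t) (g t)" if "t \<in> {a..b}" for t
  proof -
    have "linear (\<phi>' (u t))" using C1_on_linear[OF C1] u(2) that by blast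
    then have "\<phi>' (u t) (\<Sum>i\<in>Basis. (g t \<bullet> i) *\<^sub>R i) = (\<Sum>i\<in>Basis. (g t \<bullet> i) *\<^sub>R \<phi>' (u t) i)"
      by (simp add: linear_sum linear_scale)
    then show ?thesis by (simp add: euclidean_representation)
  qed
  ultimately show "(\<lambda>t. \<phi>' (u t) (g t)) absolutely_integrable_on {a..b}"
    by (auto intro: absolutely_integrable_spike[OF _ negligible_empty])
qed

text \<open>The error of the fundamental theorem for \<open>\<phi> \<circ> u\<close> is additive over intervals and on short
  intervals at most \<open>\<epsilon> \<integral> \<bar>g\<bar>\<close>, hence zero: no differentiation theorem is needed.\<close>

lemma sobolev_deriv_compose:
  fixes u :: "real \<Rightarrow> 'e::euclidean_space" and \<phi> :: "'e \<Rightarrow> 'f::euclidean_space"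
  assumes p: "p \<ge> 1" and u: "sobolev_deriv p a b u g" and S: "open S" "u ` {a..b} \<subseteq> S"
    and C1: "C1_on S \<phi> \<phi>'"
  shows "sobolev_deriv p a b (\<lambda>t. \<phi> (u t)) (\<lambda>t. \<phi>' (u t) (g t))"
proof -
  let ?G = "\<lambda>t. \<phi>' (u t) (g t)"
  let ?E = "\<lambda>s t. \<phi> (u t) - \<phi> (u s) - integral {s..t} ?G" and ?V = "\<lambda>s t. integral {s..t} (\<lambda>r. norm (g r))"
  have cu: "continuous_on {a..b} u" by (rule sobolev_deriv_continuous_on[OF u])
  have g: "g absolutely_integrable_on {a..b}" using u unfolding sobolev_deriv_def by blast
  have gn: "(\<lambda>t. norm (g t)) integrable_on {a..b}" by (rule sobolev_deriv_integrable(2)[OF u])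
  have G: "?G absolutely_integrable_on {a..b}"
    by (rule C1_on_derivative_along(1)[OF C1 cu S(2) g])
  then have Gi: "?G integrable_on {a..b}" by (simp add: absolutely_integrable_on_def)
  obtain C where C: "C \<ge> 0" "\<And>t v. t \<in> {a..b} \<Longrightarrow> norm (\<phi>' (u t) v) \<le> C * norm v"
    using C1_on_derivative_along(2)[OF C1 cu S(2) g] by blast
  have lin: "linear (\<phi>' (u t))" if "t \<in> {a..b}" for t
    using C1_on_linear[OF C1] S(2) that by blast
  have short: "\<exists>\<eta>>0. \<forall>s t. a \<le> s \<and> s \<le> t \<and> t \<le> b \<and> t - s < \<eta> \<longrightarrow>
      norm (?E s t) \<le> e * ?V s t"
    if "e > 0" for e
  proof -
    have "compact (u ` {a..b})" by (intro compact_continuous_image cu) auto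
    from C1_on_uniform_derivative[OF C1 S(1) this S(2), of "e/2"] \<open>e > 0\<close>
    obtain d where d: "d > 0" "\<And>y z. y \<in> u ` {a..b} \<Longrightarrow> dist z y < d \<Longrightarrow>
        norm (\<phi> z - \<phi> y - \<phi>' y (z - y)) \<le> e/2 * norm (z - y)" by (metis half_gt_zero)
    have "uniformly_continuous_on {a..b} u" by (intro compact_uniformly_continuous cu) auto
    then obtain d1 where d1: "d1 > 0" "\<And>s t. s \<in> {a..b} \<Longrightarrow> t \<in> {a..b} \<Longrightarrow> dist t s < d1 \<Longrightarrow> dist (u t) (u s) < d"
      unfolding uniformly_continuous_on_def using d(1) by meson
    let ?F = "\<lambda>t. Blinfun (\<phi>' (u t))"
    have "continuous_on {a..b} ?F"
      by (rule continuous_on_compose2[OF C1_on_blinfun(2)[OF C1] cu S(2)])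
    then have "uniformly_continuous_on {a..b} ?F" by (intro compact_uniformly_continuous) auto
    then obtain d2 where d2: "d2 > 0" "\<And>s t. s \<in> {a..b} \<Longrightarrow> t \<in> {a..b} \<Longrightarrow> dist t s < d2 \<Longrightarrow> dist (?F t) (?F s) < e/2"
      unfolding uniformly_continuous_on_def using \<open>e > 0\<close> half_gt_zero by meson
    have app: "blinfun_apply (?F t) = \<phi>' (u t)" if "t \<in> {a..b}" for t
      using C1_on_blinfun(1)[OF C1] S(2) that by blast
    show ?thesis
    proof (intro exI[of _ "min d1 d2"] conjI allI impI)
      show "min d1 d2 > 0" using d1 d2 by simp
      fix s t assume st: "a \<le> s \<and> s \<le> t \<and> t \<le> b \<and> t - s < min d1 d2"
      then have sI: "s \<in> {a..b}" and tI: "t \<in> {a..b}" and sub: "{s..t} \<subseteq> {a..b}" by auto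
      have gst: "g integrable_on {s..t}" "(\<lambda>r. norm (g r)) integrable_on {s..t}" "?G integrable_on {s..t}"
        using integrable_subinterval_real sub sobolev_deriv_integrable[OF u] Gi by blast+
      have inc: "u t - u s = integral {s..t} g" using sobolev_deriv_increment[OF u] st by blast
      have "norm (u t - u s) \<le> ?V s t"
        unfolding inc by (intro Henstock_Kurzweil_Integration.integral_norm_bound_integral gst) auto
      moreover have "norm (\<phi> (u t) - \<phi> (u s) - \<phi>' (u s) (u t - u s)) \<le> e/2 * norm (u t - u s)"
        using d(2)[of "u s" "u t"] d1(2)[OF sI tI] st sI by (auto simp: dist_real_def)
      ultimately have A: "norm (\<phi> (u t) - \<phi> (u s) - \<phi>' (u s) (u t - u s)) \<le> e/2 * ?V s t"
        using \<open>e > 0\<close> by (smt (verit, best) half_gt_zero mult_left_mono)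
      have bl: "bounded_linear (\<phi>' (u s))" using lin[OF sI] by (simp add: linear_conv_bounded_linear)
      have eq: "\<phi>' (u s) (u t - u s) = integral {s..t} (\<lambda>r. \<phi>' (u s) (g r))"
        unfolding inc using integral_linear[OF gst(1) bl] by (simp add: o_def)
      have gs: "(\<lambda>r. \<phi>' (u s) (g r)) integrable_on {s..t}"
        using integrable_linear[OF gst(1) bl] by (simp add: o_def)
      have "\<phi>' (u s) (u t - u s) - integral {s..t} ?G = integral {s..t} (\<lambda>r. \<phi>' (u s) (g r) - ?G r)"
        unfolding eq using gs gst(3) by (rule Henstock_Kurzweil_Integration.integral_diff[symmetric])
      moreover have "norm (integral {s..t} (\<lambda>r. \<phi>' (u s) (g r) - ?G r)) \<le> integral {s..t} (\<lambda>r. e/2 * norm (g r))"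
      proof (rule Henstock_Kurzweil_Integration.integral_norm_bound_integral)
        show "(\<lambda>r. \<phi>' (u s) (g r) - ?G r) integrable_on {s..t}"
          by (intro Henstock_Kurzweil_Integration.integrable_diff gs gst(3))
        show "(\<lambda>r. e/2 * norm (g r)) integrable_on {s..t}" using gst(2) by (rule integrable_on_mult_right)
        fix r assume r: "r \<in> {s..t}"
        then have rI: "r \<in> {a..b}" using sub by blast
        have "norm (blinfun_apply (?F s - ?F r) (g r)) \<le> norm (?F s - ?F r) * norm (g r)" by (rule norm_blinfun)
        also have "\<dots> \<le> e/2 * norm (g r)"
          using d2(2)[OF sI rI] r st by (intro mult_right_mono) (auto simp: dist_norm norm_minus_commute)
        finally show "norm (\<phi>' (u s) (g r) - ?G r) \<le> e/2 * norm (g r)"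
          using app sI rI by (simp add: blinfun.diff_left)
      qed
      ultimately have B: "norm (\<phi>' (u s) (u t - u s) - integral {s..t} ?G) \<le> e/2 * ?V s t"
        by simp
      have "\<phi> (u t) - \<phi> (u s) - integral {s..t} ?G = (\<phi> (u t) - \<phi> (u s) - \<phi>' (u s) (u t - u s)) +
          (\<phi>' (u s) (u t - u s) - integral {s..t} ?G)" by simp
      then show "norm (?E s t) \<le> e * ?V s t"
        using norm_triangle_ineq[of "\<phi> (u t) - \<phi> (u s) - \<phi>' (u s) (u t - u s)" "\<phi>' (u s) (u t - u s) - integral {s..t} ?G"] A B
        by simp
    qed
  qed
  \<comment> \<open>The bound on short intervals is additive on both sides, so Bolzano's principle
    extends it with the same \<open>e\<close>.\<close>
  have long: "norm (?E a t) \<le> e * ?V a t"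
    if e: "e > 0" and t: "t \<in> {a..b}" for e t
  proof -
    obtain \<eta> where \<eta>: "\<eta> > 0" "\<And>s t. a \<le> s \<Longrightarrow> s \<le> t \<Longrightarrow> t \<le> b \<Longrightarrow> t - s < \<eta> \<Longrightarrow>
      norm (?E s t) \<le> e * ?V s t"
      using short[OF e] by blast
    have "a \<le> t" using t by simp
    then have "a \<le> a \<longrightarrow> t \<le> b \<longrightarrow> norm (?E a t) \<le> e * ?V a t"
    proof (rule Bolzano[where P = "\<lambda>s t. a \<le> s \<longrightarrow> t \<le> b \<longrightarrow>
          norm (?E s t) \<le> e * ?V s t"])
      fix x y z :: real
      assume xy: "a \<le> x \<longrightarrow> y \<le> b \<longrightarrow> norm (?E x y) \<le> e * ?V x y"
        and yz: "a \<le> y \<longrightarrow> z \<le> b \<longrightarrow> norm (?E y z) \<le> e * ?V y z"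
        and le: "x \<le> y" "y \<le> z"
      show "a \<le> x \<longrightarrow> z \<le> b \<longrightarrow> norm (?E x z) \<le> e * ?V x z"
      proof (intro impI)
        assume b: "a \<le> x" "z \<le> b"
        have sub: "{x..z} \<subseteq> {a..b}" using b by auto
        have 1: "integral {x..y} ?G + integral {y..z} ?G = integral {x..z} ?G"
          by (rule Henstock_Kurzweil_Integration.integral_combine[OF le integrable_subinterval_real[OF Gi sub]])
        have 2: "?V x y + ?V y z = ?V x z"
          by (rule Henstock_Kurzweil_Integration.integral_combine[OF le integrable_subinterval_real[OF gn sub]])
        have "\<phi> (u z) - \<phi> (u x) - integral {x..z} ?G =
            (\<phi> (u y) - \<phi> (u x) - integral {x..y} ?G) + (\<phi> (u z) - \<phi> (u y) - integral {y..z} ?G)"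
          using 1 by (simp add: algebra_simps)
        also have "norm \<dots> \<le> e * ?V x y + e * ?V y z"
          using xy yz b le by (intro norm_triangle_mono) auto
        also have "\<dots> = e * ?V x z" using 2 by (metis distrib_left)
        finally show "norm (?E x z) \<le> e * ?V x z" .
      qed
    next
      fix x
      show "\<exists>d>0. \<forall>s t. s \<le> x \<and> x \<le> t \<and> t - s < d \<longrightarrow> a \<le> s \<longrightarrow> t \<le> b \<longrightarrow>
          norm (?E s t) \<le> e * ?V s t"
        using \<eta> by (intro exI[of _ \<eta>]) auto
    qed
    then show ?thesis using t by simp
  qed
  \<comment> \<open>Now \<open>e\<close> tends to 0; the denominator \<open>?I + 1\<close> avoids
    division by an integral that may vanish.\<close>
  have ftc: "\<phi> (u t) = \<phi> (u a) + integral {a..t} ?G" if t: "t \<in> {a..b}" for t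
  proof -
    let ?n = "norm (?E a t)" and ?I = "?V a t"
    have I: "?I \<ge> 0"
      by (intro Henstock_Kurzweil_Integration.integral_nonneg integrable_subinterval_real[OF gn]) (use t in auto)
    have "?n \<le> 0 + e" if "e > 0" for e
    proof -
      have "?n \<le> e / (?I + 1) * ?I" using long[OF _ t, of "e / (?I + 1)"] I that by simp
      also have "\<dots> \<le> e" using I that by (simp add: field_simps)
      finally show ?thesis by simp
    qed
    then have "?n \<le> 0" by (rule field_le_epsilon)
    then show ?thesis by (simp add: algebra_simps)
  qed
  show ?thesis
    unfolding sobolev_deriv_def
  proof (intro conjI ballI)
    obtain N where N: "negligible N" "\<forall>t\<in>{a..b} - N. (u has_vector_derivative g t) (at t)"
      using u unfolding sobolev_deriv_def by blast
    have "((\<lambda>t. \<phi> (u t)) has_vector_derivative ?G t) (at t)" if "t \<in> {a..b} - N" for t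
    proof (rule has_vector_derivative_compose_has_derivative[where u = u and \<phi> = \<phi>])
      show "(u has_vector_derivative g t) (at t)" using N that by blast
      have "u t \<in> S" using S(2) that by blast
      then show "(\<phi> has_derivative \<phi>' (u t)) (at (u t))" using C1 unfolding C1_on_def by blast
    qed
    then show "\<exists>N. negligible N \<and> (\<forall>t\<in>{a..b} - N. ((\<lambda>t. \<phi> (u t)) has_vector_derivative ?G t) (at t))"
      using N(1) by blast
    show "?G absolutely_integrable_on {a..b}" by (rule G)
    show "(\<lambda>t. norm (?G t) powr p) integrable_on {a..b}"
    proof (rule powr_integrable_bound[OF G])
      show "(\<lambda>t. C powr p * norm (g t) powr p) integrable_on {a..b}"
        by (intro integrable_on_mult_right sobolev_deriv_powr_integrable[OF u])
      show "norm (?G t) powr p \<le> C powr p * norm (g t) powr p" if "t \<in> {a..b}" for t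
        using C(1) C(2)[OF that, of "g t"] p
        by (subst powr_mult[symmetric]) (auto intro: powr_mono2)
    qed
    show "\<phi> (u t) = \<phi> (u a) + integral {a..t} ?G" if "t \<in> {a..b}" for t by (rule ftc[OF that])
  qed
qed

text \<open>Pairing reduces sums and bilinear products to the chain rule: they are C1 functions of
  the pair on the product space.\<close>

lemma sobolev_deriv_Pair:
  fixes u :: "real \<Rightarrow> 'e::euclidean_space" and v :: "real \<Rightarrow> 'f::euclidean_space"
  assumes p: "p \<ge> 1" and u: "sobolev_deriv p a b u g" and v: "sobolev_deriv p a b v h"
  shows "sobolev_deriv p a b (\<lambda>t. (u t, v t)) (\<lambda>t. (g t, h t))"
proof -
  have g: "g absolutely_integrable_on {a..b}" and h: "h absolutely_integrable_on {a..b}"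
    using u v unfolding sobolev_deriv_def by blast+
  have "((\<lambda>x. (x, 0::'f)) \<circ> g) absolutely_integrable_on {a..b}"
    by (intro absolutely_integrable_linear g bounded_linear_Pair bounded_linear_ident bounded_linear_zero)
  moreover have "((\<lambda>x. (0::'e, x)) \<circ> h) absolutely_integrable_on {a..b}"
    by (intro absolutely_integrable_linear h bounded_linear_Pair bounded_linear_ident bounded_linear_zero)
  ultimately have "(\<lambda>t. ((\<lambda>x. (x, 0)) \<circ> g) t + ((\<lambda>x. (0, x)) \<circ> h) t) absolutely_integrable_on {a..b}"
    by (rule set_integral_add)
  then have gh: "(\<lambda>t. (g t, h t)) absolutely_integrable_on {a..b}" by (simp add: o_def)
  then have ghi: "(\<lambda>t. (g t, h t)) integrable_on {a..b}" by (simp add: absolutely_integrable_on_def)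
  show ?thesis
    unfolding sobolev_deriv_def
  proof (intro conjI ballI)
    obtain N where N: "negligible N" "\<forall>t\<in>{a..b} - N. (u has_vector_derivative g t) (at t)"
      using u unfolding sobolev_deriv_def by blast
    obtain N' where N': "negligible N'" "\<forall>t\<in>{a..b} - N'. (v has_vector_derivative h t) (at t)"
      using v unfolding sobolev_deriv_def by blast
    show "\<exists>N. negligible N \<and> (\<forall>t\<in>{a..b} - N. ((\<lambda>t. (u t, v t)) has_vector_derivative (g t, h t)) (at t))"
      using N N' by (intro exI[of _ "N \<union> N'"]) (auto intro!: has_vector_derivative_Pair negligible_Un)
    show "(\<lambda>t. norm (g t, h t) powr p) integrable_on {a..b}"
    proof (rule powr_integrable_bound[OF gh])
      show "(\<lambda>t. 2 powr p * (norm (g t) powr p + norm (h t) powr p)) integrable_on {a..b}"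
        by (intro integrable_on_mult_right integrable_add sobolev_deriv_powr_integrable[OF u] sobolev_deriv_powr_integrable[OF v])
      show "norm (g t, h t) powr p \<le> 2 powr p * (norm (g t) powr p + norm (h t) powr p)" for t
        using p by (intro order_trans[OF powr_mono2[OF _ _ norm_Pair_le] powr_add_le]) auto
    qed
    show "(u t, v t) = (u a, v a) + integral {a..t} (\<lambda>t. (g t, h t))" if t: "t \<in> {a..b}" for t
    proof (rule prod_eqI)
      have i: "(\<lambda>t. (g t, h t)) integrable_on {a..t}" by (rule integrable_subinterval_real[OF ghi]) (use t in auto)
      have "u t = u a + fst (integral {a..t} (\<lambda>t. (g t, h t)))"
        unfolding integral_linear[OF i bounded_linear_fst, symmetric] o_def fst_conv by (rule sobolev_deriv_eq[OF u t])
      then show "fst (u t, v t) = fst ((u a, v a) + integral {a..t} (\<lambda>t. (g t, h t)))"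
        by (simp only: fst_conv fst_add)
      have "v t = v a + snd (integral {a..t} (\<lambda>t. (g t, h t)))"
        unfolding integral_linear[OF i bounded_linear_snd, symmetric] o_def snd_conv by (rule sobolev_deriv_eq[OF v t])
      then show "snd (u t, v t) = snd ((u a, v a) + integral {a..t} (\<lambda>t. (g t, h t)))"
        by (simp only: snd_conv snd_add)
    qed
  qed (rule gh)
qed

lemma C1_on_bounded_linear: "bounded_linear f \<Longrightarrow> C1_on S f (\<lambda>_. f)"
  unfolding C1_on_def using bounded_linear_imp_has_derivative by (auto intro: continuous_on_const)

lemma C1_on_bounded_bilinear:
  assumes "bounded_bilinear f"
  shows "C1_on S (\<lambda>z. f (fst z) (snd z)) (\<lambda>z v. f (fst z) (snd v) + f (fst v) (snd z))"
proof -
  interpret bounded_bilinear f by fact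
  show ?thesis
    unfolding C1_on_def
    by (auto intro!: FDERIV derivative_eq_intros continuous_intros continuous_on)
qed

lemma sobolev_deriv_linear:
  assumes "p \<ge> 1" "sobolev_deriv p a b u g" "bounded_linear f"
  shows "sobolev_deriv p a b (\<lambda>t. f (u t)) (\<lambda>t. f (g t))"
  by (rule sobolev_deriv_compose[OF assms(1,2) open_UNIV _ C1_on_bounded_linear[OF assms(3)]]) auto

lemma sobolev_deriv_bilinear:
  assumes p: "p \<ge> 1" and "sobolev_deriv p a b u g" "sobolev_deriv p a b v h" "bounded_bilinear f"
  shows "sobolev_deriv p a b (\<lambda>t. f (u t) (v t)) (\<lambda>t. f (u t) (h t) + f (g t) (v t))"
  using sobolev_deriv_compose[OF p sobolev_deriv_Pair[OF p assms(2,3)] open_UNIV _ C1_on_bounded_bilinear[OF assms(4)]]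
  by simp

lemma sobolev_deriv_add:
  assumes p: "p \<ge> 1" and "sobolev_deriv p a b u g" "sobolev_deriv p a b v h"
  shows "sobolev_deriv p a b (\<lambda>t. u t + v t) (\<lambda>t. g t + h t)"
proof -
  have "bounded_linear (\<lambda>z::'a\<times>'a. fst z + snd z)" by (intro bounded_linear_intros)
  from sobolev_deriv_linear[OF p sobolev_deriv_Pair[OF p assms(2,3)] this] show ?thesis by simp
qed

lemma sobolev_deriv_scaleR_const:
  assumes p: "p \<ge> 1" and "sobolev_deriv p a b u g"
  shows "sobolev_deriv p a b (\<lambda>t. k *\<^sub>R u t) (\<lambda>t. k *\<^sub>R g t)"
  by (rule sobolev_deriv_linear[OF assms bounded_linear_scaleR_right])

lemma sobolev_deriv_C1_function:
  fixes \<psi> :: "real \<Rightarrow> 'e::euclidean_space"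
  assumes p: "p \<ge> 1" and d: "\<And>t. (\<psi> has_vector_derivative \<psi>' t) (at t)" and c: "continuous_on UNIV \<psi>'"
  shows "sobolev_deriv p a b \<psi> \<psi>'"
  unfolding sobolev_deriv_def
proof (intro conjI ballI)
  have c': "continuous_on {a..b} \<psi>'" using c continuous_on_subset by blast
  show "\<exists>N. negligible N \<and> (\<forall>t\<in>{a..b} - N. (\<psi> has_vector_derivative \<psi>' t) (at t))"
    using d negligible_empty by blast
  show "\<psi>' absolutely_integrable_on {a..b}" by (rule absolutely_integrable_continuous_real[OF c'])
  show "(\<lambda>t. norm (\<psi>' t) powr p) integrable_on {a..b}"
    using p by (intro integrable_continuous_real continuous_on_powr' continuous_intros c') auto
  show "\<psi> t = \<psi> a + integral {a..t} \<psi>'" if t: "t \<in> {a..b}" for t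
  proof -
    have "(\<psi>' has_integral (\<psi> t - \<psi> a)) {a..t}"
      using t d by (intro fundamental_theorem_of_calculus) (auto intro: has_vector_derivative_at_within)
    then show ?thesis by (simp add: integral_unique)
  qed
qed

section \<open>Tangent spaces\<close>

locale smooth_manifold =
  fixes A :: "('a::topological_space, 'e::euclidean_space) chart set"
  assumes atlas: "smooth_atlas A"
begin

lemma charts_atD: "c \<in> charts_at A x \<Longrightarrow> c \<in> A" "c \<in> charts_at A x \<Longrightarrow> x \<in> cdom c"
  by (auto simp: charts_at_def)

lemma charts_atI: "c \<in> A \<Longrightarrow> x \<in> cdom c \<Longrightarrow> c \<in> charts_at A x"
  by (auto simp: charts_at_def)

lemma ex_chart_at: "\<exists>c. c \<in> charts_at A x"
  using atlas unfolding smooth_atlas_def charts_at_def by blast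

lemma chart:
  assumes "c \<in> A"
  shows "open (cdom c)" "open (cimg c)" "continuous_on (cdom c) (cmap c)" "continuous_on (cimg c) (cinv c)"
    and "\<And>x. x \<in> cdom c \<Longrightarrow> cinv c (cmap c x) = x"
    and "\<And>y. y \<in> cimg c \<Longrightarrow> cmap c (cinv c y) = y"
    and "\<And>y. y \<in> cimg c \<Longrightarrow> cinv c y \<in> cdom c"
proof -
  have *: "open (cdom c)" "open (cimg c)" "homeomorphism (cdom c) (cimg c) (cmap c) (cinv c)"
    using atlas assms unfolding smooth_atlas_def by blast+
  then show "open (cdom c)" "open (cimg c)" "continuous_on (cdom c) (cmap c)" "continuous_on (cimg c) (cinv c)"
    unfolding homeomorphism_def by blast+
  show "\<And>x. x \<in> cdom c \<Longrightarrow> cinv c (cmap c x) = x" "\<And>y. y \<in> cimg c \<Longrightarrow> cmap c (cinv c y) = y"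
    "\<And>y. y \<in> cimg c \<Longrightarrow> cinv c y \<in> cdom c"
    using *(3) unfolding homeomorphism_def by blast+
qed

lemma open_chart_image:
  assumes "c \<in> A" "open U" "U \<subseteq> cdom c"
  shows "open (cmap c ` U)"
proof -
  have "cmap c ` U = cimg c \<inter> cinv c -` U"
    using assms(3) chart(5)[OF assms(1)] by (auto simp: image_iff)
  then show ?thesis
    using continuous_on_open_vimage[OF chart(2)[OF assms(1)]] chart(4)[OF assms(1)] assms(2) by (metis Int_commute)
qed

lemma open_overlap: "c \<in> A \<Longrightarrow> d \<in> A \<Longrightarrow> open (cmap c ` (cdom c \<inter> cdom d))"
  by (intro open_chart_image) (auto intro: chart)

lemma transition_C1_on:
  assumes "c \<in> A" "d \<in> A"
  shows "C1_on (cmap c ` (cdom c \<inter> cdom d)) (cmap d \<circ> cinv c) (\<lambda>y. frechet_derivative (cmap d \<circ> cinv c) (at y))"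
  using atlas assms unfolding smooth_atlas_def by (intro smooth_on_imp_C1_on) blast

lemma coord_change_has_derivative:
  assumes "c \<in> charts_at A x" "d \<in> charts_at A x"
  shows "((cmap d \<circ> cinv c) has_derivative coord_change x c d) (at (cmap c x))"
  using transition_C1_on[of c d] charts_atD assms unfolding C1_on_def coord_change_def by blast

lemma linear_coord_change:
  "c \<in> charts_at A x \<Longrightarrow> d \<in> charts_at A x \<Longrightarrow> linear (coord_change x c d)"
  using coord_change_has_derivative has_derivative_linear by blast

lemma coord_change_self:
  assumes c: "c \<in> charts_at A x"
  shows "coord_change x c c v = v"
proof -
  have cA: "c \<in> A" "x \<in> cdom c" using charts_atD[OF c] by auto
  have "((cmap c \<circ> cinv c) has_derivative (\<lambda>v. v)) (at (cmap c x))"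
    by (rule has_derivative_transform_within_open[OF has_derivative_ident chart(2)[OF cA(1)]])
      (use cA chart(6) in auto)
  then have "coord_change x c c = (\<lambda>v. v)"
    using coord_change_has_derivative[OF c c] has_derivative_unique by blast
  then show ?thesis by simp
qed

text \<open>Near \<open>cmap c x\<close>, on the image of the overlap of \<open>c\<close> and
  \<open>d\<close>, the transition from \<open>c\<close> to \<open>e\<close> factors through
  \<open>d\<close>, so the chain rule applies. This is what makes \<open>tvec_of\<close> produce
  tangent vectors.\<close>

lemma coord_change_cocycle:
  assumes c: "c \<in> charts_at A x" and d: "d \<in> charts_at A x" and e: "e \<in> charts_at A x"
  shows "coord_change x d e (coord_change x c d v) = coord_change x c e v"
proof -
  have cA: "c \<in> A" "x \<in> cdom c" and dA: "d \<in> A" "x \<in> cdom d" using charts_atD c d by auto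
  have "(cmap d \<circ> cinv c) (cmap c x) = cmap d x" using chart(5)[OF cA] by simp
  then have "((\<lambda>y. (cmap e \<circ> cinv d) ((cmap d \<circ> cinv c) y)) has_derivative
      (\<lambda>v. coord_change x d e (coord_change x c d v))) (at (cmap c x))"
    using has_derivative_compose[OF coord_change_has_derivative[OF c d], of "cmap e \<circ> cinv d" "coord_change x d e"]
      coord_change_has_derivative[OF d e] by metis
  then have "((cmap e \<circ> cinv c) has_derivative (\<lambda>v. coord_change x d e (coord_change x c d v))) (at (cmap c x))"
  proof (rule has_derivative_transform_within_open[OF _ open_overlap[OF cA(1) dA(1)]])
    show "cmap c x \<in> cmap c ` (cdom c \<inter> cdom d)" using cA dA by blast
    show "(cmap e \<circ> cinv d) ((cmap d \<circ> cinv c) y) = (cmap e \<circ> cinv c) y" if "y \<in> cmap c ` (cdom c \<inter> cdom d)" for y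
      using that chart(5)[OF cA(1)] chart(5)[OF dA(1)] by auto
  qed
  then have "coord_change x c e = (\<lambda>v. coord_change x d e (coord_change x c d v))"
    using coord_change_has_derivative[OF c e] has_derivative_unique by blast
  then show ?thesis by simp
qed

lemma tangent_spaceI:
  assumes "\<And>c. c \<notin> charts_at A x \<Longrightarrow> v c = 0"
    and "\<And>c d. c \<in> charts_at A x \<Longrightarrow> d \<in> charts_at A x \<Longrightarrow> v d = coord_change x c d (v c)"
  shows "v \<in> tangent_space A x"
  unfolding tangent_space_def using assms by blast

lemma tangent_spaceD:
  assumes "v \<in> tangent_space A x"
  shows "c \<notin> charts_at A x \<Longrightarrow> v c = 0"
    and "c \<in> charts_at A x \<Longrightarrow> d \<in> charts_at A x \<Longrightarrow> coord_change x c d (v c) = v d"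
proof -
  have 1: "\<forall>c. c \<notin> charts_at A x \<longrightarrow> v c = 0"
    and 2: "\<forall>c\<in>charts_at A x. \<forall>d\<in>charts_at A x. v d = coord_change x c d (v c)"
    using assms unfolding tangent_space_def by blast+
  show "c \<notin> charts_at A x \<Longrightarrow> v c = 0" using 1 by blast
  show "c \<in> charts_at A x \<Longrightarrow> d \<in> charts_at A x \<Longrightarrow> coord_change x c d (v c) = v d"
    by (rule 2[rule_format, symmetric])
qed

lemma tvec_of_in_tangent_space: "c \<in> charts_at A x \<Longrightarrow> tvec_of A c x v \<in> tangent_space A x"
  by (rule tangent_spaceI) (simp_all add: tvec_of_def coord_change_cocycle)

lemma tvec_of_coord: "c \<in> charts_at A x \<Longrightarrow> tvec_of A c x v c = v"
  by (simp add: tvec_of_def coord_change_self)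

lemma tvec_of_tangent:
  assumes "c \<in> charts_at A x" "v \<in> tangent_space A x"
  shows "tvec_of A c x (v c) = v"
proof
  fix d
  show "tvec_of A c x (v c) d = v d"
    using tangent_spaceD[OF assms(2)] assms(1) by (simp add: tvec_of_def)
qed

lemma tangent_space_combination:
  assumes "v \<in> tangent_space A x" "w \<in> tangent_space A x"
  shows "(\<lambda>c. a *\<^sub>R v c + b *\<^sub>R w c) \<in> tangent_space A x"
proof (rule tangent_spaceI)
  show "a *\<^sub>R v c + b *\<^sub>R w c = 0" if "c \<notin> charts_at A x" for c
    using that tangent_spaceD(1)[OF assms(1)] tangent_spaceD(1)[OF assms(2)] by simp
  show "a *\<^sub>R v d + b *\<^sub>R w d = coord_change x c d (a *\<^sub>R v c + b *\<^sub>R w c)"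
    if "c \<in> charts_at A x" "d \<in> charts_at A x" for c d
    using tangent_spaceD(2)[OF assms(1) that] tangent_spaceD(2)[OF assms(2) that]
    by (simp add: linear_add[OF linear_coord_change[OF that]] linear_scale[OF linear_coord_change[OF that]])
qed

lemma zero_in_tangent_space: "(\<lambda>_. 0) \<in> tangent_space A x"
  by (rule tangent_spaceI) (simp_all add: linear_0[OF linear_coord_change])

lemma tvec_of_combination:
  assumes "c \<in> charts_at A x"
  shows "(\<lambda>d. a *\<^sub>R tvec_of A c x v d + b *\<^sub>R tvec_of A c x w d) = tvec_of A c x (a *\<^sub>R v + b *\<^sub>R w)"
  using linear_coord_change[OF assms] by (auto simp: fun_eq_iff tvec_of_def linear_add linear_scale)

lemma smooth_fun_C1_on:
  assumes "smooth_fun A f" "c \<in> A"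
  shows "C1_on (cimg c) (f \<circ> cinv c) (\<lambda>y. frechet_derivative (f \<circ> cinv c) (at y))"
  using assms unfolding smooth_fun_def by (intro smooth_on_imp_C1_on) blast

text \<open>\<open>dfun\<close> is evaluated in a chart picked by \<open>SOME\<close>. The chain
  rule for the transition map, together with the compatibility of the coordinates of
  \<open>v\<close>, makes every chart at \<open>x\<close> give the same value.\<close>

lemma dfun_chart:
  assumes f: "smooth_fun A f" and c: "c \<in> charts_at A x" and v: "v \<in> tangent_space A x"
  shows "dfun A f x v = frechet_derivative (f \<circ> cinv c) (at (cmap c x)) (v c)"
proof -
  define d where "d = (SOME c. c \<in> charts_at A x)"
  have d: "d \<in> charts_at A x" unfolding d_def using ex_chart_at by (rule someI_ex)
  have cA: "c \<in> A" "x \<in> cdom c" and dA: "d \<in> A" "x \<in> cdom d" using charts_atD c d by auto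
  have der: "((f \<circ> cinv e) has_derivative frechet_derivative (f \<circ> cinv e) (at (cmap e x))) (at (cmap e x))"
    if "e \<in> charts_at A x" for e
    using smooth_fun_C1_on[OF f, of e] charts_atD[OF that] unfolding C1_on_def by blast
  have "(cmap d \<circ> cinv c) (cmap c x) = cmap d x" using chart(5)[OF cA] by simp
  then have "((\<lambda>y. (f \<circ> cinv d) ((cmap d \<circ> cinv c) y)) has_derivative
      (\<lambda>v. frechet_derivative (f \<circ> cinv d) (at (cmap d x)) (coord_change x c d v))) (at (cmap c x))"
    using has_derivative_compose[OF coord_change_has_derivative[OF c d], of "f \<circ> cinv d"
        "frechet_derivative (f \<circ> cinv d) (at (cmap d x))"] der[OF d] by metis
  then have "((f \<circ> cinv c) has_derivative
      (\<lambda>v. frechet_derivative (f \<circ> cinv d) (at (cmap d x)) (coord_change x c d v))) (at (cmap c x))"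
  proof (rule has_derivative_transform_within_open[OF _ open_overlap[OF cA(1) dA(1)]])
    show "cmap c x \<in> cmap c ` (cdom c \<inter> cdom d)" using cA dA by blast
    show "(f \<circ> cinv d) ((cmap d \<circ> cinv c) y) = (f \<circ> cinv c) y" if "y \<in> cmap c ` (cdom c \<inter> cdom d)" for y
      using that chart(5)[OF cA(1)] chart(5)[OF dA(1)] by auto
  qed
  then have "frechet_derivative (f \<circ> cinv c) (at (cmap c x)) =
      (\<lambda>v. frechet_derivative (f \<circ> cinv d) (at (cmap d x)) (coord_change x c d v))"
    using der[OF c] has_derivative_unique by blast
  moreover have "v d = coord_change x c d (v c)" using v c d unfolding tangent_space_def by blast
  ultimately show ?thesis unfolding dfun_def d_def[symmetric] Let_def by simp
qed

text \<open>Differentiability in one chart passes to all charts through the transition maps, so the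
  coordinate derivatives fit together to a tangent vector. At other times the entries of
  \<open>loop_velocity\<close> need not be related to each other.\<close>

lemma loop_velocity_chart:
  assumes cont: "continuous_on UNIV \<gamma>" and c: "c \<in> charts_at A (\<gamma> t)"
    and der: "((\<lambda>r. cmap c (\<gamma> r)) has_vector_derivative w) (at t)"
  shows "loop_velocity A \<gamma> t = tvec_of A c (\<gamma> t) w"
proof
  fix d
  show "loop_velocity A \<gamma> t d = tvec_of A c (\<gamma> t) w d"
  proof (cases "d \<in> charts_at A (\<gamma> t)")
    case True
    have cA: "c \<in> A" "\<gamma> t \<in> cdom c" and dA: "d \<in> A" "\<gamma> t \<in> cdom d" using charts_atD c True by auto
    have "((\<lambda>r. (cmap d \<circ> cinv c) (cmap c (\<gamma> r))) has_vector_derivative coord_change (\<gamma> t) c d w) (at t)"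
      by (rule has_vector_derivative_compose_has_derivative[OF der coord_change_has_derivative[OF c True]])
    then have "((\<lambda>r. cmap d (\<gamma> r)) has_vector_derivative coord_change (\<gamma> t) c d w) (at t)"
    proof (rule has_vector_derivative_transform_within_open)
      show "open (\<gamma> -` cdom c)" using cont chart(1)[OF cA(1)] by (simp add: open_vimage)
      show "(cmap d \<circ> cinv c) (cmap c (\<gamma> r)) = cmap d (\<gamma> r)" if "r \<in> \<gamma> -` cdom c" for r
        using that chart(5)[OF cA(1)] by auto
    qed (use cA in auto)
    then show ?thesis using True by (simp add: loop_velocity_def tvec_of_def vector_derivative_at)
  qed (simp add: loop_velocity_def tvec_of_def)
qed

end

section \<open>Realising vector fields by paths of loops\<close>

lemma periodic_of_int:
  fixes f :: "real \<Rightarrow> 'b"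
  assumes "\<And>t. f (t + 1) = f t"
  shows "f (t + of_int n) = f t"
proof (induction n rule: int_induct[where k = 0])
  case (step1 i)
  then show ?case using assms[of "t + of_int i"] by (simp add: algebra_simps)
next
  case (step2 i)
  then show ?case using assms[of "t + of_int (i - 1)"] by (simp add: algebra_simps)
qed simp

lemma sobolev_norm_eq_0:
  assumes "\<And>t. t \<in> {a..b} \<Longrightarrow> f t = 0"
  shows "sobolev_norm p a b f = 0"
proof -
  have "norm (f t) powr p + norm (vector_derivative f (at t)) powr p = 0" if "t \<in> {a..b} - {a, b}" for t
  proof -
    have "(f has_vector_derivative 0) (at t)"
      by (rule has_vector_derivative_transform_within_open[where S = "{a<..<b}", OF has_vector_derivative_const[of 0]])
        (use assms that in auto)
    then show ?thesis using assms that by (simp add: vector_derivative_at)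
  qed
  then have "integral {a..b} (\<lambda>t. norm (f t) powr p + norm (vector_derivative f (at t)) powr p) = integral {a..b} (\<lambda>_. 0)"
    by (intro integral_spike[of "{a, b}"]) auto
  then show ?thesis by (simp add: sobolev_norm_def)
qed

lemma ex_closed_interval:
  assumes "open U" "t \<in> U"
  obtains d :: real where "d > 0" "{t - d..t + d} \<subseteq> U"
  using assms open_contains_cball by (metis cball_eq_atLeastAtMost)

context smooth_manifold
begin

lemma loop_spaceD:
  assumes "\<gamma> \<in> loop_space A p"
  shows "continuous_on UNIV \<gamma>" "\<gamma> (t + 1) = \<gamma> t"
    and "c \<in> A \<Longrightarrow> a < b \<Longrightarrow> \<gamma> ` {a..b} \<subseteq> cdom c \<Longrightarrow> sobolev_on p a b (\<lambda>t. cmap c (\<gamma> t))"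
  using assms unfolding loop_space_def by blast+

lemma loop_tangentD:
  assumes "X \<in> loop_tangent A p \<gamma>"
  shows "X t \<in> tangent_space A (\<gamma> t)" "X (t + 1) = X t"
    and "c \<in> A \<Longrightarrow> a < b \<Longrightarrow> \<gamma> ` {a..b} \<subseteq> cdom c \<Longrightarrow> sobolev_on p a b (\<lambda>t. X t c)"
  using assms unfolding loop_tangent_def by blast+

lemma loop_open_vimage: "\<gamma> \<in> loop_space A p \<Longrightarrow> c \<in> A \<Longrightarrow> open (\<gamma> -` cdom c)"
  using loop_spaceD(1) chart(1) open_vimage by blast

lemma ex_local_chart:
  assumes "\<gamma> \<in> loop_space A p"
  obtains c d where "c \<in> A" "d > 0" "\<gamma> ` {t - d..t + d} \<subseteq> cdom c"
proof -
  obtain c where "c \<in> charts_at A (\<gamma> t)" using ex_chart_at by blast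
  then have c: "c \<in> A" "\<gamma> t \<in> cdom c" using charts_atD by auto
  from loop_open_vimage[OF assms c(1)] c(2) obtain d where "d > 0" "{t - d..t + d} \<subseteq> \<gamma> -` cdom c"
    using ex_closed_interval by (metis vimageI)
  then show ?thesis using that c(1) by blast
qed

lemma loop_tangent_combination:
  assumes p: "p \<ge> 1" and X: "X \<in> loop_tangent A p \<gamma>" and Y: "Y \<in> loop_tangent A p \<gamma>"
  shows "(\<lambda>t c. a *\<^sub>R X t c + b *\<^sub>R Y t c) \<in> loop_tangent A p \<gamma>"
  unfolding loop_tangent_def
proof (intro CollectI conjI allI ballI impI)
  show "(\<lambda>c. a *\<^sub>R X t c + b *\<^sub>R Y t c) \<in> tangent_space A (\<gamma> t)" for t
    by (intro tangent_space_combination loop_tangentD(1)[OF X] loop_tangentD(1)[OF Y])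
  show "(\<lambda>c. a *\<^sub>R X (t + 1) c + b *\<^sub>R Y (t + 1) c) = (\<lambda>c. a *\<^sub>R X t c + b *\<^sub>R Y t c)" for t
    by (simp only: loop_tangentD(2)[OF X] loop_tangentD(2)[OF Y])
  fix c l r assume c: "c \<in> A" and lr: "l < r \<and> \<gamma> ` {l..r} \<subseteq> cdom c"
  have "sobolev_on p l r (\<lambda>t. X t c)" "sobolev_on p l r (\<lambda>t. Y t c)"
    using loop_tangentD(3)[OF X c] loop_tangentD(3)[OF Y c] lr by blast+
  then show "sobolev_on p l r (\<lambda>t. a *\<^sub>R X t c + b *\<^sub>R Y t c)"
    unfolding sobolev_on_iff[OF p, of _ _ "\<lambda>t. X t c"] sobolev_on_iff[OF p, of _ _ "\<lambda>t. Y t c"]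
    by (rule sobolev_deriv_imp_sobolev_on[OF p
          sobolev_deriv_add[OF p sobolev_deriv_scaleR_const[OF p] sobolev_deriv_scaleR_const[OF p]]])
qed

lemma loop_tangent_scaleR:
  fixes \<psi> :: "real \<Rightarrow> real"
  assumes p: "p \<ge> 1" and X: "X \<in> loop_tangent A p \<gamma>"
    and der: "\<And>t. (\<psi> has_vector_derivative \<psi>' t) (at t)" and cont: "continuous_on UNIV \<psi>'"
    and per: "\<And>t. \<psi> (t + 1) = \<psi> t"
  shows "(\<lambda>t c. \<psi> t *\<^sub>R X t c) \<in> loop_tangent A p \<gamma>"
  unfolding loop_tangent_def
proof (intro CollectI conjI allI ballI impI)
  show "(\<lambda>c. \<psi> t *\<^sub>R X t c) \<in> tangent_space A (\<gamma> t)" for t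
    using tangent_space_combination[OF loop_tangentD(1)[OF X] zero_in_tangent_space, of "\<psi> t" t 0] by simp
  show "(\<lambda>c. \<psi> (t + 1) *\<^sub>R X (t + 1) c) = (\<lambda>c. \<psi> t *\<^sub>R X t c)" for t
    by (simp only: loop_tangentD(2)[OF X] per)
  fix c l r assume c: "c \<in> A" and lr: "l < r \<and> \<gamma> ` {l..r} \<subseteq> cdom c"
  have "sobolev_on p l r (\<lambda>t. X t c)" using loop_tangentD(3)[OF X c] lr by blast
  then have *: "sobolev_deriv p l r (\<lambda>t. X t c) (\<lambda>t. vector_derivative (\<lambda>t. X t c) (at t))"
    by (simp only: sobolev_on_iff[OF p])
  show "sobolev_on p l r (\<lambda>t. \<psi> t *\<^sub>R X t c)"
    by (rule sobolev_deriv_imp_sobolev_on[OF p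
          sobolev_deriv_bilinear[OF p sobolev_deriv_C1_function[OF p der cont] * bounded_bilinear_scaleR]])
qed

lemma loop_tangent_continuous_on:
  assumes p: "p \<ge> 1" and \<gamma>: "\<gamma> \<in> loop_space A p" and X: "X \<in> loop_tangent A p \<gamma>" and c: "c \<in> A"
  shows "continuous_on (\<gamma> -` cdom c) (\<lambda>t. X t c)"
proof -
  have "isCont (\<lambda>t. X t c) t" if t: "t \<in> \<gamma> -` cdom c" for t
  proof -
    obtain d where d: "d > 0" "{t - d..t + d} \<subseteq> \<gamma> -` cdom c"
      by (rule ex_closed_interval[OF loop_open_vimage[OF \<gamma> c] t])
    have "sobolev_on p (t - d) (t + d) (\<lambda>t. X t c)"
      by (rule loop_tangentD(3)[OF X c]) (use d in auto)
    then have "continuous_on {t - d..t + d} (\<lambda>t. X t c)"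
      unfolding sobolev_on_iff[OF p] by (rule sobolev_deriv_continuous_on)
    then show ?thesis by (rule continuous_on_interior) (use d(1) in auto)
  qed
  then show ?thesis by (intro continuous_at_imp_continuous_on) blast
qed

text \<open>Vector fields along \<open>\<gamma>\<close> supported in a single chart are realised by straight lines in that
  chart, so no exponential map is needed.\<close>

lemma loop_path_localized:
  assumes p: "p \<ge> 1" and \<gamma>: "\<gamma> \<in> loop_space A p" and X: "X \<in> loop_tangent A p \<gamma>" and c: "c \<in> A"
    and K: "closed K" "\<And>t. t + 1 \<in> K \<longleftrightarrow> t \<in> K" "\<gamma> ` K \<subseteq> cdom c" and X0: "\<And>t. t \<notin> K \<Longrightarrow> X t = (\<lambda>_. 0)"
  shows "\<exists>\<sigma>. loop_path A p \<sigma> \<gamma> X"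
proof -
  define U where "U = \<gamma> -` cdom c"
  have U: "open U" "K \<subseteq> U" using loop_open_vimage[OF \<gamma> c] K(3) unfolding U_def by auto
  have U1: "t + 1 \<in> U \<longleftrightarrow> t \<in> U" for t unfolding U_def vimage_def using loop_spaceD(2)[OF \<gamma>] by simp
  define u where "u t = cmap c (\<gamma> t)" for t
  define x where "x t = X t c" for t
  have u1: "u (t + 1) = u t" and x1: "x (t + 1) = x t" for t
    using loop_spaceD(2)[OF \<gamma>] loop_tangentD(2)[OF X] by (simp_all add: u_def x_def)
  have cu: "continuous_on U u" unfolding u_def
    by (rule continuous_on_compose2[OF chart(3)[OF c] continuous_on_subset[OF loop_spaceD(1)[OF \<gamma>]]])
      (auto simp: U_def)
  have cx: "continuous_on U x" unfolding x_def U_def by (rule loop_tangent_continuous_on[OF p \<gamma> X c])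
  \<comment> \<open>\<open>K\<close> is periodic, hence unbounded unless empty. Its part in one
    period is compact, and periodicity carries the bounds \<open>r\<close> and \<open>B\<close>
    found there to all of \<open>K\<close>.\<close>
  define K0 where "K0 = K \<inter> {0..1}"
  have K0: "compact K0" "K0 \<subseteq> U" unfolding K0_def using K(1) U(2) by (auto intro: closed_Int_compact)
  have "compact (u ` K0)" by (intro compact_continuous_image continuous_on_subset[OF cu] K0)
  moreover have "u ` K0 \<subseteq> cimg c" using K0(2) by (auto simp: U_def u_def)
  ultimately obtain r where r: "r > 0" "(\<Union>y\<in>u ` K0. ball y r) \<subseteq> cimg c"
    using compact_subset_open_imp_ball_epsilon_subset chart(2)[OF c] by metis
  have "bounded (x ` K0)"
    by (intro compact_imp_bounded compact_continuous_image continuous_on_subset[OF cx] K0)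
  then obtain B where B: "B > 0" "\<And>t. t \<in> K0 \<Longrightarrow> norm (x t) \<le> B" by (auto simp: bounded_pos)
  have x0: "x t = 0" if "t \<notin> K" for t using X0[OF that] by (simp add: x_def)
  \<comment> \<open>On \<open>K\<close> the displacement has norm at most |s| B < r and so stays in
    the chart image; off \<open>K\<close> the field vanishes and the point does not move.\<close>
  have inimg: "u t + s *\<^sub>R x t \<in> cimg c" if s: "\<bar>s\<bar> < r / B" and t: "t \<in> U" for s t
  proof (cases "t \<in> K")
    case False
    then show ?thesis using t by (simp add: x0 U_def u_def)
  next
    case True
    define t' where "t' = t + of_int (- \<lfloor>t\<rfloor>)"
    have t': "u t' = u t" "x t' = x t" "t' \<in> K \<longleftrightarrow> t \<in> K" unfolding t'_def
      by (rule periodic_of_int[of u, OF u1], rule periodic_of_int[of x, OF x1],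
          rule periodic_of_int[of "\<lambda>t. t \<in> K", OF K(2)])
    have "t' \<in> {0..1}" unfolding t'_def by simp linarith
    then have "t' \<in> K0" using t' True unfolding K0_def by blast
    have "norm (s *\<^sub>R x t) \<le> \<bar>s\<bar> * B" using B(2)[OF \<open>t' \<in> K0\<close>] t' by (simp add: mult_left_mono)
    also have "\<dots> < r" using s B(1) by (simp add: field_simps)
    finally have "u t + s *\<^sub>R x t \<in> ball (u t') r" using t' by (simp add: dist_norm)
    then show ?thesis using r(2) \<open>t' \<in> K0\<close> by blast
  qed
  \<comment> \<open>A straight line in the chart \<open>c\<close>. On \<open>U\<close> outside
    \<open>K\<close> it is constant, so the two cases match there and both continuity and regularity
    can be checked on the open cover by \<open>U\<close> and the complement of
    \<open>K\<close>.\<close>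
  define \<sigma> where "\<sigma> s t = (if t \<in> U then cinv c (u t + s *\<^sub>R x t) else \<gamma> t)" for s t
  have \<sigma>_out: "\<sigma> s t = \<gamma> t" if "t \<notin> K" for s t
    using x0[OF that] chart(5)[OF c, of "\<gamma> t"] by (simp add: \<sigma>_def u_def U_def)
  have \<sigma>0: "\<sigma> 0 = \<gamma>" using chart(5)[OF c] by (auto simp: fun_eq_iff \<sigma>_def u_def U_def)
  have \<sigma>_in: "\<sigma> s t \<in> cdom c" "cmap c (\<sigma> s t) = u t + s *\<^sub>R x t" if "\<bar>s\<bar> < r / B" "t \<in> U" for s t
    using inimg[OF that] that chart(6,7)[OF c] by (simp_all add: \<sigma>_def)
  have good: "\<sigma> s \<in> loop_space A p" if s: "\<bar>s\<bar> < r / B" for s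
    unfolding loop_space_def
  proof (intro CollectI conjI allI ballI impI)
    have "continuous_on U (\<lambda>t. cinv c (u t + s *\<^sub>R x t))"
      by (rule continuous_on_compose2[OF chart(4)[OF c]]) (auto intro!: continuous_intros cu cx inimg[OF s])
    then have "continuous_on U (\<sigma> s)"
      by (subst continuous_on_cong[OF refl, where g = "\<lambda>t. cinv c (u t + s *\<^sub>R x t)"]) (auto simp: \<sigma>_def)
    moreover have "continuous_on (- K) (\<sigma> s)"
      by (subst continuous_on_cong[OF refl, where g = \<gamma>])
        (use continuous_on_subset[OF loop_spaceD(1)[OF \<gamma>]] \<sigma>_out in auto)
    ultimately have "continuous_on (U \<union> - K) (\<sigma> s)"
      using U(1) K(1) by (intro continuous_on_open_Un) auto
    moreover have "U \<union> - K = UNIV" using U(2) by blast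
    ultimately show "continuous_on UNIV (\<sigma> s)" by simp
    show "\<sigma> s (t + 1) = \<sigma> s t" for t
      using loop_spaceD(2)[OF \<gamma>] by (simp add: \<sigma>_def U1 u1 x1)
    fix d a b assume d: "d \<in> A" and ab: "a < b \<and> \<sigma> s ` {a..b} \<subseteq> cdom d"
    \<comment> \<open>Near a time in \<open>K\<close> the new loop is the transition map from
      \<open>c\<close> to \<open>d\<close> applied to a Sobolev curve; near any other time it is
      \<gamma> itself.\<close>
    show "sobolev_on p a b (\<lambda>t. cmap d (\<sigma> s t))"
    proof (rule sobolev_on_local[OF p])
      fix t assume t: "t \<in> {a..b}"
      show "\<exists>e>0. sobolev_on p (max a (t - e)) (min b (t + e)) (\<lambda>t. cmap d (\<sigma> s t))"
      proof (cases "t \<in> K")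
        case True
        then obtain e where e: "e > 0" "{t - e..t + e} \<subseteq> U" using ex_closed_interval[OF U(1)] U(2) by blast
        define l where "l = max a (t - e)"
        define m where "m = min b (t + e)"
        have lm: "l < m" "{l..m} \<subseteq> U" "{l..m} \<subseteq> {a..b}" using e t ab by (auto simp: l_def m_def)
        have "sobolev_on p l m u" unfolding u_def by (rule loop_spaceD(3)[OF \<gamma> c lm(1)]) (use lm in \<open>auto simp: U_def\<close>)
        moreover have "sobolev_on p l m x" unfolding x_def by (rule loop_tangentD(3)[OF X c lm(1)]) (use lm in \<open>auto simp: U_def\<close>)
        ultimately have "\<exists>g. sobolev_deriv p l m (\<lambda>t. u t + s *\<^sub>R x t) g"
          unfolding sobolev_on_iff[OF p] using sobolev_deriv_add[OF p] sobolev_deriv_scaleR_const[OF p] by blast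
        then obtain g where g: "sobolev_deriv p l m (\<lambda>t. u t + s *\<^sub>R x t) g" by blast
        have "(\<lambda>t. u t + s *\<^sub>R x t) ` {l..m} \<subseteq> cmap c ` (cdom c \<inter> cdom d)"
        proof clarify
          fix w assume w: "w \<in> {l..m}"
          then have "\<sigma> s w \<in> cdom c \<inter> cdom d" using \<sigma>_in(1)[OF s] lm ab by blast
          moreover have "cmap c (\<sigma> s w) = u w + s *\<^sub>R x w" using \<sigma>_in(2)[OF s] lm w by blast
          ultimately show "u w + s *\<^sub>R x w \<in> cmap c ` (cdom c \<inter> cdom d)" by (metis imageI)
        qed
        from sobolev_deriv_compose[OF p g open_overlap[OF c d] this transition_C1_on[OF c d]]
        have "sobolev_on p l m (\<lambda>t. (cmap d \<circ> cinv c) (u t + s *\<^sub>R x t))"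
          by (rule sobolev_deriv_imp_sobolev_on[OF p])
        moreover have "cmap d (\<sigma> s w) = (cmap d \<circ> cinv c) (u w + s *\<^sub>R x w)" if "w \<in> {l..m}" for w
          using that lm(2) by (auto simp: \<sigma>_def)
        ultimately have "sobolev_on p l m (\<lambda>t. cmap d (\<sigma> s t))"
          using sobolev_on_cong[OF p, of l m "\<lambda>t. cmap d (\<sigma> s t)" "\<lambda>t. (cmap d \<circ> cinv c) (u t + s *\<^sub>R x t)"] by simp
        then show ?thesis using e(1) unfolding l_def m_def by blast
      next
        case False
        have "open (- K)" "t \<in> - K" using K(1) False by auto
        then obtain e where e: "e > 0" "{t - e..t + e} \<subseteq> - K" by (rule ex_closed_interval)
        define l where "l = max a (t - e)"
        define m where "m = min b (t + e)"
        have lm: "l < m" "{l..m} \<subseteq> - K" "{l..m} \<subseteq> {a..b}" using e t ab by (auto simp: l_def m_def)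
        have eq: "\<sigma> s w = \<gamma> w" if "w \<in> {l..m}" for w using that lm(2) \<sigma>_out by blast
        have "\<gamma> w \<in> cdom d" if "w \<in> {l..m}" for w
        proof -
          have "\<sigma> s w \<in> cdom d" using that lm(3) ab by blast
          then show ?thesis using eq[OF that] by simp
        qed
        then have "sobolev_on p l m (\<lambda>t. cmap d (\<gamma> t))" by (intro loop_spaceD(3)[OF \<gamma> d lm(1)]) auto
        then have "sobolev_on p l m (\<lambda>t. cmap d (\<sigma> s t))"
          using sobolev_on_cong[OF p, of l m "\<lambda>t. cmap d (\<sigma> s t)" "\<lambda>t. cmap d (\<gamma> t)"] eq by simp
        then show ?thesis using e(1) unfolding l_def m_def by blast
      qed
    qed (use ab in simp)
  qed
  have small: "\<forall>\<^sub>F s in at 0. s \<noteq> 0 \<and> \<bar>s\<bar> < r / B"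
    unfolding eventually_at using r(1) B(1) by (intro exI[of _ "r / B"]) (auto simp: dist_real_def)
  have "loop_path A p \<sigma> \<gamma> X"
    unfolding loop_path_def
  proof (intro conjI allI)
    show "\<forall>\<^sub>F s in at 0. \<sigma> s \<in> loop_space A p" using small by eventually_elim (simp add: good)
    fix t
    show "\<exists>c\<in>A. \<exists>a b. a < t \<and> t < b \<and> \<gamma> ` {a..b} \<subseteq> cdom c \<and>
        (\<forall>\<^sub>F s in at 0. \<sigma> s ` {a..b} \<subseteq> cdom c) \<and>
        ((\<lambda>s. sobolev_norm p a b (\<lambda>r. (cmap c (\<sigma> s r) - cmap c (\<gamma> r)) /\<^sub>R s - X r c)) \<longlongrightarrow> 0) (at 0)"
    proof (cases "t \<in> U")
      case True
      then obtain e where e: "e > 0" "{t - e..t + e} \<subseteq> U" using ex_closed_interval[OF U(1)] by blast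
      have "\<forall>\<^sub>F s in at 0. \<sigma> s ` {t - e..t + e} \<subseteq> cdom c"
        using small by eventually_elim (use \<sigma>_in(1) e(2) in blast)
      \<comment> \<open>In the chart of the straight line the difference quotient equals
        \<open>x\<close> exactly, so the norm is 0 for small nonzero \<open>s\<close>, not merely
        convergent to 0.\<close>
      moreover have "\<forall>\<^sub>F s in at 0. sobolev_norm p (t - e) (t + e)
          (\<lambda>r. (cmap c (\<sigma> s r) - cmap c (\<gamma> r)) /\<^sub>R s - X r c) = 0"
        using small
      proof eventually_elim
        case (elim s)
        show ?case
        proof (rule sobolev_norm_eq_0)
          fix w assume "w \<in> {t - e..t + e}"
          then have "cmap c (\<sigma> s w) = u w + s *\<^sub>R x w" using \<sigma>_in(2) elim e(2) by blast
          then show "(cmap c (\<sigma> s w) - cmap c (\<gamma> w)) /\<^sub>R s - X w c = 0"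
            using elim by (simp add: u_def x_def)
        qed
      qed
      then have "((\<lambda>s. sobolev_norm p (t - e) (t + e) (\<lambda>r. (cmap c (\<sigma> s r) - cmap c (\<gamma> r)) /\<^sub>R s - X r c)) \<longlongrightarrow> 0) (at 0)"
        by (rule tendsto_eventually)
      moreover have "\<gamma> ` {t - e..t + e} \<subseteq> cdom c" using e(2) by (auto simp: U_def)
      ultimately show ?thesis using e(1) c by (intro bexI[of _ c] exI[of _ "t - e"] exI[of _ "t + e"]) auto
    next
      case False
      obtain d where d: "d \<in> charts_at A (\<gamma> t)" using ex_chart_at by blast
      then have dA: "d \<in> A" "\<gamma> t \<in> cdom d" using charts_atD by auto
      have "open (- K \<inter> \<gamma> -` cdom d)" using K(1) loop_open_vimage[OF \<gamma> dA(1)] by (intro open_Int) auto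
      moreover have "t \<in> - K \<inter> \<gamma> -` cdom d" using False U(2) dA by auto
      ultimately obtain e where e: "e > 0" "{t - e..t + e} \<subseteq> - K \<inter> \<gamma> -` cdom d" by (rule ex_closed_interval)
      have eq: "\<sigma> s w = \<gamma> w" "X w d = 0" if "w \<in> {t - e..t + e}" for w s
        using e(2) that \<sigma>_out X0 by auto
      have g: "\<gamma> ` {t - e..t + e} \<subseteq> cdom d" using e(2) by auto
      then have "\<sigma> s ` {t - e..t + e} \<subseteq> cdom d" for s using eq(1) by auto
      moreover have "sobolev_norm p (t - e) (t + e) (\<lambda>r. (cmap d (\<sigma> s r) - cmap d (\<gamma> r)) /\<^sub>R s - X r d) = 0" for s
        by (rule sobolev_norm_eq_0) (simp add: eq)
      ultimately show ?thesis using e(1) dA g by (intro bexI[of _ d] exI[of _ "t - e"] exI[of _ "t + e"]) auto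
    qed
  qed (use \<sigma>0 \<gamma> X in auto)
  then show ?thesis by blast
qed

end

section \<open>Periodic bump functions\<close>

lemma has_real_derivative_max_0_square:
  "((\<lambda>x::real. (max 0 x)\<^sup>2) has_real_derivative 2 * max 0 x) (at x)"
proof -
  consider "x > 0" | "x < 0" | "x = 0" by linarith
  then show ?thesis
  proof cases
    case 1
    have "((\<lambda>x::real. x\<^sup>2) has_real_derivative 2 * x) (at x)" by (auto intro!: derivative_eq_intros)
    then have "((\<lambda>x::real. (max 0 x)\<^sup>2) has_real_derivative 2 * x) (at x)"
      by (rule has_field_derivative_transform_within_open[where S = "{0<..}"]) (use 1 in auto)
    then show ?thesis using 1 by simp
  next
    case 2
    have "((\<lambda>x::real. 0) has_real_derivative 0) (at x)" by simp
    then have "((\<lambda>x::real. (max 0 x)\<^sup>2) has_real_derivative 0) (at x)"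
      by (rule has_field_derivative_transform_within_open[where S = "{..<0}"]) (use 2 in auto)
    then show ?thesis using 2 by simp
  next
    case 3
    have "((\<lambda>h. (max 0 h)\<^sup>2 / h) \<longlongrightarrow> 0) (at (0::real))"
    proof (rule Lim_null_comparison)
      show "\<forall>\<^sub>F h in at (0::real). norm ((max 0 h)\<^sup>2 / h) \<le> \<bar>h\<bar>"
        by (rule always_eventually) (auto simp: max_def power2_eq_square)
      show "(abs \<longlongrightarrow> 0) (at (0::real))" by (rule tendsto_eq_intros refl | simp)+
    qed
    then show ?thesis unfolding DERIV_def using 3 by simp
  qed
qed

text \<open>A cosine cut off at height cos (2 pi e) is 1-periodic by construction. For 0 < e < 1/2
  it is positive exactly at times closer than \<open>e\<close> to \<open>t0\<close> modulo 1, and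
  squaring the positive part makes it C1, enough regularity for multiplying Sobolev fields.\<close>

definition bump :: "real \<Rightarrow> real \<Rightarrow> real \<Rightarrow> real" where
  "bump t0 e t = (max 0 (cos (2 * pi * (t - t0)) - cos (2 * pi * e)))\<^sup>2"

definition bump' :: "real \<Rightarrow> real \<Rightarrow> real \<Rightarrow> real" where
  "bump' t0 e t = 2 * max 0 (cos (2 * pi * (t - t0)) - cos (2 * pi * e)) * (- 2 * pi * sin (2 * pi * (t - t0)))"

lemma bump_has_derivative: "(bump t0 e has_real_derivative bump' t0 e t) (at t)"
  unfolding bump_def[abs_def] bump'_def
  by (rule DERIV_chain2[OF has_real_derivative_max_0_square]) (auto intro!: derivative_eq_intros)

lemma continuous_on_bump': "continuous_on S (bump' t0 e)"
  unfolding bump'_def[abs_def] by (intro continuous_intros)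

lemma bump_periodic: "bump t0 e (t + 1) = bump t0 e t"
proof -
  have "cos (2 * pi * (t + 1 - t0)) = cos (2 * pi * (t - t0) + 2 * pi)" by (simp add: algebra_simps)
  then show ?thesis unfolding bump_def by simp
qed

lemma bump_nonneg: "bump t0 e t \<ge> 0" by (simp add: bump_def)

text \<open>An integer shift brings \<open>t\<close> within 1/2 of \<open>t0\<close>; there the
  angle has absolute value at most pi, where cosine is decreasing in that absolute value, so the
  inequality of cosines becomes one of distances.\<close>

lemma bump_support:
  assumes "0 < e" "e < 1/2" "cos (2 * pi * (t - t0)) \<ge> cos (2 * pi * e)"
  obtains n :: int where "t + of_int n \<in> {t0 - e..t0 + e}"
proof -
  define n where "n = - round (t - t0)"
  define y where "y = t + of_int n - t0"
  have y: "\<bar>y\<bar> \<le> 1/2" using of_int_round_abs_le[of "t - t0"] unfolding y_def n_def of_int_minus by linarith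
  have "cos (2 * pi * \<bar>y\<bar>) = cos (2 * pi * y)" by (simp add: abs_if)
  also have "2 * pi * y = 2 * pi * (t - t0) + 2 * pi * of_int n" by (simp add: y_def algebra_simps)
  also have "cos \<dots> = cos (2 * pi * (t - t0))"
    by (simp add: cos_add cos_int_2pin sin_int_2pin)
  finally have "cos (2 * pi * e) \<le> cos (2 * pi * \<bar>y\<bar>)" using assms(3) by simp
  then have "2 * pi * \<bar>y\<bar> \<le> 2 * pi * e"
    using assms y by (subst (asm) cos_mono_le_eq) auto
  then have "\<bar>y\<bar> \<le> e" by simp
  then show ?thesis using that[of n] unfolding y_def by (auto simp: abs_le_iff)
qed

section \<open>Uniqueness of the differentials\<close>

context smooth_manifold
begin

text \<open>Meant for the difference of two candidates for a differential. Paths have been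
  constructed only for fields supported in one chart, and linearity of \<open>L\<close> on all of
  \<open>loop_tangent\<close> extends the conclusion to their finite sums.\<close>

lemma loop_linear_functional_eq_0:
  assumes p: "p \<ge> 1" and \<gamma>: "\<gamma> \<in> loop_space A p"
    and L: "\<And>X Y a b. X \<in> loop_tangent A p \<gamma> \<Longrightarrow> Y \<in> loop_tangent A p \<gamma> \<Longrightarrow>
      L (\<lambda>t c. a *\<^sub>R X t c + b *\<^sub>R Y t c) = a * L X + b * (L Y :: real)"
    and L0: "\<And>\<sigma> X. loop_path A p \<sigma> \<gamma> X \<Longrightarrow> L X = 0"
    and X: "X \<in> loop_tangent A p \<gamma>"
  shows "L X = 0"
proof -
  have "\<forall>t0. \<exists>c e. c \<in> A \<and> 0 < e \<and> e < 1/2 \<and> \<gamma> ` {t0 - e..t0 + e} \<subseteq> cdom c"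
  proof
    fix t0
    obtain c d where "c \<in> A" "d > 0" "\<gamma> ` {t0 - d..t0 + d} \<subseteq> cdom c"
      by (rule ex_local_chart[OF \<gamma>])
    \<comment> \<open>The cap 1/4 keeps the radius below 1/2, as \<open>bump_support\<close>
      demands.\<close>
    then have "\<gamma> ` {t0 - min d (1/4)..t0 + min d (1/4)} \<subseteq> cdom c"
      by (meson add_left_mono atLeastatMost_subset_iff diff_left_mono image_mono min.cobounded1 subset_trans)
    then show "\<exists>c e. c \<in> A \<and> 0 < e \<and> e < 1/2 \<and> \<gamma> ` {t0 - e..t0 + e} \<subseteq> cdom c"
      using \<open>c \<in> A\<close> \<open>d > 0\<close> by (intro exI[of _ c] exI[of _ "min d (1/4)"]) simp
  qed
  then obtain c e where ce: "\<And>t0. c t0 \<in> A" "\<And>t0. 0 < e t0" "\<And>t0. e t0 < 1/2" "\<And>t0. \<gamma> ` {t0 - e t0..t0 + e t0} \<subseteq> cdom (c t0)"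
    by metis
  define V where "V t0 = {t. cos (2 * pi * (t - t0)) > cos (2 * pi * e t0)}" for t0
  have "open (V t0)" for t0 unfolding V_def by (intro open_Collect_less continuous_intros)
  moreover have "t0 \<in> V t0" for t0
    using ce(2,3)[of t0] cos_monotone_0_pi[of 0 "2 * pi * e t0"] by (simp add: V_def)
  then have "{0..1} \<subseteq> (\<Union>t0\<in>{0..1}. V t0)" by blast
  ultimately obtain T where T: "T \<subseteq> {0..1}" "finite T" "{0..1} \<subseteq> (\<Union>t0\<in>T. V t0)"
    using compactE_image[OF compact_Icc[of 0 "1::real"]] by metis
  \<comment> \<open>The sum of the bumps is positive but not 1. Instead of normalising each bump,
    \<open>X\<close> is divided once by \<Theta>, giving \<open>Y\<close>, and \<open>X\<close> is
    the sum of the products of the bumps with \<open>Y\<close>.\<close>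
  define \<Theta> where "\<Theta> t = (\<Sum>t0\<in>T. bump t0 (e t0) t)" for t
  define \<Theta>' where "\<Theta>' t = (\<Sum>t0\<in>T. bump' t0 (e t0) t)" for t
  have \<Theta>der: "(\<Theta> has_real_derivative \<Theta>' t) (at t)" for t
    unfolding \<Theta>_def[abs_def] \<Theta>'_def by (intro DERIV_sum bump_has_derivative)
  have c\<Theta>': "continuous_on UNIV \<Theta>'" unfolding \<Theta>'_def[abs_def] by (intro continuous_intros continuous_on_bump')
  have c\<Theta>: "continuous_on UNIV \<Theta>" by (rule DERIV_continuous_on[OF DERIV_subset[OF \<Theta>der]]) simp
  have \<Theta>1: "\<Theta> (t + 1) = \<Theta> t" for t by (simp add: \<Theta>_def bump_periodic)
  have \<Theta>pos: "\<Theta> t > 0" for t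
  proof -
    define t' where "t' = t + of_int (- \<lfloor>t\<rfloor>)"
    have "t' \<in> {0..1}" unfolding t'_def by simp linarith
    then obtain t0 where t0: "t0 \<in> T" "t' \<in> V t0" using T(3) by blast
    then have "bump t0 (e t0) t' > 0" by (simp add: bump_def V_def)
    then have "\<Theta> t' > 0" unfolding \<Theta>_def using T(2) t0(1) by (intro sum_pos2[of T t0]) (auto simp: bump_nonneg)
    moreover have "\<Theta> t' = \<Theta> t" unfolding t'_def by (rule periodic_of_int[of \<Theta>, OF \<Theta>1])
    ultimately show ?thesis by simp
  qed
  have inv: "((\<lambda>t. 1 / \<Theta> t) has_vector_derivative - \<Theta>' t / (\<Theta> t)\<^sup>2) (at t)" for t
    unfolding has_real_derivative_iff_has_vector_derivative[symmetric]
    using \<Theta>pos[of t] by (auto intro!: derivative_eq_intros \<Theta>der simp: power2_eq_square)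
  have cinv: "continuous_on UNIV (\<lambda>t. - \<Theta>' t / (\<Theta> t)\<^sup>2)"
    using \<Theta>pos by (intro continuous_intros c\<Theta> c\<Theta>') (auto simp: less_imp_neq[symmetric])
  define Y where "Y = (\<lambda>t c. (1 / \<Theta> t) *\<^sub>R X t c)"
  have Y: "Y \<in> loop_tangent A p \<gamma>"
    unfolding Y_def by (rule loop_tangent_scaleR[OF p X inv cinv]) (simp add: \<Theta>1)
  have bd: "(bump t0 k has_vector_derivative bump' t0 k t) (at t)" for t0 k t
    unfolding has_real_derivative_iff_has_vector_derivative[symmetric] by (rule bump_has_derivative)
  have piece: "(\<lambda>t c. bump t0 (e t0) t *\<^sub>R Y t c) \<in> loop_tangent A p \<gamma>" for t0
    by (rule loop_tangent_scaleR[OF p Y bd continuous_on_bump' bump_periodic])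
  have piece0: "L (\<lambda>t c. bump t0 (e t0) t *\<^sub>R Y t c) = 0" for t0
  proof -
    define K where "K = {t. cos (2 * pi * (t - t0)) \<ge> cos (2 * pi * e t0)}"
    have "\<exists>\<sigma>. loop_path A p \<sigma> \<gamma> (\<lambda>t c. bump t0 (e t0) t *\<^sub>R Y t c)"
    proof (rule loop_path_localized[OF p \<gamma> piece ce(1)])
      show "closed K" unfolding K_def by (intro closed_Collect_le continuous_intros)
      have "cos (2 * pi * (t + 1 - t0)) = cos (2 * pi * (t - t0) + 2 * pi)" for t by (simp add: algebra_simps)
      then show "t + 1 \<in> K \<longleftrightarrow> t \<in> K" for t unfolding K_def by simp
      show "\<gamma> ` K \<subseteq> cdom (c t0)"
      proof clarify
        fix t assume "t \<in> K"
        then obtain n :: int where n: "t + of_int n \<in> {t0 - e t0..t0 + e t0}"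
          using bump_support[OF ce(2,3)[of t0], of t t0] unfolding K_def by blast
        have "\<gamma> (t + of_int n) = \<gamma> t" by (rule periodic_of_int[of \<gamma>, OF loop_spaceD(2)[OF \<gamma>]])
        then show "\<gamma> t \<in> cdom (c t0)" using ce(4) n by (metis image_subset_iff)
      qed
      show "(\<lambda>c. bump t0 (e t0) t *\<^sub>R Y t c) = (\<lambda>_. 0)" if "t \<notin> K" for t
        using that by (simp add: K_def bump_def max_def)
    qed
    then show ?thesis using L0 by blast
  qed
  have zero: "L (\<lambda>t c. 0) = 0" using L[OF X X, of 0 0] by simp
  \<comment> \<open>Linearity is available for two summands that lie in \<open>loop_tangent\<close>,
    hence an induction that carries the membership of the partial sums.\<close>
  have "(\<lambda>t c. (\<Sum>t0\<in>S. bump t0 (e t0) t) *\<^sub>R Y t c) \<in> loop_tangent A p \<gamma> \<and>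
      L (\<lambda>t c. (\<Sum>t0\<in>S. bump t0 (e t0) t) *\<^sub>R Y t c) = 0" if "finite S" for S
    using that
  proof (induction S)
    case empty
    show ?case using loop_tangent_combination[OF p X X, of 0 0] zero by simp
  next
    case (insert s S)
    have eq: "(\<lambda>t c. (\<Sum>t0\<in>insert s S. bump t0 (e t0) t) *\<^sub>R Y t c) =
        (\<lambda>t c. 1 *\<^sub>R (bump s (e s) t *\<^sub>R Y t c) + 1 *\<^sub>R ((\<Sum>t0\<in>S. bump t0 (e t0) t) *\<^sub>R Y t c))"
      using insert by (simp add: scaleR_left_distrib)
    have "L (\<lambda>t c. (\<Sum>t0\<in>insert s S. bump t0 (e t0) t) *\<^sub>R Y t c) = 0"
      unfolding eq using L[OF piece insert.IH[THEN conjunct1], of 1 s 1] piece0 insert.IH by simp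
    moreover have "(\<lambda>t c. (\<Sum>t0\<in>insert s S. bump t0 (e t0) t) *\<^sub>R Y t c) \<in> loop_tangent A p \<gamma>"
      unfolding eq by (rule loop_tangent_combination[OF p piece insert.IH[THEN conjunct1]])
    ultimately show ?case by blast
  qed
  from this[OF T(2)] have "L (\<lambda>t c. \<Theta> t *\<^sub>R Y t c) = 0" by (simp add: \<Theta>_def)
  moreover have "(\<lambda>t c. \<Theta> t *\<^sub>R Y t c) = X"
    using \<Theta>pos by (simp add: Y_def fun_eq_iff less_imp_neq[symmetric])
  ultimately show ?thesis by simp
qed

lemma has_loop_differential_unique:
  assumes p: "p \<ge> 1" and \<gamma>: "\<gamma> \<in> loop_space A p"
    and L: "has_loop_differential A p F \<gamma> L" and M: "has_loop_differential A p F \<gamma> M"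
    and X: "X \<in> loop_tangent A p \<gamma>"
  shows "L X = M X"
proof -
  have "L X - M X = 0"
  proof (rule loop_linear_functional_eq_0[OF p \<gamma> _ _ X, where L = "\<lambda>X. L X - M X"])
    show "L (\<lambda>t c. a *\<^sub>R X t c + b *\<^sub>R Y t c) - M (\<lambda>t c. a *\<^sub>R X t c + b *\<^sub>R Y t c) =
        a * (L X - M X) + b * (L Y - M Y)"
      if "X \<in> loop_tangent A p \<gamma>" "Y \<in> loop_tangent A p \<gamma>" for X Y a b
      using L M that unfolding has_loop_differential_def by (simp add: algebra_simps)
    show "L X - M X = 0" if "loop_path A p \<sigma> \<gamma> X" for \<sigma> X
      using L M that DERIV_unique unfolding has_loop_differential_def by fastforce
  qed
  then show ?thesis by simp
qed

text \<open>One witness \<open>L\<close> makes the choice by \<open>SOME\<close> satisfy the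
  defining property, and uniqueness then fixes its values on \<open>loop_tangent\<close>.\<close>

lemma loop_differential_eq:
  assumes "p \<ge> 1" "\<gamma> \<in> loop_space A p" "has_loop_differential A p F \<gamma> L" "X \<in> loop_tangent A p \<gamma>"
  shows "loop_differential A p F \<gamma> X = L X"
  using has_loop_differential_unique[OF assms(1,2) someI[of "has_loop_differential A p F \<gamma>", OF assms(3)] assms(3,4)]
  unfolding loop_differential_def .

text \<open>Linearity splits (X, l) into (X, 0) and (0, l). The first part is a functional on
  \<open>loop_tangent\<close> to which the localisation argument applies. For the second a path of
  loops with velocity zero suffices, the real parameter moving along \<tau> + s l; that path comes
  from the localised construction with empty support.\<close>

lemma has_ext_differential_unique:
  assumes p: "p \<ge> 1" and \<gamma>: "\<gamma> \<in> loop_space A p"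
    and L: "has_ext_differential A p F (\<gamma>, \<tau>) L" and M: "has_ext_differential A p F (\<gamma>, \<tau>) M"
    and X: "X \<in> loop_tangent A p \<gamma>"
  shows "L (X, l) = M (X, l)"
proof -
  have add: "N (\<lambda>t c. a *\<^sub>R X t c + b *\<^sub>R Y t c, a * k + b * l) = a * N (X, k) + b * N (Y, l)"
    if "has_ext_differential A p F (\<gamma>, \<tau>) N" "X \<in> loop_tangent A p \<gamma>" "Y \<in> loop_tangent A p \<gamma>" for N X Y a b k l
    using that unfolding has_ext_differential_def by simp
  have path: "L (X, l) = M (X, l)" if "loop_path A p \<sigma> \<gamma> X" for \<sigma> X l
  proof -
    have "((\<lambda>s. \<tau> + s * l) has_real_derivative l) (at 0)" by (auto intro!: derivative_eq_intros)
    then have "((\<lambda>s. F (\<sigma> s, \<tau> + s * l)) has_real_derivative L (X, l)) (at 0)"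
      "((\<lambda>s. F (\<sigma> s, \<tau> + s * l)) has_real_derivative M (X, l)) (at 0)"
      using L M that unfolding has_ext_differential_def by (auto elim!: allE[of _ \<sigma>])
    then show ?thesis by (rule DERIV_unique)
  qed
  have "L (X, 0) - M (X, 0) = 0"
  proof (rule loop_linear_functional_eq_0[OF p \<gamma> _ _ X, where L = "\<lambda>X. L (X, 0) - M (X, 0)"])
    show "L (\<lambda>t c. a *\<^sub>R X t c + b *\<^sub>R Y t c, 0) - M (\<lambda>t c. a *\<^sub>R X t c + b *\<^sub>R Y t c, 0) =
        a * (L (X, 0) - M (X, 0)) + b * (L (Y, 0) - M (Y, 0))"
      if "X \<in> loop_tangent A p \<gamma>" "Y \<in> loop_tangent A p \<gamma>" for X Y a b
      using add[OF L that, of a b 0 0] add[OF M that, of a b 0 0] by (simp add: algebra_simps)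
  qed (simp add: path)
  moreover have Z: "(\<lambda>t c. 0) \<in> loop_tangent A p \<gamma>"
    using loop_tangent_combination[OF p X X, of 0 0] by simp
  have "\<exists>\<sigma>. loop_path A p \<sigma> \<gamma> (\<lambda>t c. 0)"
  proof -
    obtain c where "c \<in> A" using ex_chart_at charts_atD by blast
    then show ?thesis by (intro loop_path_localized[OF p \<gamma> Z, where K = "{}"]) auto
  qed
  then have "L (\<lambda>t c. 0, l) = M (\<lambda>t c. 0, l)" using path by blast
  ultimately have eq: "L (X, 0) = M (X, 0)" "L (\<lambda>t c. 0, l) = M (\<lambda>t c. 0, l)" by simp_all
  have "N (X, l) = N (X, 0) + N (\<lambda>t c. 0, l)" if "has_ext_differential A p F (\<gamma>, \<tau>) N" for N
    using add[OF that X Z, of 1 1 0 l] by simp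
  from this[OF L] this[OF M] eq show ?thesis by simp
qed

lemma ext_differential_eq:
  assumes "p \<ge> 1" "\<gamma> \<in> loop_space A p" "has_ext_differential A p F (\<gamma>, \<tau>) L" "X \<in> loop_tangent A p \<gamma>"
  shows "ext_differential A p F (\<gamma>, \<tau>) (X, l) = L (X, l)"
  using has_ext_differential_unique[OF assms(1,2) someI[of "has_ext_differential A p F (\<gamma>, \<tau>)", OF assms(3)] assms(3,4)]
  unfolding ext_differential_def .

end

section \<open>Regularity of the gradient\<close>

lemma C1_on_mult:
  fixes f g :: "'e::euclidean_space \<Rightarrow> real"
  assumes f: "C1_on S f f'" and g: "C1_on S g g'"
  shows "C1_on S (\<lambda>x. f x * g x) (\<lambda>x v. f x * g' x v + f' x v * g x)"
  unfolding C1_on_def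
proof (intro conjI ballI allI)
  fix x assume "x \<in> S"
  then have "(f has_derivative f' x) (at x)" "(g has_derivative g' x) (at x)"
    using f g unfolding C1_on_def by blast+
  then show "((\<lambda>x. f x * g x) has_derivative (\<lambda>v. f x * g' x v + f' x v * g x)) (at x)"
    by (rule has_derivative_mult)
next
  fix v
  have "continuous_on S (\<lambda>x. f' x v)" "continuous_on S (\<lambda>x. g' x v)" using f g unfolding C1_on_def by blast+
  then show "continuous_on S (\<lambda>x. f x * g' x v + f' x v * g x)"
    using C1_on_imp_continuous_on[OF f] C1_on_imp_continuous_on[OF g] by (intro continuous_intros)
qed

lemma C1_on_sum:
  assumes "\<And>i. i \<in> I \<Longrightarrow> C1_on S (f i) (f' i)"
  shows "C1_on S (\<lambda>x. \<Sum>i\<in>I. f i x) (\<lambda>x v. \<Sum>i\<in>I. f' i x v)"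
  using assms unfolding C1_on_def
  by (auto intro!: has_derivative_sum continuous_intros)

lemma C1_on_compose_linear:
  assumes "C1_on S f f'" "bounded_linear L"
  shows "C1_on S (\<lambda>x. L (f x)) (\<lambda>x v. L (f' x v))"
  using assms unfolding C1_on_def
  by (auto intro: bounded_linear.has_derivative bounded_linear.continuous_on)

lemma C1_on_cong:
  assumes "C1_on S f f'" "open S" "\<And>x. x \<in> S \<Longrightarrow> g x = f x"
  shows "C1_on S g f'"
  unfolding C1_on_def
proof (intro conjI ballI allI)
  fix x assume x: "x \<in> S"
  then have "(f has_derivative f' x) (at x)" using assms unfolding C1_on_def by blast
  then show "(g has_derivative f' x) (at x)"
    by (rule has_derivative_transform_within_open[OF _ assms(2) x]) (simp add: assms(3))
qed (use assms in \<open>auto simp: C1_on_def\<close>)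

text \<open>An injective linear map in finite dimension is bounded below by some B > 0. The
  deviation of \<open>T y\<close> from \<open>T y0\<close> is controlled by its values on the basis,
  whose sum \<open>f\<close> tends to 0; once f y < B / 2, half of the lower bound survives.\<close>

lemma linear_family_coercive:
  fixes T :: "'e::euclidean_space \<Rightarrow> 'e \<Rightarrow> 'e"
  assumes S: "open S" and T: "\<And>v. continuous_on S (\<lambda>y. T y v)"
    and lin: "\<And>y. y \<in> S \<Longrightarrow> linear (T y)" and inj: "\<And>y v. y \<in> S \<Longrightarrow> T y v = 0 \<Longrightarrow> v = 0"
    and y0: "y0 \<in> S"
  obtains m f where "m > 0" "(f \<longlongrightarrow> 0) (at y0)"
    "\<forall>\<^sub>F y in at y0. y \<in> S \<and> (\<forall>v. m * norm v \<le> norm (T y v)) \<and> (\<forall>v. norm (T y v - T y0 v) \<le> f y * norm v)"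
proof -
  have "inj (T y0)" using lin[OF y0] inj[OF y0] by (simp add: linear_injective_0)
  then obtain B where B: "B > 0" "\<And>v. B * norm v \<le> norm (T y0 v)"
    using linear_inj_bounded_below_pos[OF lin[OF y0]] by metis
  define f where "f y = (\<Sum>i\<in>Basis. norm (T y i - T y0 i))" for y
  have "isCont (\<lambda>y. T y i) y0" for i using T S y0 continuous_on_eq_continuous_at by blast
  then have f0: "(f \<longlongrightarrow> 0) (at y0)" unfolding f_def isCont_def
    by (intro tendsto_null_sum tendsto_norm_zero LIM_zero)
  then have "\<forall>\<^sub>F y in at y0. f y < B / 2" using B(1) by (intro order_tendstoD) auto
  moreover have "\<forall>\<^sub>F y in at y0. y \<in> S" using S y0 eventually_at_topological by blast
  ultimately have "\<forall>\<^sub>F y in at y0. y \<in> S \<and> (\<forall>v. B / 2 * norm v \<le> norm (T y v)) \<and> (\<forall>v. norm (T y v - T y0 v) \<le> f y * norm v)"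
  proof eventually_elim
    case (elim y)
    have *: "norm (T y v - T y0 v) \<le> f y * norm v" for v
    proof -
      have "T z v = (\<Sum>i\<in>Basis. (v \<bullet> i) *\<^sub>R T z i)" if "z \<in> S" for z
        using linear_sum[OF lin[OF that], of "\<lambda>i. (v \<bullet> i) *\<^sub>R i" Basis]
        by (simp add: euclidean_representation linear_scale[OF lin[OF that]])
      then have "T y v - T y0 v = (\<Sum>i\<in>Basis. (v \<bullet> i) *\<^sub>R (T y i - T y0 i))"
        using elim y0 by (simp add: sum_subtractf scaleR_diff_right)
      also have "norm \<dots> \<le> (\<Sum>i\<in>Basis. norm (T y i - T y0 i) * norm v)"
        by (intro sum_norm_le) (auto simp: mult.commute[of "\<bar>_ \<bullet> _\<bar>"] intro!: mult_left_mono Basis_le_norm)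
      finally show ?thesis by (simp add: f_def sum_distrib_right)
    qed
    have "B / 2 * norm v \<le> norm (T y v)" for v
    proof -
      have "B * norm v \<le> norm (T y v) + norm (T y v - T y0 v)"
        using B(2)[of v] norm_triangle_ineq4[of "T y v" "T y v - T y0 v"] by simp
      also have "norm (T y v - T y0 v) \<le> B / 2 * norm v"
        using *[of v] elim by (meson less_imp_le mult_right_mono norm_ge_zero order_trans)
      finally show ?thesis by simp
    qed
    then show ?case using elim * by blast
  qed
  then show ?thesis using that[of "B / 2" f] B(1) f0 by simp
qed

text \<open>Coercivity applied to T y (V y - V y0) = \<eta> y - T y (V y0): the right-hand side is
  continuous and vanishes at \<open>y0\<close>. It serves both the solution and, later, its
  derivative.\<close>

lemma linear_family_solution_continuous:
  fixes T :: "'e::euclidean_space \<Rightarrow> 'e \<Rightarrow> 'e"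
  assumes S: "open S" and T: "\<And>v. continuous_on S (\<lambda>y. T y v)"
    and lin: "\<And>y. y \<in> S \<Longrightarrow> linear (T y)" and inj: "\<And>y v. y \<in> S \<Longrightarrow> T y v = 0 \<Longrightarrow> v = 0"
    and \<eta>: "continuous_on S \<eta>" and sol: "\<And>y. y \<in> S \<Longrightarrow> T y (V y) = \<eta> y"
  shows "continuous_on S V"
proof (rule continuous_at_imp_continuous_on, rule ballI)
  fix y0 assume y0: "y0 \<in> S"
  obtain m f where mf: "m > 0" "(f \<longlongrightarrow> 0) (at y0)" "\<forall>\<^sub>F y in at y0. y \<in> S \<and> (\<forall>v. m * norm v \<le> norm (T y v)) \<and> (\<forall>v. norm (T y v - T y0 v) \<le> f y * norm v)"
    by (rule linear_family_coercive[OF S T lin inj y0])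
  have "isCont (\<lambda>y. \<eta> y - T y (V y0)) y0"
    using \<eta> T[of "V y0"] S y0 by (intro continuous_intros) (simp_all add: continuous_on_eq_continuous_at)
  then have "((\<lambda>y. norm (\<eta> y - T y (V y0)) / m) \<longlongrightarrow> 0) (at y0)"
    unfolding isCont_def sol[OF y0] by (intro tendsto_divide_zero tendsto_norm_zero) simp
  moreover have "\<forall>\<^sub>F y in at y0. norm (V y - V y0) \<le> norm (\<eta> y - T y (V y0)) / m"
    using mf(3)
  proof eventually_elim
    case (elim y)
    have "T y (V y - V y0) = \<eta> y - T y (V y0)" using elim sol lin by (simp add: linear_diff)
    then have "m * norm (V y - V y0) \<le> norm (\<eta> y - T y (V y0))" using elim by metis
    then show ?case using mf(1) by (simp add: field_simps)
  qed
  ultimately have "((\<lambda>y. V y - V y0) \<longlongrightarrow> 0) (at y0)" by (rule Lim_null_comparison[rotated])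
  then show "isCont V y0" unfolding isCont_def by (rule LIM_zero_cancel)
qed

text \<open>Through coercivity this gives a Lipschitz bound for V y - V y0 at \<open>y0\<close>
  before \<open>V\<close> is known to be differentiable there.\<close>

lemma has_derivative_imp_linear_bound:
  assumes "(R has_derivative R') (at y0)" "R y0 = 0"
  obtains C where "C \<ge> 0" "\<forall>\<^sub>F y in at y0. norm (R y) \<le> C * norm (y - y0)"
proof -
  obtain K where K: "K > 0" "\<And>h. norm (R' h) \<le> norm h * K"
    using bounded_linear.pos_bounded[OF has_derivative_bounded_linear[OF assms(1)]] by blast
  have "((\<lambda>y. norm (R y - R y0 - R' (y - y0)) / norm (y - y0)) \<longlongrightarrow> 0) (at y0)"
    using assms(1) unfolding has_derivative_iff_norm by blast
  then have "\<forall>\<^sub>F y in at y0. norm (R y - R y0 - R' (y - y0)) / norm (y - y0) < 1"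
    by (intro order_tendstoD) auto
  moreover have "\<forall>\<^sub>F y in at y0. y \<noteq> y0" by (simp add: eventually_at_filter)
  ultimately have "\<forall>\<^sub>F y in at y0. norm (R y) \<le> (1 + K) * norm (y - y0)"
  proof eventually_elim
    case (elim y)
    then have "norm (R y - R' (y - y0)) \<le> norm (y - y0)" using assms(2) by (simp add: field_simps)
    then show ?case using K(2)[of "y - y0"] norm_triangle_ineq[of "R y - R' (y - y0)" "R' (y - y0)"]
      by (simp add: algebra_simps)
  qed
  then show ?thesis using that[of "1 + K"] K(1) by simp
qed

text \<open>\<open>T\<^sub>y (V y - V y\<^sub>0) = \<eta> y - T\<^sub>y (V y\<^sub>0)\<close>, whose right-hand side is differentiable in \<open>y\<close>;
  replacing \<open>T\<^sub>y\<close> by \<open>T\<^bsub>y\<^sub>0\<^esub>\<close> on the left costs only \<open>o(\<bar>y - y\<^sub>0\<bar>)\<close>.\<close>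

lemma linear_family_solution_C1:
  fixes T :: "'e::euclidean_space \<Rightarrow> 'e \<Rightarrow> 'e"
  assumes S: "open S" and T: "\<And>v. C1_on S (\<lambda>y. T y v) (T' v)"
    and lin: "\<And>y. y \<in> S \<Longrightarrow> linear (T y)" and inj: "\<And>y v. y \<in> S \<Longrightarrow> T y v = 0 \<Longrightarrow> v = 0"
    and \<eta>: "C1_on S \<eta> \<eta>'" and sol: "\<And>y. y \<in> S \<Longrightarrow> T y (V y) = \<eta> y"
  shows "\<exists>V'. C1_on S V V'"
proof -
  note cT = C1_on_imp_continuous_on[OF T]
  have cV: "continuous_on S V"
    by (rule linear_family_solution_continuous[OF S cT lin inj C1_on_imp_continuous_on[OF \<eta>] sol])
  \<comment> \<open>Formal differentiation of T y (V y) = \<eta> y in the direction \<open>h\<close>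
    gives T y (V' y h) = rhs y h. The vector \<open>V y\<close> is expanded in the basis because
    derivatives of \<open>T\<close> are given at fixed vectors.\<close>
  define rhs where "rhs y h = \<eta>' y h - (\<Sum>i\<in>Basis. (V y \<bullet> i) *\<^sub>R T' i y h)" for y h
  define V' where "V' y h = inv (T y) (rhs y h)" for y h
  have injT: "inj (T y)" if "y \<in> S" for y using lin[OF that] inj[OF that] by (simp add: linear_injective_0)
  have V': "T y (V' y h) = rhs y h" if "y \<in> S" for y h
    unfolding V'_def by (rule surj_f_inv_f[OF linear_inj_imp_surj[OF lin[OF that] injT[OF that]]])
  have crhs: "continuous_on S (\<lambda>y. rhs y h)" for h
    using T \<eta> unfolding rhs_def C1_on_def by (intro continuous_intros cV) auto
  \<comment> \<open>\<open>V'\<close> solves a linear family of the same kind as \<open>V\<close>,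
    with right-hand side \<open>rhs\<close>, so its continuity comes from the same lemma.\<close>
  have cV': "continuous_on S (\<lambda>y. V' y h)" for h
    by (rule linear_family_solution_continuous[OF S cT lin inj crhs V'])
  have "(V has_derivative V' y0) (at y0)" if y0: "y0 \<in> S" for y0
  proof -
    define R where "R y = \<eta> y - T y (V y0)" for y
    have R0: "R y0 = 0" by (simp add: R_def sol[OF y0])
    have Tsum: "(\<Sum>i\<in>Basis. (V y0 \<bullet> i) *\<^sub>R T z i) = T z (V y0)" if "z \<in> S" for z
      using linear_sum[OF lin[OF that], of "\<lambda>i. (V y0 \<bullet> i) *\<^sub>R i" Basis]
      by (simp add: euclidean_representation linear_scale[OF lin[OF that]])
    have "((\<lambda>y. \<Sum>i\<in>Basis. (V y0 \<bullet> i) *\<^sub>R T y i) has_derivative (\<lambda>h. \<Sum>i\<in>Basis. (V y0 \<bullet> i) *\<^sub>R T' i y0 h)) (at y0)"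
      using T y0 unfolding C1_on_def by (intro has_derivative_sum has_derivative_scaleR_right) blast
    then have "((\<lambda>y. T y (V y0)) has_derivative (\<lambda>h. \<Sum>i\<in>Basis. (V y0 \<bullet> i) *\<^sub>R T' i y0 h)) (at y0)"
      by (rule has_derivative_transform_within_open[OF _ S y0]) (rule Tsum)
    moreover have "(\<eta> has_derivative \<eta>' y0) (at y0)" using \<eta> y0 unfolding C1_on_def by blast
    ultimately have R': "(R has_derivative rhs y0) (at y0)"
      unfolding R_def rhs_def by (intro has_derivative_diff)
    obtain C where C: "C \<ge> 0" "\<forall>\<^sub>F y in at y0. norm (R y) \<le> C * norm (y - y0)"
      by (rule has_derivative_imp_linear_bound[OF R' R0])
    obtain m f where mf: "m > 0" "(f \<longlongrightarrow> 0) (at y0)"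
      "\<forall>\<^sub>F y in at y0. y \<in> S \<and> (\<forall>v. m * norm v \<le> norm (T y v)) \<and> (\<forall>v. norm (T y v - T y0 v) \<le> f y * norm v)"
      by (rule linear_family_coercive[OF S cT lin inj y0])
    \<comment> \<open>The cost of replacing \<open>T y\<close> by \<open>T y0\<close>. It is at most
      f y * norm (V y - V y0), hence at most f y * (C / m) * norm (y - y0), with \<open>f\<close>
      tending to 0.\<close>
    define E where "E y = T y0 (V y - V y0) - T y (V y - V y0)" for y
    have TV: "T y (V y - V y0) = R y" if "y \<in> S" for y
      using that sol lin by (simp add: R_def linear_diff)
    have "((\<lambda>y. norm (E y) / norm (y - y0)) \<longlongrightarrow> 0) (at y0)"
    proof (rule Lim_null_comparison)
      show "((\<lambda>y. f y * (C / m)) \<longlongrightarrow> 0) (at y0)" by (rule tendsto_mult_left_zero[OF mf(2)])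
      show "\<forall>\<^sub>F y in at y0. norm (norm (E y) / norm (y - y0)) \<le> f y * (C / m)"
        using C(2) mf(3)
      proof eventually_elim
        case (elim y)
        have "norm (E y) \<le> f y * norm (V y - V y0)"
          using elim(2) unfolding E_def by (metis norm_minus_commute)
        moreover have "m * norm (V y - V y0) \<le> C * norm (y - y0)"
          using elim TV[of y] by (metis order_trans)
        then have "norm (V y - V y0) \<le> C / m * norm (y - y0)" using mf(1) by (simp add: field_simps)
        \<comment> \<open>Nonnegativity of \<open>f y\<close> is read off by testing its defining
          bound on a unit vector.\<close>
        moreover have "f y \<ge> 0"
        proof -
          obtain b :: 'e where "b \<in> Basis" using nonempty_Basis by blast
          then have "norm b = 1" by simp
          then show ?thesis using elim(2) norm_ge_zero[of "T y b - T y0 b"] by (metis mult.right_neutral order_trans)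
        qed
        ultimately have "norm (E y) \<le> f y * (C / m * norm (y - y0))"
          by (meson mult_left_mono order_trans)
        then have "norm (E y) / norm (y - y0) \<le> f y * (C / m)"
          using C(1) mf(1) \<open>f y \<ge> 0\<close> by (cases "y = y0") (simp_all add: divide_le_eq mult.assoc)
        then show ?case by simp
      qed
    qed
    then have E': "(E has_derivative (\<lambda>_. 0)) (at y0)"
      unfolding has_derivative_iff_norm by (simp add: E_def linear_0[OF lin[OF y0]])
    \<comment> \<open>With the left inverse \<open>g\<close> of \<open>T y0\<close>, V y = V y0 + g
      (R y + E y), where \<open>E\<close> has derivative 0 at \<open>y0\<close>.\<close>
    obtain g where g: "linear g" "\<And>x. g (T y0 x) = x"
      using linear_injective_isomorphism[OF lin[OF y0] injT[OF y0]] by blast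
    then have bg: "bounded_linear g" by (simp add: linear_conv_bounded_linear)
    have "((\<lambda>y. V y0 + g (R y + E y)) has_derivative (\<lambda>h. 0 + g (rhs y0 h + 0))) (at y0)"
      by (intro has_derivative_add has_derivative_const bounded_linear.has_derivative[OF bg] R' E')
    then have "(V has_derivative (\<lambda>h. 0 + g (rhs y0 h + 0))) (at y0)"
    proof (rule has_derivative_transform_within_open[OF _ S y0])
      fix y assume y: "y \<in> S"
      have "R y + E y = T y0 (V y - V y0)" using TV[OF y] by (simp add: E_def)
      then show "V y0 + g (R y + E y) = V y" by (simp add: g(2))
    qed
    moreover have "(\<lambda>h. 0 + g (rhs y0 h + 0)) = V' y0"
    proof
      fix h
      show "0 + g (rhs y0 h + 0) = V' y0 h" using g(2)[of "V' y0 h"] unfolding V'[OF y0] by simp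
    qed
    ultimately show ?thesis by simp
  qed
  then show ?thesis using cV' unfolding C1_on_def by blast
qed

section \<open>The two-form, the metric and the gradient in charts\<close>

lemma linear_combination:
  fixes f :: "'e::real_vector \<Rightarrow> real"
  shows "linear f \<Longrightarrow> f (a *\<^sub>R v + b *\<^sub>R w) = a * f v + b * f w"
  by (simp add: linear_add linear_scale)

lemma linear_basis_expansion:
  fixes f :: "'e::euclidean_space \<Rightarrow> real"
  assumes "linear f"
  shows "f w = (\<Sum>i\<in>Basis. (w \<bullet> i) * f i)"
proof -
  have "f w = f (\<Sum>i\<in>Basis. (w \<bullet> i) *\<^sub>R i)" by (simp only: euclidean_representation)
  also have "\<dots> = (\<Sum>i\<in>Basis. (w \<bullet> i) * f i)" using assms by (simp add: linear_sum linear_scale)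
  finally show ?thesis .
qed

locale two_form_manifold = smooth_manifold A
  for A :: "('a::topological_space, 'e::euclidean_space) chart set" +
  fixes om :: "('a, 'e) two_form"
  assumes om: "smooth_two_form A om"
begin

lemma om_antisym: "v \<in> tangent_space A x \<Longrightarrow> w \<in> tangent_space A x \<Longrightarrow> om x v w = - om x w v"
  using om unfolding smooth_two_form_def by blast

lemma om_chart_linear_left:
  assumes "c \<in> charts_at A x"
  shows "linear (\<lambda>v. om x (tvec_of A c x v) (tvec_of A c x w))"
  using om charts_atD[OF assms] unfolding smooth_two_form_def by blast

lemma om_linear_left:
  assumes v: "v \<in> tangent_space A x" and v': "v' \<in> tangent_space A x" and w: "w \<in> tangent_space A x"
  shows "om x (\<lambda>c. a *\<^sub>R v c + b *\<^sub>R v' c) w = a * om x v w + b * om x v' w"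
proof -
  obtain c where c: "c \<in> charts_at A x" using ex_chart_at by blast
  have "om x (tvec_of A c x (a *\<^sub>R v c + b *\<^sub>R v' c)) (tvec_of A c x (w c)) =
      a * om x (tvec_of A c x (v c)) (tvec_of A c x (w c)) + b * om x (tvec_of A c x (v' c)) (tvec_of A c x (w c))"
    by (rule linear_combination[OF om_chart_linear_left[OF c]])
  then show ?thesis
    unfolding tvec_of_combination[OF c, symmetric] by (simp only: tvec_of_tangent[OF c] v v' w)
qed

lemma om_linear_right:
  assumes "v \<in> tangent_space A x" "w \<in> tangent_space A x" "w' \<in> tangent_space A x"
  shows "om x v (\<lambda>c. a *\<^sub>R w c + b *\<^sub>R w' c) = a * om x v w + b * om x v w'"
  using om_antisym[OF assms(1) tangent_space_combination[OF assms(2,3)], of a b] om_linear_left[OF assms(2,3,1), of a b]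
    om_antisym[OF assms(1,2)] om_antisym[OF assms(1,3)] by simp

lemma om_chart_linear_right:
  assumes "c \<in> charts_at A x" "v \<in> tangent_space A x"
  shows "linear (\<lambda>w. om x v (tvec_of A c x w))"
proof (rule linearI)
  fix w w' :: 'e and r :: real
  show "om x v (tvec_of A c x (w + w')) = om x v (tvec_of A c x w) + om x v (tvec_of A c x w')"
    using om_linear_right[OF assms(2) tvec_of_in_tangent_space[OF assms(1)] tvec_of_in_tangent_space[OF assms(1)], of 1 w 1 w']
    unfolding tvec_of_combination[OF assms(1)] by simp
  show "om x v (tvec_of A c x (r *\<^sub>R w)) = r *\<^sub>R om x v (tvec_of A c x w)"
    using om_linear_right[OF assms(2) tvec_of_in_tangent_space[OF assms(1)] tvec_of_in_tangent_space[OF assms(1)], of r w 0 w]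
    unfolding tvec_of_combination[OF assms(1)] by simp
qed

end

locale compatible_manifold = two_form_manifold A om
  for A :: "('a::topological_space, 'e::euclidean_space) chart set" and om +
  fixes J :: "('a, 'e) endo_field"
  assumes J: "almost_complex A J" and compat: "compatible A om J"
begin

abbreviation grad :: "('a \<Rightarrow> real) \<Rightarrow> 'a \<Rightarrow> ('a, 'e) tvec" where
  "grad \<equiv> gradient A (compatible_metric om J)"

lemma J_tangent: "v \<in> tangent_space A x \<Longrightarrow> J x v \<in> tangent_space A x"
  using J unfolding almost_complex_def by blast

lemma metric_pos: "v \<in> tangent_space A x \<Longrightarrow> v \<noteq> (\<lambda>_. 0) \<Longrightarrow> om x v (J x v) > 0"
  using compat unfolding compatible_def by blast

lemma metric_definite: "v \<in> tangent_space A x \<Longrightarrow> om x v (J x v) = 0 \<Longrightarrow> v = (\<lambda>_. 0)"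
  using metric_pos less_irrefl by metis

text \<open>The Gram operator of the metric in the chart \<open>c\<close>: its inner product with
  \<open>w\<close> is g(v, w), see \<open>gram_inner\<close>. It turns the equation for the gradient
  into a linear system between coordinate vectors.\<close>

definition gram :: "('a, 'e) chart \<Rightarrow> 'e \<Rightarrow> 'e \<Rightarrow> 'e" where
  "gram c y v = (\<Sum>w\<in>Basis. om (cinv c y) (tvec_of A c (cinv c y) v) (J (cinv c y) (tvec_of A c (cinv c y) w)) *\<^sub>R w)"

lemma metric_chart_linear_right:
  assumes c: "c \<in> charts_at A x" and v: "v \<in> tangent_space A x"
  shows "linear (\<lambda>w. om x v (J x (tvec_of A c x w)))"
proof -
  have "linear (\<lambda>w. J x (tvec_of A c x w) c)"
    using J charts_atD[OF c] unfolding almost_complex_def by blast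
  from linear_compose[OF this om_chart_linear_right[OF c v]]
  show ?thesis
    by (simp add: o_def tvec_of_tangent[OF c J_tangent[OF tvec_of_in_tangent_space[OF c]]])
qed

lemma metric_chart_linear_left:
  assumes c: "c \<in> charts_at A x"
  shows "linear (\<lambda>v. om x (tvec_of A c x v) (J x (tvec_of A c x w)))"
  using om_chart_linear_left[OF c, of "J x (tvec_of A c x w) c"]
  by (simp only: tvec_of_tangent[OF c J_tangent[OF tvec_of_in_tangent_space[OF c]]])

lemma gram_inner:
  assumes c: "c \<in> A" and y: "y \<in> cimg c"
  shows "gram c y v \<bullet> w = om (cinv c y) (tvec_of A c (cinv c y) v) (J (cinv c y) (tvec_of A c (cinv c y) w))"
proof -
  have x: "c \<in> charts_at A (cinv c y)" using chart(7)[OF c y] c by (rule charts_atI[rotated])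
  let ?l = "\<lambda>w. om (cinv c y) (tvec_of A c (cinv c y) v) (J (cinv c y) (tvec_of A c (cinv c y) w))"
  have lin: "linear ?l" by (rule metric_chart_linear_right[OF x tvec_of_in_tangent_space[OF x]])
  have "?l w = (\<Sum>i\<in>Basis. (w \<bullet> i) * ?l i)" by (rule linear_basis_expansion[OF lin])
  also have "\<dots> = gram c y v \<bullet> w" unfolding gram_def by (simp add: inner_sum_left inner_commute[of w] mult.commute)
  finally show ?thesis by simp
qed

lemma linear_gram:
  assumes c: "c \<in> A" and y: "y \<in> cimg c"
  shows "linear (gram c y)"
proof -
  have x: "c \<in> charts_at A (cinv c y)" using chart(7)[OF c y] c by (rule charts_atI[rotated])
  show ?thesis
    unfolding gram_def[abs_def]
    by (intro linear_compose_sum ballI bounded_linear.linear bounded_linear_scaleR_left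
        linear_compose[OF metric_chart_linear_left[OF x], unfolded o_def, of "\<lambda>r. r *\<^sub>R _"])
qed

lemma gram_eq_0:
  assumes c: "c \<in> A" and y: "y \<in> cimg c" and "gram c y v = 0"
  shows "v = 0"
proof -
  have x: "c \<in> charts_at A (cinv c y)" using chart(7)[OF c y] c by (rule charts_atI[rotated])
  have "gram c y v \<bullet> v = 0" using assms(3) by simp
  then have "tvec_of A c (cinv c y) v = (\<lambda>_. 0)"
    unfolding gram_inner[OF c y] by (rule metric_definite[OF tvec_of_in_tangent_space[OF x]])
  then show "v = 0" using tvec_of_coord[OF x, of v] by simp
qed

text \<open>Smoothness of \<open>om\<close> is given on constant coordinate fields, and
  \<open>J\<close> applied to such a field is no longer constant. Expanding it in the basis makes
  every entry a finite sum of products of coordinates of \<open>J\<close> with entries of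
  \<open>om\<close>.\<close>

lemma gram_C1_on:
  assumes c: "c \<in> A"
  shows "\<exists>T'. C1_on (cimg c) (\<lambda>y. gram c y v) T'"
proof -
  define o2 where "o2 j y = om (cinv c y) (tvec_of A c (cinv c y) v) (tvec_of A c (cinv c y) j)" for j y
  define Jc where "Jc w y = J (cinv c y) (tvec_of A c (cinv c y) w) c" for w y
  define o2' where "o2' j = (\<lambda>y. frechet_derivative (o2 j) (at y))" for j
  define Jc' where "Jc' w = (\<lambda>y. frechet_derivative (Jc w) (at y))" for w
  have "smooth_on (cimg c) (o2 j)" for j
    using om c unfolding smooth_two_form_def o2_def by blast
  then have o2': "C1_on (cimg c) (o2 j) (o2' j)" for j unfolding o2'_def by (rule smooth_on_imp_C1_on)
  have "smooth_on (cimg c) (Jc w)" for w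
    using J c unfolding almost_complex_def Jc_def by blast
  then have Jc': "C1_on (cimg c) (Jc w) (Jc' w)" for w unfolding Jc'_def by (rule smooth_on_imp_C1_on)
  have "C1_on (cimg c) (\<lambda>y. \<Sum>w\<in>Basis. (\<Sum>j\<in>Basis. (Jc w y \<bullet> j) * o2 j y) *\<^sub>R w)
     (\<lambda>y h. \<Sum>w\<in>Basis. (\<Sum>j\<in>Basis. (Jc w y \<bullet> j) * o2' j y h + (Jc' w y h \<bullet> j) * o2 j y) *\<^sub>R w)"
    by (rule C1_on_sum, rule C1_on_compose_linear[OF _ bounded_linear_scaleR_left], rule C1_on_sum,
        rule C1_on_mult[OF C1_on_compose_linear[OF Jc' bounded_linear_inner_left] o2'])
  then show ?thesis
  proof (intro exI, rule C1_on_cong[OF _ chart(2)[OF c]])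
    fix y assume y: "y \<in> cimg c"
    have x: "c \<in> charts_at A (cinv c y)" using chart(7)[OF c y] c by (rule charts_atI[rotated])
    let ?l = "\<lambda>w. om (cinv c y) (tvec_of A c (cinv c y) v) (tvec_of A c (cinv c y) w)"
    have lin: "linear ?l" by (rule om_chart_linear_right[OF x tvec_of_in_tangent_space[OF x]])
    have "om (cinv c y) (tvec_of A c (cinv c y) v) (J (cinv c y) (tvec_of A c (cinv c y) w)) = (\<Sum>j\<in>Basis. (Jc w y \<bullet> j) * o2 j y)" for w
    proof -
      have "om (cinv c y) (tvec_of A c (cinv c y) v) (J (cinv c y) (tvec_of A c (cinv c y) w)) = ?l (Jc w y)"
        unfolding Jc_def by (simp only: tvec_of_tangent[OF x J_tangent[OF tvec_of_in_tangent_space[OF x]]])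
      also have "\<dots> = (\<Sum>j\<in>Basis. (Jc w y \<bullet> j) * o2 j y)" unfolding o2_def by (rule linear_basis_expansion[OF lin])
      finally show ?thesis .
    qed
    then show "gram c y v = (\<Sum>w\<in>Basis. (\<Sum>j\<in>Basis. (Jc w y \<bullet> j) * o2 j y) *\<^sub>R w)"
      unfolding gram_def by simp
  qed
qed

lemma linear_dfun_chart:
  assumes f: "smooth_fun A f" and c: "c \<in> charts_at A x"
  shows "linear (\<lambda>w. dfun A f x (tvec_of A c x w))"
proof -
  have "linear (frechet_derivative (f \<circ> cinv c) (at (cmap c x)))"
    using C1_on_linear[OF smooth_fun_C1_on[OF f]] charts_atD[OF c] by blast
  then show ?thesis
    by (simp add: dfun_chart[OF f c tvec_of_in_tangent_space[OF c]] tvec_of_coord[OF c])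
qed

text \<open>\<open>gradient\<close> is a definite description, so unique existence comes first.
  Positive definiteness makes \<open>gram\<close> injective, hence surjective by dimension, which
  gives a solution; the difference of two solutions is orthogonal to itself and so vanishes.\<close>

lemma gradient:
  assumes f: "smooth_fun A f"
  shows "grad f x \<in> tangent_space A x"
    and "w \<in> tangent_space A x \<Longrightarrow> om x (grad f x) (J x w) = dfun A f x w"
proof -
  obtain c where c: "c \<in> charts_at A x" using ex_chart_at by blast
  then have cA: "c \<in> A" "x \<in> cdom c" using charts_atD by auto
  define y where "y = cmap c x"
  have y: "y \<in> cimg c" "cinv c y = x" using cA chart(5)[OF cA] by (auto simp: y_def)
  have inj: "inj (gram c y)"
    using linear_gram[OF cA(1) y(1)] gram_eq_0[OF cA(1) y(1)] by (simp add: linear_injective_0)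
  have surj: "surj (gram c y)" by (rule linear_inj_imp_surj[OF linear_gram[OF cA(1) y(1)] inj])
  \<comment> \<open>The Euclidean representative of the differential of \<open>f\<close> in the
    chart, which is the right-hand side of the linear system.\<close>
  define \<eta> where "\<eta> = (\<Sum>i\<in>Basis. dfun A f x (tvec_of A c x i) *\<^sub>R i)"
  have \<eta>: "\<eta> \<bullet> w = dfun A f x (tvec_of A c x w)" for w
  proof -
    have lin: "linear (\<lambda>w. dfun A f x (tvec_of A c x w))" by (rule linear_dfun_chart[OF f c])
    have "dfun A f x (tvec_of A c x w) = (\<Sum>i\<in>Basis. (w \<bullet> i) * dfun A f x (tvec_of A c x i))"
      by (rule linear_basis_expansion[OF lin])
    also have "\<dots> = \<eta> \<bullet> w" by (simp add: \<eta>_def inner_sum_left inner_commute[of w] mult.commute)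
    finally show ?thesis by simp
  qed
  obtain v0 where v0: "gram c y v0 = \<eta>" using surj by (metis surjD)
  define v where "v = tvec_of A c x v0"
  have vT: "v \<in> tangent_space A x" unfolding v_def by (rule tvec_of_in_tangent_space[OF c])
  have v: "om x v (J x w) = dfun A f x w" if "w \<in> tangent_space A x" for w
    using gram_inner[OF cA(1) y(1), of v0 "w c"] \<eta>[of "w c"] unfolding v0 y(2) v_def
    by (simp add: tvec_of_tangent[OF c that])
  have "grad f x = v"
    unfolding gradient_def compatible_metric_def
  proof (rule the_equality)
    show "v \<in> tangent_space A x \<and> (\<forall>w\<in>tangent_space A x. om x v (J x w) = dfun A f x w)" using vT v by blast
    fix u assume u: "u \<in> tangent_space A x \<and> (\<forall>w\<in>tangent_space A x. om x u (J x w) = dfun A f x w)"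
    define d where "d = (\<lambda>c. 1 *\<^sub>R u c + (-1) *\<^sub>R v c)"
    have dT: "d \<in> tangent_space A x" unfolding d_def using u vT by (intro tangent_space_combination) auto
    have "om x d (J x d) = 1 * om x u (J x d) + (-1) * om x v (J x d)"
      using u vT J_tangent[OF dT] by (subst d_def, intro om_linear_left) auto
    then have "om x d (J x d) = 0" using u v dT by simp
    then have "d = (\<lambda>_. 0)" by (rule metric_definite[OF dT])
    then show "u = v" by (simp add: d_def fun_eq_iff)
  qed
  then show "grad f x \<in> tangent_space A x"
    "w \<in> tangent_space A x \<Longrightarrow> om x (grad f x) (J x w) = dfun A f x w"
    using vT v by auto
qed

text \<open>In the chart the gradient solves \<open>gram c y\<close> V = \<eta> y, with \<eta> the
  Euclidean gradient of the coordinate expression of \<open>f\<close>. Both sides have C1 data, the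
  right one because \<open>f\<close> is smooth, so the solution is C1.\<close>

lemma gradient_C1_on:
  assumes f: "smooth_fun A f" and c: "c \<in> A"
  shows "\<exists>V'. C1_on (cimg c) (\<lambda>y. grad f (cinv c y) c) V'"
proof -
  obtain T' where T': "\<And>v. C1_on (cimg c) (\<lambda>y. gram c y v) (T' v)" using gram_C1_on[OF c] by metis
  define \<eta> where "\<eta> y = (\<Sum>i\<in>Basis. frechet_derivative (f \<circ> cinv c) (at y) i *\<^sub>R i)" for y
  have "smooth_on (cimg c) (f \<circ> cinv c)" using f c unfolding smooth_fun_def by blast
  from smooth_on_imp_C1_on[OF smooth_on_frechet_derivative[OF this]]
  have \<eta>: "C1_on (cimg c) \<eta> (\<lambda>y h. \<Sum>i\<in>Basis. frechet_derivative (\<lambda>y. frechet_derivative (f \<circ> cinv c) (at y) i) (at y) h *\<^sub>R i)"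
    unfolding \<eta>_def by (rule C1_on_sum[OF C1_on_compose_linear[OF _ bounded_linear_scaleR_left]])
  show ?thesis
  proof (rule linear_family_solution_C1[OF chart(2)[OF c] T' linear_gram[OF c] gram_eq_0[OF c] \<eta>])
    fix y assume y: "y \<in> cimg c"
    have x: "c \<in> charts_at A (cinv c y)" using chart(7)[OF c y] c by (rule charts_atI[rotated])
    let ?g = "grad f (cinv c y)"
    show "gram c y (?g c) = \<eta> y"
      unfolding gram_def \<eta>_def
    proof (rule sum.cong[OF refl])
      fix i :: 'e
      have "om (cinv c y) ?g (J (cinv c y) (tvec_of A c (cinv c y) i)) = frechet_derivative (f \<circ> cinv c) (at y) i"
        unfolding gradient(2)[OF f tvec_of_in_tangent_space[OF x]] dfun_chart[OF f x tvec_of_in_tangent_space[OF x]]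
        by (simp add: tvec_of_coord[OF x] chart(6)[OF c y])
      then show "om (cinv c y) (tvec_of A c (cinv c y) (?g c)) (J (cinv c y) (tvec_of A c (cinv c y) i)) *\<^sub>R i =
          frechet_derivative (f \<circ> cinv c) (at y) i *\<^sub>R i"
        by (simp only: tvec_of_tangent[OF x gradient(1)[OF f]])
    qed
  qed
qed

text \<open>The chain rule composes the C1 coordinate expression with the Sobolev loop. Membership
  matters because the differentials in \<open>constraint_factor\<close> are determined on
  \<open>loop_tangent\<close> only.\<close>

lemma gradient_loop_tangent:
  assumes p: "p \<ge> 1" and \<gamma>: "\<gamma> \<in> loop_space A p" and f: "smooth_fun A f"
  shows "(\<lambda>t. grad f (\<gamma> t)) \<in> loop_tangent A p \<gamma>"
  unfolding loop_tangent_def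
proof (intro CollectI conjI allI ballI impI)
  fix c a b assume c: "c \<in> A" and ab: "a < b \<and> \<gamma> ` {a..b} \<subseteq> cdom c"
  obtain V' where V': "C1_on (cimg c) (\<lambda>y. grad f (cinv c y) c) V'"
    using gradient_C1_on[OF f c] by blast
  have "sobolev_on p a b (\<lambda>t. cmap c (\<gamma> t))" using loop_spaceD(3)[OF \<gamma> c] ab by blast
  then have "sobolev_deriv p a b (\<lambda>t. cmap c (\<gamma> t)) (\<lambda>t. vector_derivative (\<lambda>t. cmap c (\<gamma> t)) (at t))"
    by (simp only: sobolev_on_iff[OF p])
  from sobolev_deriv_compose[OF p this chart(2)[OF c] _ V'] ab
  have "sobolev_on p a b (\<lambda>t. grad f (cinv c (cmap c (\<gamma> t))) c)"
    by (intro sobolev_deriv_imp_sobolev_on[OF p]) blast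
  moreover have "cinv c (cmap c (\<gamma> t)) = \<gamma> t" if "t \<in> {a..b}" for t using chart(5)[OF c] ab that by blast
  ultimately show "sobolev_on p a b (\<lambda>t. grad f (\<gamma> t) c)"
    by (subst sobolev_on_cong[OF p, where u = "\<lambda>t. grad f (cinv c (cmap c (\<gamma> t))) c"]) simp_all
qed (simp_all add: gradient(1)[OF f] loop_spaceD(2)[OF \<gamma>])

end

section \<open>Existence of the differentials\<close>

text \<open>For x > e, write x = x powr (1 - p) * x powr p; the first factor is at most e powr (1 -
  p) since 1 - p \<le> 0.\<close>

lemma le_eps_plus_powr:
  fixes x e p :: real
  assumes "p \<ge> 1" "e > 0" "x \<ge> 0"
  shows "x \<le> e + e powr (1 - p) * x powr p"
proof (cases "x \<le> e")
  case False
  then have "e powr (p - 1) \<le> x powr (p - 1)" using assms by (intro powr_mono2) auto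
  then have "1 \<le> e powr (1 - p) * x powr (p - 1)"
    using assms(2) powr_add[of e "1 - p" "p - 1"] mult_left_mono[of "e powr (p - 1)" "x powr (p - 1)" "e powr (1 - p)"] by simp
  then have "x * 1 \<le> x * (e powr (1 - p) * x powr (p - 1))" using assms by (intro mult_left_mono) auto
  also have "x * (e powr (1 - p) * x powr (p - 1)) = e powr (1 - p) * x powr p"
    using False assms powr_add[of x 1 "p - 1"] by simp
  finally show ?thesis using assms by simp
qed (use assms in \<open>simp add: add_increasing2\<close>)

text \<open>L^p convergence implies L^1 convergence on a bounded interval: integrate the pointwise
  bound \<open>le_eps_plus_powr\<close>, fix \<open>e\<close> small, then let the integral of the
  p-th power tend to 0.\<close>

lemma integral_norm_tendsto_0:
  fixes f :: "real \<Rightarrow> real \<Rightarrow> 'e::euclidean_space"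
  assumes p: "p \<ge> 1" and ab: "a \<le> b"
    and i1: "\<forall>\<^sub>F s in F. (\<lambda>t. norm (f s t)) integrable_on {a..b}"
    and ip: "\<forall>\<^sub>F s in F. (\<lambda>t. norm (f s t) powr p) integrable_on {a..b}"
    and lim: "((\<lambda>s. integral {a..b} (\<lambda>t. norm (f s t) powr p)) \<longlongrightarrow> 0) F"
  shows "((\<lambda>s. integral {a..b} (\<lambda>t. norm (f s t))) \<longlongrightarrow> 0) F"
proof (rule tendstoI)
  fix d :: real assume d: "d > 0"
  define e where "e = d / (2 * (b - a + 1))"
  have e: "e > 0" "e * (b - a) \<le> d / 2" using d ab by (auto simp: e_def field_simps)
  have "((\<lambda>s. e powr (1 - p) * integral {a..b} (\<lambda>t. norm (f s t) powr p)) \<longlongrightarrow> 0) F"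
    by (rule tendsto_mult_right_zero[OF lim])
  then have "\<forall>\<^sub>F s in F. e powr (1 - p) * integral {a..b} (\<lambda>t. norm (f s t) powr p) < d / 2"
    using d by (intro order_tendstoD) auto
  with i1 ip show "\<forall>\<^sub>F s in F. dist (integral {a..b} (\<lambda>t. norm (f s t))) 0 < d"
  proof eventually_elim
    case (elim s)
    have "integral {a..b} (\<lambda>t. norm (f s t)) \<le> integral {a..b} (\<lambda>t. e + e powr (1 - p) * norm (f s t) powr p)"
      using elim e p
      by (intro Henstock_Kurzweil_Integration.integral_le Henstock_Kurzweil_Integration.integrable_add integrable_on_mult_right
          integrable_const_ivl le_eps_plus_powr) auto
    also have "\<dots> = integral {a..b} (\<lambda>t. e) + integral {a..b} (\<lambda>t. e powr (1 - p) * norm (f s t) powr p)"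
      using elim by (intro Henstock_Kurzweil_Integration.integral_add integrable_on_mult_right integrable_const_ivl) auto
    also have "\<dots> = e * (b - a) + e powr (1 - p) * integral {a..b} (\<lambda>t. norm (f s t) powr p)"
      using ab by simp
    also have "\<dots> < d" using elim e by linarith
    finally have "integral {a..b} (\<lambda>t. norm (f s t)) < d" .
    moreover have "integral {a..b} (\<lambda>t. norm (f s t)) \<ge> 0"
      using elim by (intro Henstock_Kurzweil_Integration.integral_nonneg) auto
    ultimately show ?case by simp
  qed
qed

text \<open>The embedding of W^{1,1} into C^0: norm (r t) is at most norm (r w) plus the integral of
  norm (q), for every \<open>w\<close>; averaging over \<open>w\<close> gives the claim. Multiplying
  by b - a keeps it free of division.\<close>

lemma sobolev_deriv_sup_bound:
  assumes r: "sobolev_deriv p a b r q" and t: "t \<in> {a..b}"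
  shows "(b - a) * norm (r t) \<le> integral {a..b} (\<lambda>t. norm (r t)) + (b - a) * integral {a..b} (\<lambda>t. norm (q t))"
proof -
  let ?Q = "integral {a..b} (\<lambda>t. norm (q t))"
  note qi = sobolev_deriv_integrable[OF r]
  have inc: "norm (r y - r x) \<le> ?Q" if "a \<le> x" "x \<le> y" "y \<le> b" for x y
  proof -
    have sub: "{x..y} \<subseteq> {a..b}" using that by auto
    have "norm (integral {x..y} q) \<le> integral {x..y} (\<lambda>t. norm (q t))"
      by (intro Henstock_Kurzweil_Integration.integral_norm_bound_integral integrable_subinterval_real[OF qi(1) sub]
          integrable_subinterval_real[OF qi(2) sub]) simp
    also have "\<dots> \<le> ?Q"
      by (intro integral_subset_le sub integrable_subinterval_real[OF qi(2) sub] qi(2)) simp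
    finally show ?thesis using sobolev_deriv_increment[OF r that] by simp
  qed
  have pt: "norm (r t) \<le> norm (r w) + ?Q" if "w \<in> {a..b}" for w
  proof (cases "w \<le> t")
    case True
    then show ?thesis using inc[of w t] that t norm_triangle_sub[of "r t" "r w"] by simp
  next
    case False
    then show ?thesis using inc[of t w] that t norm_triangle_sub[of "r t" "r w"] by (simp add: norm_minus_commute)
  qed
  have ri: "(\<lambda>w. norm (r w)) integrable_on {a..b}"
    by (intro integrable_continuous_real continuous_on_norm sobolev_deriv_continuous_on[OF r])
  have "integral {a..b} (\<lambda>w. norm (r t)) \<le> integral {a..b} (\<lambda>w. norm (r w) + ?Q)"
    by (intro Henstock_Kurzweil_Integration.integral_le Henstock_Kurzweil_Integration.integrable_add ri integrable_const_ivl pt)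
  also have "\<dots> = integral {a..b} (\<lambda>w. norm (r w)) + integral {a..b} (\<lambda>w. ?Q)"
    by (intro Henstock_Kurzweil_Integration.integral_add ri integrable_const_ivl)
  finally show ?thesis using t by simp
qed

text \<open>Differentiability at \<open>s = 0\<close> with velocity \<open>x\<close>, in \<open>C\<^sup>0\<close> for \<open>u s\<close> and in \<open>L\<^sup>1\<close> for its weak
  \<open>t\<close>-derivative \<open>g s\<close>: all that the differentials need of \<open>W\<^sup>1\<^sup>,\<^sup>p\<close> convergence, and, unlike
  \<open>sobolev_norm\<close>, visibly inherited by subintervals.\<close>

definition C0_L1_path :: "real \<Rightarrow> real \<Rightarrow> (real \<Rightarrow> real \<Rightarrow> 'e::euclidean_space) \<Rightarrow> (real \<Rightarrow> real \<Rightarrow> 'e) \<Rightarrow>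
    (real \<Rightarrow> 'e) \<Rightarrow> (real \<Rightarrow> 'e) \<Rightarrow> bool" where
  "C0_L1_path a b u g x h \<longleftrightarrow>
     (\<forall>\<^sub>F s in nhds 0. continuous_on {a..b} (u s) \<and> g s absolutely_integrable_on {a..b}) \<and>
     continuous_on {a..b} x \<and> h absolutely_integrable_on {a..b} \<and>
     (\<forall>e>0. \<forall>\<^sub>F s in at 0. \<forall>t\<in>{a..b}. norm ((u s t - u 0 t) /\<^sub>R s - x t) \<le> e) \<and>
     ((\<lambda>s. integral {a..b} (\<lambda>t. norm ((g s t - g 0 t) /\<^sub>R s - h t))) \<longlongrightarrow> 0) (at 0)"

lemma C0_L1_path_diff_integrable:
  fixes g h :: "real \<Rightarrow> 'e::euclidean_space"
  assumes "k absolutely_integrable_on S" "g absolutely_integrable_on S" "h absolutely_integrable_on S"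
  shows "(\<lambda>t. (k t - g t) /\<^sub>R s - h t) absolutely_integrable_on S"
  by (rule set_integral_diff(1)[OF absolutely_integrable_scaleR_left[OF set_integral_diff(1)[OF assms(1,2)]] assms(3)])

lemma C0_L1_path_subinterval:
  assumes P: "C0_L1_path a b u g x h" and cd: "a \<le> c" "d \<le> b"
  shows "C0_L1_path c d u g x h"
proof -
  have sub: "{c..d} \<subseteq> {a..b}" using cd by auto
  have ev: "\<forall>\<^sub>F s in nhds 0. continuous_on {a..b} (u s) \<and> g s absolutely_integrable_on {a..b}"
    and x: "continuous_on {a..b} x" and h: "h absolutely_integrable_on {a..b}"
    and C0: "\<forall>e>0. \<forall>\<^sub>F s in at 0. \<forall>t\<in>{a..b}. norm ((u s t - u 0 t) /\<^sub>R s - x t) \<le> e"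
    and L1: "((\<lambda>s. integral {a..b} (\<lambda>t. norm ((g s t - g 0 t) /\<^sub>R s - h t))) \<longlongrightarrow> 0) (at 0)"
    using P unfolding C0_L1_path_def by blast+
  have g0: "g 0 absolutely_integrable_on {a..b}" using eventually_nhds_x_imp_x[OF ev] by blast
  have ev': "\<forall>\<^sub>F s in at 0. continuous_on {a..b} (u s) \<and> g s absolutely_integrable_on {a..b}"
    using ev unfolding eventually_nhds_conv_at by blast
  show ?thesis
    unfolding C0_L1_path_def
  proof (intro conjI allI impI)
    show "\<forall>\<^sub>F s in nhds 0. continuous_on {c..d} (u s) \<and> g s absolutely_integrable_on {c..d}"
      using ev by eventually_elim (use sub continuous_on_subset absolutely_integrable_on_subinterval in blast)
    show "continuous_on {c..d} x" using x sub continuous_on_subset by blast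
    show "h absolutely_integrable_on {c..d}" using h sub absolutely_integrable_on_subinterval by blast
    show "\<forall>\<^sub>F s in at 0. \<forall>t\<in>{c..d}. norm ((u s t - u 0 t) /\<^sub>R s - x t) \<le> e" if "e > 0" for e
      using C0[rule_format, OF that] by eventually_elim (use sub in blast)
    show "((\<lambda>s. integral {c..d} (\<lambda>t. norm ((g s t - g 0 t) /\<^sub>R s - h t))) \<longlongrightarrow> 0) (at 0)"
    proof (rule Lim_null_comparison[OF _ L1])
      show "\<forall>\<^sub>F s in at 0. norm (integral {c..d} (\<lambda>t. norm ((g s t - g 0 t) /\<^sub>R s - h t)))
          \<le> integral {a..b} (\<lambda>t. norm ((g s t - g 0 t) /\<^sub>R s - h t))"
        using ev'
      proof eventually_elim
        case (elim s)
        have i: "(\<lambda>t. norm ((g s t - g 0 t) /\<^sub>R s - h t)) integrable_on {a..b}"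
          using C0_L1_path_diff_integrable[OF _ g0 h] elim unfolding absolutely_integrable_on_def by blast
        have i': "(\<lambda>t. norm ((g s t - g 0 t) /\<^sub>R s - h t)) integrable_on {c..d}"
          by (rule integrable_subinterval_real[OF i sub])
        have "integral {c..d} (\<lambda>t. norm ((g s t - g 0 t) /\<^sub>R s - h t)) \<ge> 0"
          by (intro Henstock_Kurzweil_Integration.integral_nonneg i') simp
        moreover have "integral {c..d} (\<lambda>t. norm ((g s t - g 0 t) /\<^sub>R s - h t))
            \<le> integral {a..b} (\<lambda>t. norm ((g s t - g 0 t) /\<^sub>R s - h t))"
          by (intro integral_subset_le sub i i') simp
        ultimately show ?case by simp
      qed
    qed
  qed
qed

text \<open>The p-th power of the Sobolev norm of the remainder \<open>r\<close> is a sum of two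
  nonnegative integrals, so both tend to 0. Each L^p convergence gives L^1 convergence, and the two
  together give uniform convergence of \<open>r\<close> by the embedding bound.\<close>

lemma C0_L1_pathI:
  fixes u g :: "real \<Rightarrow> real \<Rightarrow> 'e::euclidean_space"
  assumes p: "p \<ge> 1" and ab: "a < b"
    and u: "\<forall>\<^sub>F s in nhds 0. sobolev_deriv p a b (u s) (g s)" and x: "sobolev_deriv p a b x h"
    and lim: "((\<lambda>s. sobolev_norm p a b (\<lambda>t. (u s t - u 0 t) /\<^sub>R s - x t)) \<longlongrightarrow> 0) (at 0)"
  shows "C0_L1_path a b u g x h"
proof -
  have u0: "sobolev_deriv p a b (u 0) (g 0)" using eventually_nhds_x_imp_x[OF u] .
  have u': "\<forall>\<^sub>F s in at 0. sobolev_deriv p a b (u s) (g s)"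
    using u unfolding eventually_nhds_conv_at by blast
  define r where "r s t = (u s t - u 0 t) /\<^sub>R s - x t" for s t
  define q where "q s t = (g s t - g 0 t) /\<^sub>R s - h t" for s t
  have rq: "\<forall>\<^sub>F s in at 0. sobolev_deriv p a b (r s) (q s)"
    using u'
  proof eventually_elim
    case (elim s)
    have "sobolev_deriv p a b (\<lambda>t. (inverse s *\<^sub>R u s t + (- inverse s) *\<^sub>R u 0 t) + (-1) *\<^sub>R x t)
        (\<lambda>t. (inverse s *\<^sub>R g s t + (- inverse s) *\<^sub>R g 0 t) + (-1) *\<^sub>R h t)"
      by (intro sobolev_deriv_add[OF p] sobolev_deriv_scaleR_const[OF p] elim u0 x)
    then show ?case by (simp add: r_def[abs_def] q_def[abs_def] scaleR_diff_right)
  qed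
  define I where "I s = integral {a..b} (\<lambda>t. norm (r s t) powr p + norm (vector_derivative (r s) (at t)) powr p)" for s
  have I: "\<forall>\<^sub>F s in at 0. integral {a..b} (\<lambda>t. norm (r s t) powr p) \<ge> 0 \<and> integral {a..b} (\<lambda>t. norm (q s t) powr p) \<ge> 0 \<and>
      I s = integral {a..b} (\<lambda>t. norm (r s t) powr p) + integral {a..b} (\<lambda>t. norm (q s t) powr p)"
    using rq
  proof eventually_elim
    case (elim s)
    have ri: "(\<lambda>t. norm (r s t) powr p) integrable_on {a..b}"
      using p by (intro integrable_continuous_real continuous_on_powr' continuous_intros sobolev_deriv_continuous_on[OF elim]) auto
    have qi: "(\<lambda>t. norm (q s t) powr p) integrable_on {a..b}" by (rule sobolev_deriv_powr_integrable[OF elim])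
    obtain N where N: "negligible N" "\<forall>t\<in>{a..b} - N. (r s has_vector_derivative q s t) (at t)"
      using elim unfolding sobolev_deriv_def by blast
    have "I s = integral {a..b} (\<lambda>t. norm (r s t) powr p + norm (q s t) powr p)"
      unfolding I_def
    proof (rule integral_spike[OF N(1)])
      fix t assume "t \<in> {a..b} - N"
      then have "vector_derivative (r s) (at t) = q s t" using N(2) vector_derivative_at by blast
      then show "norm (r s t) powr p + norm (q s t) powr p = norm (r s t) powr p + norm (vector_derivative (r s) (at t)) powr p"
        by simp
    qed
    also have "\<dots> = integral {a..b} (\<lambda>t. norm (r s t) powr p) + integral {a..b} (\<lambda>t. norm (q s t) powr p)"
      by (rule Henstock_Kurzweil_Integration.integral_add[OF ri qi])
    finally show ?case
      by (auto intro!: Henstock_Kurzweil_Integration.integral_nonneg ri qi)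
  qed
  \<comment> \<open>\<open>sobolev_norm\<close> is the p-th root of \<open>I s\<close>; raising it
    to the power \<open>p\<close> recovers \<open>I s\<close>, which is nonnegative.\<close>
  have "((\<lambda>s. sobolev_norm p a b (r s) powr p) \<longlongrightarrow> 0 powr p) (at 0)"
    using p lim unfolding r_def[abs_def] by (intro tendsto_powr') (auto simp: sobolev_norm_def)
  moreover have "\<forall>\<^sub>F s in at 0. sobolev_norm p a b (r s) powr p = I s"
    using I
  proof eventually_elim
    case (elim s)
    then have "I s \<ge> 0" by linarith
    then show ?case using p unfolding sobolev_norm_def I_def[symmetric] by (simp add: powr_powr)
  qed
  ultimately have I0: "(I \<longlongrightarrow> 0) (at 0)"
    using p by (simp add: tendsto_cong)
  have "((\<lambda>s. integral {a..b} (\<lambda>t. norm (r s t) powr p)) \<longlongrightarrow> 0) (at 0)"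
    by (rule Lim_null_comparison[OF _ I0]) (use I in \<open>eventually_elim, simp\<close>)
  then have r1: "((\<lambda>s. integral {a..b} (\<lambda>t. norm (r s t))) \<longlongrightarrow> 0) (at 0)"
  proof (rule integral_norm_tendsto_0[OF p less_imp_le[OF ab], rotated 2])
    show "\<forall>\<^sub>F s in at 0. (\<lambda>t. norm (r s t)) integrable_on {a..b}"
      using rq by eventually_elim (intro integrable_continuous_real continuous_intros sobolev_deriv_continuous_on)
    show "\<forall>\<^sub>F s in at 0. (\<lambda>t. norm (r s t) powr p) integrable_on {a..b}"
      using rq
    proof eventually_elim
      case (elim s)
      then show ?case
        using p by (intro integrable_continuous_real continuous_on_powr' continuous_intros sobolev_deriv_continuous_on[OF elim]) auto
    qed
  qed
  have "((\<lambda>s. integral {a..b} (\<lambda>t. norm (q s t) powr p)) \<longlongrightarrow> 0) (at 0)"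
    by (rule Lim_null_comparison[OF _ I0]) (use I in \<open>eventually_elim, simp\<close>)
  then have q1: "((\<lambda>s. integral {a..b} (\<lambda>t. norm (q s t))) \<longlongrightarrow> 0) (at 0)"
  proof (rule integral_norm_tendsto_0[OF p less_imp_le[OF ab], rotated 2])
    show "\<forall>\<^sub>F s in at 0. (\<lambda>t. norm (q s t)) integrable_on {a..b}"
      using rq by eventually_elim (rule sobolev_deriv_integrable(2))
    show "\<forall>\<^sub>F s in at 0. (\<lambda>t. norm (q s t) powr p) integrable_on {a..b}"
      using rq by eventually_elim (rule sobolev_deriv_powr_integrable)
  qed
  have sup: "\<forall>\<^sub>F s in at 0. \<forall>t\<in>{a..b}. norm (r s t) \<le> e" if e: "e > 0" for e
  proof -
    have "((\<lambda>s. integral {a..b} (\<lambda>t. norm (r s t)) + (b - a) * integral {a..b} (\<lambda>t. norm (q s t))) \<longlongrightarrow> 0 + (b - a) * 0) (at 0)"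
      by (intro tendsto_intros r1 q1)
    then have "\<forall>\<^sub>F s in at 0. integral {a..b} (\<lambda>t. norm (r s t)) + (b - a) * integral {a..b} (\<lambda>t. norm (q s t)) < (b - a) * e"
      using e ab by (intro order_tendstoD) auto
    with rq show ?thesis
    proof eventually_elim
      case (elim s)
      show ?case
      proof
        fix t assume "t \<in> {a..b}"
        then have "(b - a) * norm (r s t) \<le> (b - a) * e"
          using sobolev_deriv_sup_bound[OF elim(1)] elim(2) by fastforce
        then show "norm (r s t) \<le> e" using ab by simp
      qed
    qed
  qed
  show ?thesis
    unfolding C0_L1_path_def
  proof (intro conjI allI impI)
    show "\<forall>\<^sub>F s in nhds 0. continuous_on {a..b} (u s) \<and> g s absolutely_integrable_on {a..b}"
      using u by eventually_elim (use sobolev_deriv_continuous_on in \<open>unfold sobolev_deriv_def, blast\<close>)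
    show "continuous_on {a..b} x" by (rule sobolev_deriv_continuous_on[OF x])
    show "h absolutely_integrable_on {a..b}" using x unfolding sobolev_deriv_def by blast
    show "\<forall>\<^sub>F s in at 0. \<forall>t\<in>{a..b}. norm ((u s t - u 0 t) /\<^sub>R s - x t) \<le> e" if "e > 0" for e
      using sup[OF that] unfolding r_def .
    show "((\<lambda>s. integral {a..b} (\<lambda>t. norm ((g s t - g 0 t) /\<^sub>R s - h t))) \<longlongrightarrow> 0) (at 0)"
      using q1 unfolding q_def .
  qed
qed

text \<open>Taylor's estimate is uniform over the compact image of \<open>u 0\<close>, and u s t - u
  0 t = s (x t + r) with \<open>r\<close> uniformly small, so the chain rule at s = 0 holds
  uniformly in \<open>t\<close>.\<close>

lemma C1_on_path_difference_quotient:
  fixes \<phi> :: "'e::euclidean_space \<Rightarrow> 'f::real_normed_vector"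
  assumes P: "C0_L1_path a b u g x h" and S: "open S" "u 0 ` {a..b} \<subseteq> S" and C1: "C1_on S \<phi> \<phi>'" and e: "e > 0"
  shows "\<forall>\<^sub>F s in at 0. \<forall>t\<in>{a..b}. u s t \<in> S \<and>
    norm ((\<phi> (u s t) - \<phi> (u 0 t)) /\<^sub>R s - \<phi>' (u 0 t) (x t)) \<le> e"
proof -
  have ev: "\<forall>\<^sub>F s in nhds 0. continuous_on {a..b} (u s) \<and> g s absolutely_integrable_on {a..b}"
    and x: "continuous_on {a..b} x"
    and C0: "\<forall>e>0. \<forall>\<^sub>F s in at 0. \<forall>t\<in>{a..b}. norm ((u s t - u 0 t) /\<^sub>R s - x t) \<le> e"
    using P unfolding C0_L1_path_def by blast+
  have u0: "continuous_on {a..b} (u 0)" using eventually_nhds_x_imp_x[OF ev] by blast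
  have "bounded (x ` {a..b})" by (intro compact_imp_bounded compact_continuous_image x) auto
  then obtain B where B: "B > 0" "\<And>t. t \<in> {a..b} \<Longrightarrow> norm (x t) \<le> B" by (auto simp: bounded_pos)
  let ?F = "\<lambda>t. Blinfun (\<phi>' (u 0 t))"
  have "continuous_on {a..b} ?F"
    by (rule continuous_on_compose2[OF C1_on_blinfun(2)[OF C1] u0 S(2)])
  then have "bounded (?F ` {a..b})" by (intro compact_imp_bounded compact_continuous_image) auto
  then obtain C where C: "C > 0" "\<And>t. t \<in> {a..b} \<Longrightarrow> norm (?F t) \<le> C" by (auto simp: bounded_pos)
  have Cb: "norm (\<phi>' (u 0 t) v) \<le> C * norm v" if t: "t \<in> {a..b}" for t v
  proof -
    have "norm (blinfun_apply (?F t) v) \<le> norm (?F t) * norm v" by (rule norm_blinfun)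
    also have "\<dots> \<le> C * norm v" by (intro mult_right_mono C(2) t) simp
    finally show ?thesis using C1_on_blinfun(1)[OF C1] S(2) t by (metis image_subset_iff)
  qed
  \<comment> \<open>\<open>e1\<close> is for the Taylor error, since the displacement is at most |s|
    (B + 1); \<open>e2\<close> is for the image of \<open>r\<close> under the derivative, whose norm
    is at most \<open>C\<close>. The cap e2 \<le> 1 is what gives norm (x t + r) \<le> B +
    1.\<close>
  define e1 where "e1 = e / (2 * (B + 1))"
  define e2 where "e2 = min 1 (e / (2 * C))"
  have e1: "e1 > 0" "e1 * (B + 1) \<le> e / 2" using e B(1) by (auto simp: e1_def field_simps)
  have e2: "e2 > 0" "e2 \<le> 1" "C * e2 \<le> e / 2" using e C(1) by (auto simp: e2_def min_def field_simps)
  obtain d where d: "d > 0" "\<And>y z. y \<in> u 0 ` {a..b} \<Longrightarrow> dist z y < d \<Longrightarrow>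
      z \<in> S \<and> norm (\<phi> z - \<phi> y - \<phi>' y (z - y)) \<le> e1 * norm (z - y)"
    by (rule C1_on_uniform_derivative[OF C1 S(1) compact_continuous_image[OF u0 compact_Icc] S(2) e1(1)]) blast
  have "\<forall>\<^sub>F s in at 0. s \<noteq> 0 \<and> \<bar>s\<bar> < d / (B + 1)"
    unfolding eventually_at using d(1) B(1) by (intro exI[of _ "d / (B + 1)"]) (auto simp: dist_real_def)
  then show ?thesis
    using C0[rule_format, OF e2(1)]
  proof eventually_elim
    case (elim s)
    show ?case
    proof
      fix t assume t: "t \<in> {a..b}"
      define r where "r = (u s t - u 0 t) /\<^sub>R s - x t"
      have r: "norm r \<le> e2" using elim t by (simp add: r_def)
      have us: "u s t - u 0 t = s *\<^sub>R (x t + r)" using elim by (simp add: r_def)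
      have xr: "norm (x t + r) \<le> B + 1" using norm_triangle_ineq[of "x t" r] B(2)[OF t] r e2 by linarith
      have n: "norm (u s t - u 0 t) \<le> \<bar>s\<bar> * (B + 1)" unfolding us using xr by (simp add: mult_left_mono)
      also have "\<dots> < d" using elim B(1) by (simp add: field_simps)
      finally have "dist (u s t) (u 0 t) < d" by (simp add: dist_norm)
      then have in_S: "u s t \<in> S" and err: "norm (\<phi> (u s t) - \<phi> (u 0 t) - \<phi>' (u 0 t) (u s t - u 0 t)) \<le> e1 * norm (u s t - u 0 t)"
        using d(2)[of "u 0 t" "u s t"] t by auto
      have lin: "linear (\<phi>' (u 0 t))" using C1_on_linear[OF C1] S(2) t by blast
      have "(\<phi> (u s t) - \<phi> (u 0 t)) /\<^sub>R s - \<phi>' (u 0 t) (x t) =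
          (\<phi> (u s t) - \<phi> (u 0 t) - \<phi>' (u 0 t) (u s t - u 0 t)) /\<^sub>R s + \<phi>' (u 0 t) r"
        using elim unfolding us by (simp add: linear_scale[OF lin] linear_add[OF lin] algebra_simps)
      moreover have "norm ((\<phi> (u s t) - \<phi> (u 0 t) - \<phi>' (u 0 t) (u s t - u 0 t)) /\<^sub>R s) \<le> e / 2"
      proof -
        have "norm (\<phi> (u s t) - \<phi> (u 0 t) - \<phi>' (u 0 t) (u s t - u 0 t)) \<le> e1 * (\<bar>s\<bar> * (B + 1))"
          using err n e1(1) by (meson less_imp_le mult_left_mono order_trans)
        also have "\<dots> = \<bar>s\<bar> * (e1 * (B + 1))" by simp
        also have "\<dots> \<le> \<bar>s\<bar> * (e / 2)" using e1(2) by (intro mult_left_mono) auto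
        finally have *: "norm (\<phi> (u s t) - \<phi> (u 0 t) - \<phi>' (u 0 t) (u s t - u 0 t)) \<le> \<bar>s\<bar> * (e / 2)" .
        have s: "\<bar>s\<bar> > 0" using elim by simp
        have "norm ((\<phi> (u s t) - \<phi> (u 0 t) - \<phi>' (u 0 t) (u s t - u 0 t)) /\<^sub>R s) =
            norm (\<phi> (u s t) - \<phi> (u 0 t) - \<phi>' (u 0 t) (u s t - u 0 t)) / \<bar>s\<bar>"
          by (simp only: norm_scaleR real_norm_def abs_inverse divide_inverse mult.commute)
        also have "\<dots> \<le> e / 2"
          unfolding pos_divide_le_eq[OF s] using * by (simp only: mult.commute)
        finally show ?thesis .
      qed
      moreover have "norm (\<phi>' (u 0 t) r) \<le> e / 2"
        using Cb[OF t, of r] mult_left_mono[OF r, of C] C(1) e2(3) by linarith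
      ultimately show "u s t \<in> S \<and> norm ((\<phi> (u s t) - \<phi> (u 0 t)) /\<^sub>R s - \<phi>' (u 0 t) (x t)) \<le> e"
        using in_S norm_triangle_ineq[of "(\<phi> (u s t) - \<phi> (u 0 t) - \<phi>' (u 0 t) (u s t - u 0 t)) /\<^sub>R s" "\<phi>' (u 0 t) r"]
        by simp
    qed
  qed
qed

text \<open>The membership half of \<open>C1_on_path_difference_quotient\<close>, read off with the
  arbitrary error bound 1, and with s = 0 added.\<close>

lemma C0_L1_path_eventually_in:
  fixes \<phi> :: "'e::euclidean_space \<Rightarrow> 'f::real_normed_vector"
  assumes P: "C0_L1_path a b u g x h" and S: "open S" "u 0 ` {a..b} \<subseteq> S" and C1: "C1_on S \<phi> \<phi>'"
  shows "\<forall>\<^sub>F s in nhds 0. u s ` {a..b} \<subseteq> S"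
proof -
  have "\<forall>\<^sub>F s in at 0. u s ` {a..b} \<subseteq> S"
    using C1_on_path_difference_quotient[OF P S C1 zero_less_one]
    by eventually_elim (simp add: image_subset_iff)
  with S(2) show ?thesis unfolding eventually_nhds_conv_at by (intro conjI)
qed

text \<open>Differentiation under the integral sign when the difference quotients converge in L^1.
  Smallness is expressed by an integrable majorant \<open>k\<close>, which may depend on
  \<open>s\<close>; such majorants are what the applications supply.\<close>

lemma has_real_derivative_integral_L1:
  fixes F :: "real \<Rightarrow> real \<Rightarrow> real"
  assumes F: "\<forall>\<^sub>F s in nhds 0. F s integrable_on {a..b}" and D: "D integrable_on {a..b}"
    and bound: "\<And>e. e > 0 \<Longrightarrow> \<forall>\<^sub>F s in at 0. \<exists>k. k integrable_on {a..b} \<and>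
      (\<forall>t\<in>{a..b}. \<bar>(F s t - F 0 t) / s - D t\<bar> \<le> k t) \<and> integral {a..b} k \<le> e"
  shows "((\<lambda>s. integral {a..b} (F s)) has_real_derivative integral {a..b} D) (at 0)"
  unfolding DERIV_def
proof (rule LIM_zero_cancel, rule tendstoI)
  fix e :: real assume "e > 0"
  have F0: "F 0 integrable_on {a..b}" using eventually_nhds_x_imp_x[OF F] .
  have F': "\<forall>\<^sub>F s in at 0. F s integrable_on {a..b}" using F unfolding eventually_nhds_conv_at by blast
  have "\<forall>\<^sub>F s in at 0. \<exists>k. k integrable_on {a..b} \<and>
      (\<forall>t\<in>{a..b}. \<bar>(F s t - F 0 t) / s - D t\<bar> \<le> k t) \<and> integral {a..b} k \<le> e / 2"
    using bound[of "e / 2"] \<open>e > 0\<close> by (simp only: half_gt_zero)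
  with F' show "\<forall>\<^sub>F h in at 0. dist ((integral {a..b} (F (0 + h)) - integral {a..b} (F 0)) / h - integral {a..b} D) 0 < e"
  proof eventually_elim
    case (elim s)
    then obtain k where k: "k integrable_on {a..b}" "\<And>t. t \<in> {a..b} \<Longrightarrow> \<bar>(F s t - F 0 t) / s - D t\<bar> \<le> k t"
      "integral {a..b} k \<le> e / 2" by blast
    have i: "(\<lambda>t. (F s t - F 0 t) / s) integrable_on {a..b}"
      using integrable_on_mult_left[OF Henstock_Kurzweil_Integration.integrable_diff[OF elim(1) F0], of "inverse s"]
      by (simp add: divide_inverse)
    have "(integral {a..b} (F s) - integral {a..b} (F 0)) / s = integral {a..b} (\<lambda>t. (F s t - F 0 t) / s)"
      by (simp add: Henstock_Kurzweil_Integration.integral_diff[OF elim(1) F0])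
    then have "(integral {a..b} (F s) - integral {a..b} (F 0)) / s - integral {a..b} D
        = integral {a..b} (\<lambda>t. (F s t - F 0 t) / s - D t)"
      by (simp add: Henstock_Kurzweil_Integration.integral_diff[OF i D])
    also have "norm \<dots> \<le> integral {a..b} k"
      by (rule Henstock_Kurzweil_Integration.integral_norm_bound_integral[OF Henstock_Kurzweil_Integration.integrable_diff[OF i D] k(1)])
        (simp add: k(2))
    finally show ?case using k(3) \<open>e > 0\<close> by simp
  qed
qed

lemma C0_L1_path_integral_derivative:
  fixes \<phi> :: "'e::euclidean_space \<Rightarrow> real"
  assumes P: "C0_L1_path a b u g x h" and S: "open S" "u 0 ` {a..b} \<subseteq> S" and C1: "C1_on S \<phi> \<phi>'" and ab: "a \<le> b"
  shows "((\<lambda>s. integral {a..b} (\<lambda>t. \<phi> (u s t))) has_real_derivative integral {a..b} (\<lambda>t. \<phi>' (u 0 t) (x t))) (at 0)"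
    and "\<forall>\<^sub>F s in nhds 0. (\<lambda>t. \<phi> (u s t)) integrable_on {a..b}"
    and "(\<lambda>t. \<phi>' (u 0 t) (x t)) integrable_on {a..b}"
proof -
  have ev: "\<forall>\<^sub>F s in nhds 0. continuous_on {a..b} (u s) \<and> g s absolutely_integrable_on {a..b}"
    and x: "continuous_on {a..b} x" using P unfolding C0_L1_path_def by blast+
  have u0: "continuous_on {a..b} (u 0)" using eventually_nhds_x_imp_x[OF ev] by blast
  have inS: "\<forall>\<^sub>F s in nhds 0. u s ` {a..b} \<subseteq> S"
    by (rule C0_L1_path_eventually_in[OF P S C1])
  show i: "\<forall>\<^sub>F s in nhds 0. (\<lambda>t. \<phi> (u s t)) integrable_on {a..b}"
    using ev inS
  proof eventually_elim
    case (elim s)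
    show ?case
      by (rule integrable_continuous_real[OF continuous_on_compose2[OF C1_on_imp_continuous_on[OF C1] conjunct1[OF elim(1)] elim(2)]])
  qed
  show D: "(\<lambda>t. \<phi>' (u 0 t) (x t)) integrable_on {a..b}"
    by (intro integrable_continuous_real C1_on_continuous_derivative[OF C1 u0 x S(2)])
  show "((\<lambda>s. integral {a..b} (\<lambda>t. \<phi> (u s t))) has_real_derivative integral {a..b} (\<lambda>t. \<phi>' (u 0 t) (x t))) (at 0)"
  proof (rule has_real_derivative_integral_L1[OF i D])
    fix e :: real assume e: "e > 0"
    \<comment> \<open>The error is at most \<open>e'\<close> uniformly in \<open>t\<close>, so the
      constant \<open>e'\<close> is the majorant; the summand 1 covers the case a = b.\<close>
    define e' where "e' = e / (b - a + 1)"
    have e': "e' > 0" "e' * (b - a) \<le> e" using e ab by (auto simp: e'_def field_simps)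
    show "\<forall>\<^sub>F s in at 0. \<exists>k. k integrable_on {a..b} \<and>
      (\<forall>t\<in>{a..b}. \<bar>(\<phi> (u s t) - \<phi> (u 0 t)) / s - \<phi>' (u 0 t) (x t)\<bar> \<le> k t) \<and> integral {a..b} k \<le> e"
      using C1_on_path_difference_quotient[OF P S C1 e'(1)]
      by eventually_elim
        (use e' ab in \<open>auto intro!: exI[of _ "\<lambda>_. e'"] integrable_const_ivl simp: divide_inverse mult.commute\<close>)
  qed
qed

lemma integrable_inner_continuous:
  fixes f g :: "real \<Rightarrow> 'e::euclidean_space"
  assumes "continuous_on {a..b} f" "g absolutely_integrable_on {a..b}"
  shows "(\<lambda>t. f t \<bullet> g t) integrable_on {a..b}"
proof -
  have bil: "bilinear (\<lambda>(x::'e) y. x \<bullet> y)"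
    using bilinear_conv_bounded_bilinear bounded_bilinear_inner by blast
  have "(\<lambda>t. f t \<bullet> g t) absolutely_integrable_on {a..b}"
    by (rule absolutely_integrable_bounded_measurable_product[OF bil _ _ _ assms(2)])
      (auto intro!: continuous_imp_measurable_on_sets_lebesgue assms(1) compact_imp_bounded compact_continuous_image)
  then show ?thesis by (simp add: absolutely_integrable_on_def)
qed

text \<open>A product rule in which one factor converges uniformly and the other only in L^1. The
  error is the sum of w \<bullet> g 0, of (\<phi> (u s) - \<phi> (u 0)) \<bullet> (h + q) and of
  \<phi> (u 0) \<bullet> q, where \<open>w\<close> is uniformly small and \<open>q\<close> is small
  in L^1.\<close>

lemma C0_L1_path_action_derivative:
  fixes \<phi> :: "'e::euclidean_space \<Rightarrow> 'e"
  assumes P: "C0_L1_path a b u g x h" and S: "open S" "u 0 ` {a..b} \<subseteq> S" and C1: "C1_on S \<phi> \<phi>'" and ab: "a \<le> b"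
  shows "((\<lambda>s. integral {a..b} (\<lambda>t. \<phi> (u s t) \<bullet> g s t)) has_real_derivative
      integral {a..b} (\<lambda>t. \<phi>' (u 0 t) (x t) \<bullet> g 0 t + \<phi> (u 0 t) \<bullet> h t)) (at 0)"
    and "\<forall>\<^sub>F s in nhds 0. (\<lambda>t. \<phi> (u s t) \<bullet> g s t) integrable_on {a..b}"
proof -
  have ev: "\<forall>\<^sub>F s in nhds 0. continuous_on {a..b} (u s) \<and> g s absolutely_integrable_on {a..b}"
    and x: "continuous_on {a..b} x" and h: "h absolutely_integrable_on {a..b}"
    and L1: "((\<lambda>s. integral {a..b} (\<lambda>t. norm ((g s t - g 0 t) /\<^sub>R s - h t))) \<longlongrightarrow> 0) (at 0)"
    using P unfolding C0_L1_path_def by blast+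
  have u0: "continuous_on {a..b} (u 0)" and g0: "g 0 absolutely_integrable_on {a..b}"
    using eventually_nhds_x_imp_x[OF ev] by blast+
  have ev': "\<forall>\<^sub>F s in at 0. continuous_on {a..b} (u s) \<and> g s absolutely_integrable_on {a..b}"
    using ev unfolding eventually_nhds_conv_at by blast
  note c\<phi> = C1_on_imp_continuous_on[OF C1]
  have inS: "\<forall>\<^sub>F s in nhds 0. u s ` {a..b} \<subseteq> S"
    by (rule C0_L1_path_eventually_in[OF P S C1])
  show i: "\<forall>\<^sub>F s in nhds 0. (\<lambda>t. \<phi> (u s t) \<bullet> g s t) integrable_on {a..b}"
    using ev inS
  proof eventually_elim
    case (elim s)
    show ?case
      by (rule integrable_inner_continuous[OF continuous_on_compose2[OF c\<phi> conjunct1[OF elim(1)] elim(2)] conjunct2[OF elim(1)]])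
  qed
  have c0: "continuous_on {a..b} (\<lambda>t. \<phi> (u 0 t))" by (rule continuous_on_compose2[OF c\<phi> u0 S(2)])
  have c1: "continuous_on {a..b} (\<lambda>t. \<phi>' (u 0 t) (x t))" by (rule C1_on_continuous_derivative[OF C1 u0 x S(2)])
  have D: "(\<lambda>t. \<phi>' (u 0 t) (x t) \<bullet> g 0 t + \<phi> (u 0 t) \<bullet> h t) integrable_on {a..b}"
    by (intro Henstock_Kurzweil_Integration.integrable_add integrable_inner_continuous c0 c1 g0 h)
  have "bounded ((\<lambda>t. \<phi> (u 0 t)) ` {a..b})" by (intro compact_imp_bounded compact_continuous_image c0) auto
  then obtain M where M: "M > 0" "\<And>t. t \<in> {a..b} \<Longrightarrow> norm (\<phi> (u 0 t)) \<le> M" by (auto simp: bounded_pos)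
  have "bounded ((\<lambda>t. \<phi>' (u 0 t) (x t)) ` {a..b})" by (intro compact_imp_bounded compact_continuous_image c1) auto
  then obtain B where B: "B > 0" "\<And>t. t \<in> {a..b} \<Longrightarrow> norm (\<phi>' (u 0 t) (x t)) \<le> B" by (auto simp: bounded_pos)
  have gn: "(\<lambda>t. norm (g 0 t)) integrable_on {a..b}" "(\<lambda>t. norm (h t)) integrable_on {a..b}"
    using g0 h unfolding absolutely_integrable_on_def by blast+
  define G where "G = integral {a..b} (\<lambda>t. norm (g 0 t))"
  define Hh where "Hh = integral {a..b} (\<lambda>t. norm (h t))"
  have GH: "G \<ge> 0" "Hh \<ge> 0" unfolding G_def Hh_def by (intro Henstock_Kurzweil_Integration.integral_nonneg gn; simp)+
  show "((\<lambda>s. integral {a..b} (\<lambda>t. \<phi> (u s t) \<bullet> g s t)) has_real_derivative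
      integral {a..b} (\<lambda>t. \<phi>' (u 0 t) (x t) \<bullet> g 0 t + \<phi> (u 0 t) \<bullet> h t)) (at 0)"
  proof (rule has_real_derivative_integral_L1[OF i D])
    fix e :: real assume e: "e > 0"
    \<comment> \<open>\<open>e1\<close> bounds \<open>w\<close> and meets the integral
      \<open>G\<close>; \<open>e2\<close> bounds \<phi> (u s) - \<phi> (u 0), which holds for |s| <
      e2 / (e1 + B), and meets the integral \<open>Hh\<close>. The cap e2 \<le> 1 lets its product
      with \<open>q\<close> merge into the factor M + 1. Each part receives e / 3.\<close>
    define e1 where "e1 = e / (3 * (G + 1))"
    define e2 where "e2 = min 1 (e / (3 * (Hh + 1)))"
    have e1: "e1 > 0" "e1 * G \<le> e / 3" using e GH by (auto simp: e1_def field_simps)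
    have e2: "e2 > 0" "e2 \<le> 1" using e GH by (auto simp: e2_def)
    have "e2 * Hh \<le> e / (3 * (Hh + 1)) * Hh" using GH by (intro mult_right_mono) (auto simp: e2_def)
    also have "\<dots> \<le> e / 3" using GH e by (simp add: field_simps)
    finally have e2': "e2 * Hh \<le> e / 3" .
    have "((\<lambda>s. (M + 1) * integral {a..b} (\<lambda>t. norm ((g s t - g 0 t) /\<^sub>R s - h t))) \<longlongrightarrow> 0) (at 0)"
      by (rule tendsto_mult_right_zero[OF L1])
    then have small: "\<forall>\<^sub>F s in at 0. (M + 1) * integral {a..b} (\<lambda>t. norm ((g s t - g 0 t) /\<^sub>R s - h t)) < e / 3"
      using e by (intro order_tendstoD) auto
    have "\<forall>\<^sub>F s in at 0. s \<noteq> 0 \<and> \<bar>s\<bar> < e2 / (e1 + B)"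
      unfolding eventually_at using e1(1) e2(1) B(1) by (intro exI[of _ "e2 / (e1 + B)"]) (auto simp: dist_real_def)
    with ev' small C1_on_path_difference_quotient[OF P S C1 e1(1)]
    show "\<forall>\<^sub>F s in at 0. \<exists>k. k integrable_on {a..b} \<and>
      (\<forall>t\<in>{a..b}. \<bar>(\<phi> (u s t) \<bullet> g s t - \<phi> (u 0 t) \<bullet> g 0 t) / s - (\<phi>' (u 0 t) (x t) \<bullet> g 0 t + \<phi> (u 0 t) \<bullet> h t)\<bar> \<le> k t) \<and>
      integral {a..b} k \<le> e"
    proof eventually_elim
      case (elim s)
      define q where "q t = (g s t - g 0 t) /\<^sub>R s - h t" for t
      have qn: "(\<lambda>t. norm (q t)) integrable_on {a..b}"
        using C0_L1_path_diff_integrable[OF _ g0 h] elim(1) unfolding absolutely_integrable_on_def q_def by blast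
      let ?k = "\<lambda>t. (e1 * norm (g 0 t) + e2 * norm (h t)) + (M + 1) * norm (q t)"
      have "?k integrable_on {a..b}"
        by (intro Henstock_Kurzweil_Integration.integrable_add integrable_on_mult_right gn qn)
      moreover have "integral {a..b} ?k = (e1 * G + e2 * Hh) + (M + 1) * integral {a..b} (\<lambda>t. norm (q t))"
        unfolding G_def Hh_def
        by (simp add: Henstock_Kurzweil_Integration.integral_add Henstock_Kurzweil_Integration.integrable_add integrable_on_mult_right gn qn)
      moreover have "\<dots> \<le> e" using e1(2) e2' elim(2) unfolding q_def by linarith
      moreover have "\<bar>(\<phi> (u s t) \<bullet> g s t - \<phi> (u 0 t) \<bullet> g 0 t) / s - (\<phi>' (u 0 t) (x t) \<bullet> g 0 t + \<phi> (u 0 t) \<bullet> h t)\<bar> \<le> ?k t"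
        if t: "t \<in> {a..b}" for t
      proof -
        define w where "w = (\<phi> (u s t) - \<phi> (u 0 t)) /\<^sub>R s - \<phi>' (u 0 t) (x t)"
        have w: "norm w \<le> e1" using elim(3) t by (simp add: w_def)
        have gs: "g s t = g 0 t + s *\<^sub>R (h t + q t)" using elim(4) by (simp add: q_def)
        have ps: "\<phi> (u s t) = \<phi> (u 0 t) + s *\<^sub>R (\<phi>' (u 0 t) (x t) + w)" using elim(4) by (simp add: w_def)
        have "norm (s *\<^sub>R (\<phi>' (u 0 t) (x t) + w)) \<le> \<bar>s\<bar> * (B + e1)"
          using norm_triangle_mono[OF B(2)[OF t] w] by (simp add: mult_left_mono)
        also have "\<dots> \<le> e2" using elim(4) B(1) e1(1) by (simp add: field_simps)
        finally have p: "norm (s *\<^sub>R (\<phi>' (u 0 t) (x t) + w)) \<le> e2" .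
        have eq: "(\<phi> (u s t) \<bullet> g s t - \<phi> (u 0 t) \<bullet> g 0 t) / s - (\<phi>' (u 0 t) (x t) \<bullet> g 0 t + \<phi> (u 0 t) \<bullet> h t) =
            w \<bullet> g 0 t + (s *\<^sub>R (\<phi>' (u 0 t) (x t) + w)) \<bullet> (h t + q t) + \<phi> (u 0 t) \<bullet> q t"
          unfolding gs ps using elim(4) by (simp add: inner_add_left inner_add_right field_simps)
        have "\<bar>w \<bullet> g 0 t\<bar> \<le> e1 * norm (g 0 t)"
          using Cauchy_Schwarz_ineq2[of w "g 0 t"] mult_right_mono[OF w norm_ge_zero[of "g 0 t"]] by linarith
        moreover have "\<bar>(s *\<^sub>R (\<phi>' (u 0 t) (x t) + w)) \<bullet> (h t + q t)\<bar> \<le> e2 * norm (h t) + norm (q t)"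
        proof -
          have "\<bar>(s *\<^sub>R (\<phi>' (u 0 t) (x t) + w)) \<bullet> (h t + q t)\<bar> \<le> e2 * norm (h t + q t)"
            using Cauchy_Schwarz_ineq2[of "s *\<^sub>R (\<phi>' (u 0 t) (x t) + w)" "h t + q t"] mult_right_mono[OF p norm_ge_zero[of "h t + q t"]]
            by linarith
          also have "\<dots> \<le> e2 * (norm (h t) + norm (q t))" using e2(1) by (intro mult_left_mono norm_triangle_ineq) auto
          also have "\<dots> \<le> e2 * norm (h t) + norm (q t)" using e2 by (simp add: distrib_left mult_left_le_one_le)
          finally show ?thesis .
        qed
        moreover have "\<bar>\<phi> (u 0 t) \<bullet> q t\<bar> \<le> M * norm (q t)"
          using Cauchy_Schwarz_ineq2[of "\<phi> (u 0 t)" "q t"] mult_right_mono[OF M(2)[OF t] norm_ge_zero[of "q t"]] by linarith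
        moreover have "(M + 1) * norm (q t) = M * norm (q t) + norm (q t)" by (simp add: distrib_right)
        ultimately show ?thesis unfolding eq by linarith
      qed
      ultimately show ?case by (intro exI[of _ ?k]) simp
    qed
  qed
qed

text \<open>The gluing step for Bolzano's principle. Integrability for \<open>s\<close> near 0 is
  carried along because \<open>integral\<close> is 0 by default on nonintegrable functions, and
  additivity of the integral is used at every such \<open>s\<close>.\<close>

lemma integral_derivative_join:
  fixes f :: "real \<Rightarrow> real \<Rightarrow> real"
  assumes le: "a \<le> b" "b \<le> c"
    and f: "\<forall>\<^sub>F s in nhds 0. f s integrable_on {a..b}" "\<forall>\<^sub>F s in nhds 0. f s integrable_on {b..c}"
    and D: "((\<lambda>s. integral {a..b} (f s)) has_real_derivative D) (at 0)"
      "((\<lambda>s. integral {b..c} (f s)) has_real_derivative E) (at 0)"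
  shows "\<forall>\<^sub>F s in nhds 0. f s integrable_on {a..c}"
    and "((\<lambda>s. integral {a..c} (f s)) has_real_derivative D + E) (at 0)"
proof -
  show i: "\<forall>\<^sub>F s in nhds 0. f s integrable_on {a..c}"
    using f by eventually_elim (rule Henstock_Kurzweil_Integration.integrable_combine[OF le])
  then have "\<forall>\<^sub>F s in nhds 0. integral {a..c} (f s) = integral {a..b} (f s) + integral {b..c} (f s)"
    by eventually_elim (simp add: Henstock_Kurzweil_Integration.integral_combine[OF le])
  then show "((\<lambda>s. integral {a..c} (f s)) has_real_derivative D + E) (at 0)"
    by (subst DERIV_cong_ev[OF refl _ refl]) (auto intro: DERIV_add D)
qed

section \<open>The differential of the mean energy\<close>

context smooth_manifold
begin

text \<open>\<open>loop_path\<close> is already local in time; here its W^{1,p} convergence is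
  weakened to \<open>C0_L1_path\<close>. Since \<sigma> 0 = \<gamma>, the conditions for
  \<open>s\<close> near but different from 0 extend to a full neighbourhood.\<close>

lemma loop_path_chart:
  assumes p: "p \<ge> 1" and P: "loop_path A p \<sigma> \<gamma> X"
  obtains c a b where "c \<in> A" "a < t" "t < b" "\<gamma> ` {a..b} \<subseteq> cdom c"
    "\<forall>\<^sub>F s in nhds 0. \<sigma> s \<in> loop_space A p \<and> \<sigma> s ` {a..b} \<subseteq> cdom c"
    "C0_L1_path a b (\<lambda>s r. cmap c (\<sigma> s r)) (\<lambda>s r. vector_derivative (\<lambda>r. cmap c (\<sigma> s r)) (at r))
      (\<lambda>r. X r c) (\<lambda>r. vector_derivative (\<lambda>r. X r c) (at r))"
proof -
  have \<sigma>0: "\<sigma> 0 = \<gamma>" and \<gamma>: "\<gamma> \<in> loop_space A p" and X: "X \<in> loop_tangent A p \<gamma>"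
    and ev1: "\<forall>\<^sub>F s in at 0. \<sigma> s \<in> loop_space A p"
    using P unfolding loop_path_def by blast+
  obtain c a b where c: "c \<in> A" "a < t" "t < b" "\<gamma> ` {a..b} \<subseteq> cdom c"
    and ev2: "\<forall>\<^sub>F s in at 0. \<sigma> s ` {a..b} \<subseteq> cdom c"
    and lim: "((\<lambda>s. sobolev_norm p a b (\<lambda>r. (cmap c (\<sigma> s r) - cmap c (\<gamma> r)) /\<^sub>R s - X r c)) \<longlongrightarrow> 0) (at 0)"
    using P unfolding loop_path_def by meson
  have ab: "a < b" using c by simp
  have ev: "\<forall>\<^sub>F s in nhds 0. \<sigma> s \<in> loop_space A p \<and> \<sigma> s ` {a..b} \<subseteq> cdom c"
    unfolding eventually_nhds_conv_at using eventually_conj[OF ev1 ev2] \<sigma>0 \<gamma> c(4) by simp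
  have "C0_L1_path a b (\<lambda>s r. cmap c (\<sigma> s r)) (\<lambda>s r. vector_derivative (\<lambda>r. cmap c (\<sigma> s r)) (at r))
      (\<lambda>r. X r c) (\<lambda>r. vector_derivative (\<lambda>r. X r c) (at r))"
  proof (rule C0_L1_pathI[OF p ab])
    show "\<forall>\<^sub>F s in nhds 0. sobolev_deriv p a b (\<lambda>r. cmap c (\<sigma> s r)) (\<lambda>r. vector_derivative (\<lambda>r. cmap c (\<sigma> s r)) (at r))"
      using ev
    proof eventually_elim
      case (elim s)
      then show ?case unfolding sobolev_on_iff[OF p, symmetric] using loop_spaceD(3)[OF _ c(1) ab] by blast
    qed
    show "sobolev_deriv p a b (\<lambda>r. X r c) (\<lambda>r. vector_derivative (\<lambda>r. X r c) (at r))"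
      unfolding sobolev_on_iff[OF p, symmetric] by (rule loop_tangentD(3)[OF X c(1) ab c(4)])
    show "((\<lambda>s. sobolev_norm p a b (\<lambda>t. (cmap c (\<sigma> s t) - cmap c (\<sigma> 0 t)) /\<^sub>R s - X t c)) \<longlongrightarrow> 0) (at 0)"
      using lim unfolding \<sigma>0 .
  qed
  then show ?thesis using that c ev by blast
qed

lemma dfun_combination:
  assumes f: "smooth_fun A f" and v: "v \<in> tangent_space A x" and w: "w \<in> tangent_space A x"
  shows "dfun A f x (\<lambda>c. a *\<^sub>R v c + b *\<^sub>R w c) = a * dfun A f x v + b * dfun A f x w"
proof -
  obtain c where c: "c \<in> charts_at A x" using ex_chart_at by blast
  have "linear (frechet_derivative (f \<circ> cinv c) (at (cmap c x)))"
    using C1_on_linear[OF smooth_fun_C1_on[OF f]] charts_atD[OF c] by blast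
  then show ?thesis
    unfolding dfun_chart[OF f c tangent_space_combination[OF v w]] dfun_chart[OF f c v] dfun_chart[OF f c w]
    by (simp add: linear_add linear_scale)
qed

lemma continuous_on_dfun_loop:
  assumes p: "p \<ge> 1" and f: "smooth_fun A f" and \<gamma>: "\<gamma> \<in> loop_space A p" and X: "X \<in> loop_tangent A p \<gamma>"
  shows "continuous_on UNIV (\<lambda>t. dfun A f (\<gamma> t) (X t))"
proof (rule continuous_at_imp_continuous_on, rule ballI)
  fix t :: real
  obtain c where c: "c \<in> charts_at A (\<gamma> t)" using ex_chart_at by blast
  then have cA: "c \<in> A" "\<gamma> t \<in> cdom c" using charts_atD by auto
  let ?U = "\<gamma> -` cdom c"
  have U: "open ?U" "t \<in> ?U" using loop_open_vimage[OF \<gamma> cA(1)] cA(2) by auto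
  have "continuous_on ?U (\<lambda>t. cmap c (\<gamma> t))"
    by (rule continuous_on_compose2[OF chart(3)[OF cA(1)] continuous_on_subset[OF loop_spaceD(1)[OF \<gamma>]]]) auto
  then have "continuous_on ?U (\<lambda>t. frechet_derivative (f \<circ> cinv c) (at (cmap c (\<gamma> t))) (X t c))"
    by (rule C1_on_continuous_derivative[OF smooth_fun_C1_on[OF f cA(1)] _ loop_tangent_continuous_on[OF p \<gamma> X cA(1)]]) auto
  then have "continuous_on ?U (\<lambda>t. dfun A f (\<gamma> t) (X t))"
    by (subst continuous_on_cong[OF refl, where g = "\<lambda>t. frechet_derivative (f \<circ> cinv c) (at (cmap c (\<gamma> t))) (X t c)"])
      (simp_all add: dfun_chart[OF f charts_atI[OF cA(1)] loop_tangentD(1)[OF X]])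
  then show "isCont (\<lambda>t. dfun A f (\<gamma> t) (X t)) t"
    using U continuous_on_eq_continuous_at by blast
qed

text \<open>On a short interval the path lies in one chart, where the coordinate expression of
  \<open>H\<close> is differentiated under the integral; Bolzano's principle adds the pieces over
  {0..1}. The limit is linear in \<open>X\<close> because \<open>dfun\<close> is.\<close>

lemma has_loop_differential_mean_energy:
  assumes p: "p \<ge> 1" and H: "smooth_fun A H" and \<gamma>: "\<gamma> \<in> loop_space A p"
  shows "has_loop_differential A p (mean_energy H) \<gamma> (\<lambda>X. integral {0..1} (\<lambda>t. dfun A H (\<gamma> t) (X t)))"
  unfolding has_loop_differential_def
proof (intro conjI ballI allI impI)
  have i: "(\<lambda>t. dfun A H (\<gamma> t) (X t)) integrable_on {l..r}" if "X \<in> loop_tangent A p \<gamma>" for X l r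
    by (intro integrable_continuous_real continuous_on_subset[OF continuous_on_dfun_loop[OF p H \<gamma> that]]) simp
  show "integral {0..1} (\<lambda>t. dfun A H (\<gamma> t) (\<lambda>c. a *\<^sub>R X t c + b *\<^sub>R Y t c)) =
      a * integral {0..1} (\<lambda>t. dfun A H (\<gamma> t) (X t)) + b * integral {0..1} (\<lambda>t. dfun A H (\<gamma> t) (Y t))"
    if X: "X \<in> loop_tangent A p \<gamma>" and Y: "Y \<in> loop_tangent A p \<gamma>" for X Y a b
    unfolding dfun_combination[OF H loop_tangentD(1)[OF X] loop_tangentD(1)[OF Y]]
    by (subst Henstock_Kurzweil_Integration.integral_add) (auto intro!: integrable_on_mult_right i X Y)
  fix \<sigma> X assume P: "loop_path A p \<sigma> \<gamma> X"
  then have \<sigma>0: "\<sigma> 0 = \<gamma>" and X: "X \<in> loop_tangent A p \<gamma>" unfolding loop_path_def by blast+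
  let ?h = "\<lambda>s t. H (\<sigma> s t)" and ?D = "\<lambda>l r. integral {l..r} (\<lambda>t. dfun A H (\<gamma> t) (X t))"
  have "(\<forall>\<^sub>F s in nhds 0. ?h s integrable_on {0..1}) \<and>
      ((\<lambda>s. integral {0..1} (?h s)) has_real_derivative ?D 0 1) (at 0)"
  proof (rule Bolzano[where P = "\<lambda>l r. (\<forall>\<^sub>F s in nhds 0. ?h s integrable_on {l..r}) \<and>
      ((\<lambda>s. integral {l..r} (?h s)) has_real_derivative ?D l r) (at 0)"])
    fix l m r :: real
    assume A: "(\<forall>\<^sub>F s in nhds 0. ?h s integrable_on {l..m}) \<and>
      ((\<lambda>s. integral {l..m} (?h s)) has_real_derivative ?D l m) (at 0)"
      "(\<forall>\<^sub>F s in nhds 0. ?h s integrable_on {m..r}) \<and>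
      ((\<lambda>s. integral {m..r} (?h s)) has_real_derivative ?D m r) (at 0)"
      and le: "l \<le> m" "m \<le> r"
    have "?D l m + ?D m r =
        ?D l r"
      by (rule Henstock_Kurzweil_Integration.integral_combine[OF le i[OF X]])
    then show "(\<forall>\<^sub>F s in nhds 0. ?h s integrable_on {l..r}) \<and>
      ((\<lambda>s. integral {l..r} (?h s)) has_real_derivative ?D l r) (at 0)"
      using integral_derivative_join[OF le conjunct1[OF A(1)] conjunct1[OF A(2)] conjunct2[OF A(1)] conjunct2[OF A(2)]] by simp
  next
    fix t :: real
    obtain c a b where c: "c \<in> A" "a < t" "t < b" "\<gamma> ` {a..b} \<subseteq> cdom c"
      and ev: "\<forall>\<^sub>F s in nhds 0. \<sigma> s \<in> loop_space A p \<and> \<sigma> s ` {a..b} \<subseteq> cdom c"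
      and C0L1: "C0_L1_path a b (\<lambda>s r. cmap c (\<sigma> s r)) (\<lambda>s r. vector_derivative (\<lambda>r. cmap c (\<sigma> s r)) (at r))
        (\<lambda>r. X r c) (\<lambda>r. vector_derivative (\<lambda>r. X r c) (at r))"
      by (rule loop_path_chart[OF p P])
    show "\<exists>d>0. \<forall>l r. l \<le> t \<and> t \<le> r \<and> r - l < d \<longrightarrow> (\<forall>\<^sub>F s in nhds 0. ?h s integrable_on {l..r}) \<and>
      ((\<lambda>s. integral {l..r} (?h s)) has_real_derivative ?D l r) (at 0)"
    proof (intro exI[of _ "min (t - a) (b - t)"] conjI[of "_ > _"] allI impI)
      show "min (t - a) (b - t) > 0" using c by simp
      fix l r assume lr: "l \<le> t \<and> t \<le> r \<and> r - l < min (t - a) (b - t)"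
      then have sub: "a \<le> l" "r \<le> b" "l \<le> r" and subs: "{l..r} \<subseteq> {a..b}" by auto
      note P' = C0_L1_path_subinterval[OF C0L1 sub(1,2)]
      have im: "(\<lambda>r. cmap c (\<sigma> 0 r)) ` {l..r} \<subseteq> cimg c" using c(4) subs unfolding \<sigma>0 by blast
      note D = C0_L1_path_integral_derivative[OF P' chart(2)[OF c(1)] im smooth_fun_C1_on[OF H c(1)] sub(3)]
      have eq: "\<forall>\<^sub>F s in nhds 0. \<forall>t\<in>{l..r}. (H \<circ> cinv c) (cmap c (\<sigma> s t)) = H (\<sigma> s t)"
        using ev
      proof eventually_elim
        case (elim s)
        show ?case
        proof
          fix t assume "t \<in> {l..r}"
          then have "\<sigma> s t \<in> cdom c" using elim subs by blast
          then show "(H \<circ> cinv c) (cmap c (\<sigma> s t)) = H (\<sigma> s t)" using chart(5)[OF c(1)] by simp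
        qed
      qed
      have "\<forall>\<^sub>F s in nhds 0. ?h s integrable_on {l..r}"
        using D(2) eq
      proof eventually_elim
        case (elim s)
        show ?case by (rule integrable_eq[OF elim(1)]) (use elim(2) in blast)
      qed
      moreover have eqi: "\<forall>\<^sub>F s in nhds 0. integral {l..r} (\<lambda>t. H (\<sigma> s t)) = integral {l..r} (\<lambda>t. (H \<circ> cinv c) (cmap c (\<sigma> s t)))"
        using eq by eventually_elim (intro Henstock_Kurzweil_Integration.integral_cong, metis)
      have eqD: "?D l r =
          integral {l..r} (\<lambda>t. frechet_derivative (H \<circ> cinv c) (at (cmap c (\<sigma> 0 t))) (X t c))"
      proof (rule Henstock_Kurzweil_Integration.integral_cong)
        fix t assume "t \<in> {l..r}"
        then have "c \<in> charts_at A (\<gamma> t)" using c(1,4) subs by (intro charts_atI) blast+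
        then show "dfun A H (\<gamma> t) (X t) = frechet_derivative (H \<circ> cinv c) (at (cmap c (\<sigma> 0 t))) (X t c)"
          unfolding \<sigma>0 by (rule dfun_chart[OF H _ loop_tangentD(1)[OF X]])
      qed
      have "((\<lambda>s. integral {l..r} (?h s)) has_real_derivative ?D l r) (at 0)"
        using D(1) unfolding eqD by (subst DERIV_cong_ev[OF refl eqi refl])
      ultimately show "(\<forall>\<^sub>F s in nhds 0. ?h s integrable_on {l..r}) \<and>
        ((\<lambda>s. integral {l..r} (?h s)) has_real_derivative ?D l r) (at 0)"
        by blast
    qed
  qed simp
  then show "((\<lambda>s. mean_energy H (\<sigma> s)) has_real_derivative ?D 0 1) (at 0)"
    unfolding mean_energy_def by blast
qed

end

section \<open>The action functional\<close>

locale exact_manifold = two_form_manifold A om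
  for A :: "('a::topological_space, 'e::euclidean_space) chart set" and om +
  fixes lam :: "('a, 'e) one_form"
  assumes lam: "smooth_one_form A lam" and exact: "is_exterior_derivative A lam om"
begin

text \<open>\<open>lam\<close> in the chart \<open>c\<close>, as a vector field via the inner product.\<close>

definition ell :: "('a, 'e) chart \<Rightarrow> 'e \<Rightarrow> 'e" where
  "ell c y = (\<Sum>i\<in>Basis. lam (cinv c y) (tvec_of A c (cinv c y) i) *\<^sub>R i)"

definition ell' :: "('a, 'e) chart \<Rightarrow> 'e \<Rightarrow> 'e \<Rightarrow> 'e" where
  "ell' c y h = (\<Sum>i\<in>Basis. frechet_derivative (\<lambda>y. lam (cinv c y) (tvec_of A c (cinv c y) i)) (at y) h *\<^sub>R i)"

lemma ell_C1_on: "c \<in> A \<Longrightarrow> C1_on (cimg c) (ell c) (ell' c)"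
proof -
  assume c: "c \<in> A"
  have "smooth_on (cimg c) (\<lambda>y. lam (cinv c y) (tvec_of A c (cinv c y) i))" for i
    using lam c unfolding smooth_one_form_def by blast
  then show ?thesis
    unfolding ell_def[abs_def] ell'_def[abs_def]
    by (rule C1_on_sum[OF C1_on_compose_linear[OF smooth_on_imp_C1_on bounded_linear_scaleR_left]])
qed

lemma lam_chart:
  assumes c: "c \<in> charts_at A x"
  shows "lam x (tvec_of A c x v) = ell c (cmap c x) \<bullet> v"
proof -
  have cA: "c \<in> A" "x \<in> cdom c" using charts_atD[OF c] by auto
  have "linear (\<lambda>v. lam x (tvec_of A c x v))" using lam cA unfolding smooth_one_form_def by blast
  then have "lam x (tvec_of A c x v) = (\<Sum>i\<in>Basis. (v \<bullet> i) * lam x (tvec_of A c x i))" by (rule linear_basis_expansion)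
  also have "\<dots> = ell c (cmap c x) \<bullet> v"
    by (simp add: ell_def chart(5)[OF cA] inner_sum_left inner_commute[of v] mult.commute)
  finally show ?thesis .
qed

text \<open>\<open>is_exterior_derivative\<close> differentiates \<open>lam\<close> on constant
  coordinate fields, and in the chart these values are the functions y \<mapsto> ell c y \<bullet>
  w.\<close>

lemma om_chart:
  assumes c: "c \<in> charts_at A x"
  shows "om x (tvec_of A c x v) (tvec_of A c x w) = ell' c (cmap c x) v \<bullet> w - ell' c (cmap c x) w \<bullet> v"
proof -
  have cA: "c \<in> A" "x \<in> cdom c" using charts_atD[OF c] by auto
  have img: "cmap c x \<in> cimg c" using cA by blast
  have "frechet_derivative (\<lambda>y. lam (cinv c y) (tvec_of A c (cinv c y) w)) (at (cmap c x)) = (\<lambda>v. ell' c (cmap c x) v \<bullet> w)" for w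
  proof (rule frechet_derivative_at[symmetric])
    have "(ell c has_derivative ell' c (cmap c x)) (at (cmap c x))"
      using ell_C1_on[OF cA(1)] img unfolding C1_on_def by blast
    then have "((\<lambda>y. ell c y \<bullet> w) has_derivative (\<lambda>v. ell' c (cmap c x) v \<bullet> w)) (at (cmap c x))"
      by (rule has_derivative_inner_left)
    then show "((\<lambda>y. lam (cinv c y) (tvec_of A c (cinv c y) w)) has_derivative (\<lambda>v. ell' c (cmap c x) v \<bullet> w)) (at (cmap c x))"
    proof (rule has_derivative_transform_within_open[OF _ chart(2)[OF cA(1)] img])
      fix y assume y: "y \<in> cimg c"
      show "ell c y \<bullet> w = lam (cinv c y) (tvec_of A c (cinv c y) w)"
        unfolding lam_chart[OF charts_atI[OF cA(1) chart(7)[OF cA(1) y]]] chart(6)[OF cA(1) y] ..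
    qed
  qed
  moreover have "om x (tvec_of A c x v) (tvec_of A c x w) =
       frechet_derivative (\<lambda>y. lam (cinv c y) (tvec_of A c (cinv c y) w)) (at (cmap c x)) v
     - frechet_derivative (\<lambda>y. lam (cinv c y) (tvec_of A c (cinv c y) v)) (at (cmap c x)) w"
    using exact cA unfolding is_exterior_derivative_def by blast
  ultimately show ?thesis by simp
qed

lemma loop_velocity_AE_chart:
  assumes p: "p \<ge> 1" and \<gamma>: "\<gamma> \<in> loop_space A p" and c: "c \<in> A" and ab: "a < b" "\<gamma> ` {a..b} \<subseteq> cdom c"
  obtains N where "negligible N" "\<And>t. t \<in> {a..b} - N \<Longrightarrow>
    loop_velocity A \<gamma> t = tvec_of A c (\<gamma> t) (vector_derivative (\<lambda>r. cmap c (\<gamma> r)) (at t))"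
proof -
  have "sobolev_deriv p a b (\<lambda>r. cmap c (\<gamma> r)) (\<lambda>t. vector_derivative (\<lambda>r. cmap c (\<gamma> r)) (at t))"
    unfolding sobolev_on_iff[OF p, symmetric] by (rule loop_spaceD(3)[OF \<gamma> c ab])
  then obtain N where N: "negligible N" "\<forall>t\<in>{a..b} - N.
      ((\<lambda>r. cmap c (\<gamma> r)) has_vector_derivative vector_derivative (\<lambda>r. cmap c (\<gamma> r)) (at t)) (at t)"
    unfolding sobolev_deriv_def by blast
  have "loop_velocity A \<gamma> t = tvec_of A c (\<gamma> t) (vector_derivative (\<lambda>r. cmap c (\<gamma> r)) (at t))" if t: "t \<in> {a..b} - N" for t
  proof (rule loop_velocity_chart[OF loop_spaceD(1)[OF \<gamma>]])
    show "c \<in> charts_at A (\<gamma> t)" using c ab(2) t by (intro charts_atI) blast+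
  qed (use N(2) t in blast)
  then show ?thesis using that N(1) by blast
qed

text \<open>Where the velocity is junk (a null set) the integrand is cut off, which makes it linear in
  the vector field at every single time.\<close>

definition action_density :: "(real \<Rightarrow> 'a) \<Rightarrow> real \<Rightarrow> ('a, 'e) tvec \<Rightarrow> real" where
  "action_density \<gamma> t v = (if loop_velocity A \<gamma> t \<in> tangent_space A (\<gamma> t) then om (\<gamma> t) (loop_velocity A \<gamma> t) v else 0)"

lemma action_density_combination:
  "v \<in> tangent_space A (\<gamma> t) \<Longrightarrow> w \<in> tangent_space A (\<gamma> t) \<Longrightarrow>
    action_density \<gamma> t (\<lambda>c. a *\<^sub>R v c + b *\<^sub>R w c) = a * action_density \<gamma> t v + b * action_density \<gamma> t w"
  by (simp add: action_density_def om_linear_right)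

text \<open>Where the loop is differentiable in the chart, its velocity is a tangent vector, the
  cut-off is inactive and \<open>om_chart\<close> applies. Each term of \<open>w\<close> pairs a
  continuous function with an integrable one.\<close>

lemma action_density_chart:
  assumes p: "p \<ge> 1" and \<gamma>: "\<gamma> \<in> loop_space A p" and X: "X \<in> loop_tangent A p \<gamma>"
    and c: "c \<in> A" and ab: "a < b" "\<gamma> ` {a..b} \<subseteq> cdom c"
  defines "u \<equiv> \<lambda>t. cmap c (\<gamma> t)"
  defines "g \<equiv> \<lambda>t. vector_derivative u (at t)"
  defines "w \<equiv> \<lambda>t. ell' c (u t) (g t) \<bullet> X t c - ell' c (u t) (X t c) \<bullet> g t"
  shows "\<exists>N. negligible N \<and> (\<forall>t\<in>{a..b} - N. action_density \<gamma> t (X t) = w t)"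
    and "w integrable_on {a..b}" and "(\<lambda>t. action_density \<gamma> t (X t)) integrable_on {a..b}"
proof -
  obtain N where N: "negligible N" "\<And>t. t \<in> {a..b} - N \<Longrightarrow> loop_velocity A \<gamma> t = tvec_of A c (\<gamma> t) (g t)"
    unfolding g_def u_def using loop_velocity_AE_chart[OF p \<gamma> c ab] by blast
  have eq: "action_density \<gamma> t (X t) = w t" if t: "t \<in> {a..b} - N" for t
  proof -
    have ct: "c \<in> charts_at A (\<gamma> t)" using c ab(2) t by (intro charts_atI) blast+
    have "om (\<gamma> t) (tvec_of A c (\<gamma> t) (g t)) (tvec_of A c (\<gamma> t) (X t c)) = w t"
      unfolding om_chart[OF ct] w_def u_def ..
    then show ?thesis
      unfolding action_density_def N(2)[OF t] tvec_of_tangent[OF ct loop_tangentD(1)[OF X]]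
      by (simp add: tvec_of_in_tangent_space[OF ct])
  qed
  then show ex: "\<exists>N. negligible N \<and> (\<forall>t\<in>{a..b} - N. action_density \<gamma> t (X t) = w t)" using N(1) by blast
  have su: "sobolev_deriv p a b u g"
    unfolding g_def u_def sobolev_on_iff[OF p, symmetric] by (rule loop_spaceD(3)[OF \<gamma> c ab])
  have sx: "sobolev_deriv p a b (\<lambda>t. X t c) (\<lambda>t. vector_derivative (\<lambda>t. X t c) (at t))"
    unfolding sobolev_on_iff[OF p, symmetric] by (rule loop_tangentD(3)[OF X c ab])
  have g: "g absolutely_integrable_on {a..b}" using su unfolding sobolev_deriv_def by blast
  note cu = sobolev_deriv_continuous_on[OF su] and cx = sobolev_deriv_continuous_on[OF sx]
  have im: "u ` {a..b} \<subseteq> cimg c" using ab(2) unfolding u_def by blast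
  have "(\<lambda>t. X t c \<bullet> ell' c (u t) (g t)) integrable_on {a..b}"
    by (rule integrable_inner_continuous[OF cx C1_on_derivative_along(1)[OF ell_C1_on[OF c] cu im g]])
  moreover have "(\<lambda>t. ell' c (u t) (X t c) \<bullet> g t) integrable_on {a..b}"
    by (rule integrable_inner_continuous[OF C1_on_continuous_derivative[OF ell_C1_on[OF c] cu cx im] g])
  ultimately show w: "w integrable_on {a..b}"
    unfolding w_def by (simp add: inner_commute Henstock_Kurzweil_Integration.integrable_diff)
  show "(\<lambda>t. action_density \<gamma> t (X t)) integrable_on {a..b}"
    by (rule integrable_spike[OF w N(1) eq])
qed

lemma action_density_integrable:
  assumes p: "p \<ge> 1" and \<gamma>: "\<gamma> \<in> loop_space A p" and X: "X \<in> loop_tangent A p \<gamma>"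
  shows "(\<lambda>t. action_density \<gamma> t (X t)) integrable_on {a..b}"
proof (cases "a \<le> b")
  case True
  then show ?thesis
  proof (rule Bolzano[where P = "\<lambda>a b. (\<lambda>t. action_density \<gamma> t (X t)) integrable_on {a..b}"])
    fix x y z :: real
    assume "(\<lambda>t. action_density \<gamma> t (X t)) integrable_on {x..y}" "(\<lambda>t. action_density \<gamma> t (X t)) integrable_on {y..z}"
      "x \<le> y" "y \<le> z"
    then show "(\<lambda>t. action_density \<gamma> t (X t)) integrable_on {x..z}"
      by (intro Henstock_Kurzweil_Integration.integrable_combine[of x y z])
  next
    fix t :: real
    obtain c d where c: "c \<in> A" "d > 0" "\<gamma> ` {t - d..t + d} \<subseteq> cdom c" by (rule ex_local_chart[OF \<gamma>])
    then have "(\<lambda>t. action_density \<gamma> t (X t)) integrable_on {t - d..t + d}"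
      by (intro action_density_chart(3)[OF p \<gamma> X c(1)]) auto
    then have "(\<lambda>t. action_density \<gamma> t (X t)) integrable_on {l..r}" if "l \<le> t" "t \<le> r" "r - l < d" for l r
      by (rule integrable_subinterval_real) (use that in auto)
    then show "\<exists>d>0. \<forall>l r. l \<le> t \<and> t \<le> r \<and> r - l < d \<longrightarrow> (\<lambda>t. action_density \<gamma> t (X t)) integrable_on {l..r}"
      using c(2) by blast
  qed
qed (simp add: integrable_on_empty)

text \<open>On a chart interval, the derivative of \<open>\<integral> \<lambda>(\<partial>\<^sub>t \<sigma>)\<close> is \<open>- \<integral> \<omega>(\<partial>\<^sub>t \<gamma>, X)\<close> plus the boundary terms
  of \<open>\<lambda>(X)\<close>, which telescope around the circle.\<close>

lemma action_local_derivative: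
  assumes p: "p \<ge> 1" and P: "loop_path A p \<sigma> \<gamma> X"
  shows "\<exists>d>0. \<forall>l r. l \<le> t \<and> t \<le> r \<and> r - l < d \<longrightarrow>
    (\<forall>\<^sub>F s in nhds 0. (\<lambda>t. lam (\<sigma> s t) (loop_velocity A (\<sigma> s) t)) integrable_on {l..r}) \<and>
    ((\<lambda>s. integral {l..r} (\<lambda>t. lam (\<sigma> s t) (loop_velocity A (\<sigma> s) t))) has_real_derivative
      lam (\<gamma> r) (X r) - lam (\<gamma> l) (X l) - integral {l..r} (\<lambda>t. action_density \<gamma> t (X t))) (at 0)"
proof -
  have \<sigma>0: "\<sigma> 0 = \<gamma>" and \<gamma>: "\<gamma> \<in> loop_space A p" and X: "X \<in> loop_tangent A p \<gamma>"
    using P unfolding loop_path_def by blast+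
  obtain c a b where c: "c \<in> A" "a < t" "t < b" "\<gamma> ` {a..b} \<subseteq> cdom c"
    and ev: "\<forall>\<^sub>F s in nhds 0. \<sigma> s \<in> loop_space A p \<and> \<sigma> s ` {a..b} \<subseteq> cdom c"
    and C0L1: "C0_L1_path a b (\<lambda>s r. cmap c (\<sigma> s r)) (\<lambda>s r. vector_derivative (\<lambda>r. cmap c (\<sigma> s r)) (at r))
      (\<lambda>r. X r c) (\<lambda>r. vector_derivative (\<lambda>r. X r c) (at r))"
    by (rule loop_path_chart[OF p P])
  have ab: "a < b" using c by simp
  define u where "u t = cmap c (\<gamma> t)" for t
  define x where "x t = X t c" for t
  define g where "g t = vector_derivative u (at t)" for t
  define h where "h t = vector_derivative x (at t)" for t
  have su: "sobolev_deriv p a b u g"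
    unfolding g_def u_def sobolev_on_iff[OF p, symmetric] by (rule loop_spaceD(3)[OF \<gamma> c(1) ab c(4)])
  have sx: "sobolev_deriv p a b x h"
    unfolding h_def x_def sobolev_on_iff[OF p, symmetric] by (rule loop_tangentD(3)[OF X c(1) ab c(4)])
  have im: "u ` {a..b} \<subseteq> cimg c" using c(4) unfolding u_def by blast
  \<comment> \<open>The product rule for the value of \<open>lam\<close> on \<open>X\<close> along
    \<gamma>; its integral is the source of the boundary terms.\<close>
  have prod: "sobolev_deriv p a b (\<lambda>t. ell c (u t) \<bullet> x t) (\<lambda>t. ell c (u t) \<bullet> h t + ell' c (u t) (g t) \<bullet> x t)"
    by (rule sobolev_deriv_bilinear[OF p sobolev_deriv_compose[OF p su chart(2)[OF c(1)] im ell_C1_on[OF c(1)]] sx bounded_bilinear_inner])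
  have ct: "c \<in> charts_at A (\<gamma> t)" if "t \<in> {a..b}" for t using c(1,4) that by (intro charts_atI) blast+
  have lamX: "lam (\<gamma> t) (X t) = ell c (u t) \<bullet> x t" if "t \<in> {a..b}" for t
    using lam_chart[OF ct[OF that], of "X t c"] unfolding tvec_of_tangent[OF ct[OF that] loop_tangentD(1)[OF X]] u_def x_def .
  let ?w = "\<lambda>t. ell' c (u t) (g t) \<bullet> x t - ell' c (u t) (x t) \<bullet> g t"
  obtain N where N: "negligible N" "\<And>t. t \<in> {a..b} - N \<Longrightarrow> action_density \<gamma> t (X t) = ?w t"
    using action_density_chart(1)[OF p \<gamma> X c(1) ab c(4)] unfolding u_def[abs_def] x_def g_def by blast
  have wi: "?w integrable_on {a..b}"
    using action_density_chart(2)[OF p \<gamma> X c(1) ab c(4)] unfolding u_def[abs_def] x_def g_def .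
  show ?thesis
  proof (intro exI[of _ "min (t - a) (b - t)"] conjI[of "_ > _"] allI impI)
    show "min (t - a) (b - t) > 0" using c by simp
    fix l r assume lr: "l \<le> t \<and> t \<le> r \<and> r - l < min (t - a) (b - t)"
    then have sub: "a \<le> l" "r \<le> b" "l \<le> r" and subs: "{l..r} \<subseteq> {a..b}" by auto
    note P' = C0_L1_path_subinterval[OF C0L1 sub(1,2)]
    have im': "(\<lambda>r. cmap c (\<sigma> 0 r)) ` {l..r} \<subseteq> cimg c" using c(4) subs unfolding \<sigma>0 by blast
    note D = C0_L1_path_action_derivative[OF P' chart(2)[OF c(1)] im' ell_C1_on[OF c(1)] sub(3)]
    let ?f = "\<lambda>s t. ell c (cmap c (\<sigma> s t)) \<bullet> vector_derivative (\<lambda>r. cmap c (\<sigma> s r)) (at t)"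
    let ?L = "\<lambda>s t. lam (\<sigma> s t) (loop_velocity A (\<sigma> s) t)"
    \<comment> \<open>Velocity and chart derivative agree off a null set that depends on
      \<open>s\<close>, so the integrals are compared separately for each \<open>s\<close>.\<close>
    have eq: "\<forall>\<^sub>F s in nhds 0. \<exists>N. negligible N \<and> (\<forall>t\<in>{l..r} - N. ?L s t = ?f s t)"
      using ev
    proof eventually_elim
      case (elim s)
      then obtain N where N: "negligible N" "\<And>t. t \<in> {a..b} - N \<Longrightarrow>
          loop_velocity A (\<sigma> s) t = tvec_of A c (\<sigma> s t) (vector_derivative (\<lambda>r. cmap c (\<sigma> s r)) (at t))"
        using loop_velocity_AE_chart[OF p _ c(1) ab] by blast
      have "?L s t = ?f s t" if t: "t \<in> {l..r} - N" for t
      proof -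
        have "t \<in> {a..b} - N" using t subs by blast
        moreover have "c \<in> charts_at A (\<sigma> s t)" using elim c(1) t subs by (intro charts_atI) blast+
        ultimately show ?thesis using N(2) lam_chart by simp
      qed
      then show ?case using N(1) by blast
    qed
    have i: "\<forall>\<^sub>F s in nhds 0. ?L s integrable_on {l..r}"
      using D(2) eq
    proof eventually_elim
      case (elim s)
      then obtain N where "negligible N" "\<And>t. t \<in> {l..r} - N \<Longrightarrow> ?L s t = ?f s t" by blast
      then show ?case by (rule integrable_spike[OF elim(1)])
    qed
    have eqi: "\<forall>\<^sub>F s in nhds 0. integral {l..r} (?L s) = integral {l..r} (?f s)"
      using eq
    proof eventually_elim
      case (elim s)
      then obtain N where "negligible N" "\<And>t. t \<in> {l..r} - N \<Longrightarrow> ?L s t = ?f s t" by blast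
      then have "integral {l..r} (?f s) = integral {l..r} (?L s)" by (rule integral_spike)
      then show ?case by (rule sym)
    qed
    have boundary: "integral {l..r} (\<lambda>t. ell c (u t) \<bullet> h t + ell' c (u t) (g t) \<bullet> x t) = lam (\<gamma> r) (X r) - lam (\<gamma> l) (X l)"
      using sobolev_deriv_increment[OF prod sub(1,3,2)] lamX[of l] lamX[of r] sub by simp
    have density: "integral {l..r} ?w = integral {l..r} (\<lambda>t. action_density \<gamma> t (X t))"
      by (rule integral_spike[OF N(1)]) (use N(2) subs in auto)
    have bi: "(\<lambda>t. ell c (u t) \<bullet> h t + ell' c (u t) (g t) \<bullet> x t) integrable_on {l..r}"
      by (rule integrable_subinterval_real[OF sobolev_deriv_integrable(1)[OF prod] subs])
    have di: "?w integrable_on {l..r}" by (rule integrable_subinterval_real[OF wi subs])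
    \<comment> \<open>Integration by parts: the weak derivative of ell c (u t) \<bullet> x t minus
      the density \<open>?w\<close> is exactly the integrand found in
      \<open>C0_L1_path_action_derivative\<close>.\<close>
    have "integral {l..r} (\<lambda>t. (ell c (u t) \<bullet> h t + ell' c (u t) (g t) \<bullet> x t) - ?w t) =
        lam (\<gamma> r) (X r) - lam (\<gamma> l) (X l) - integral {l..r} (\<lambda>t. action_density \<gamma> t (X t))"
      unfolding Henstock_Kurzweil_Integration.integral_diff[OF bi di] boundary density ..
    moreover have "(\<lambda>t. (ell c (u t) \<bullet> h t + ell' c (u t) (g t) \<bullet> x t) - ?w t) =
        (\<lambda>t. ell' c (u t) (x t) \<bullet> g t + ell c (u t) \<bullet> h t)" by auto
    ultimately have val: "integral {l..r} (\<lambda>t. ell' c (u t) (x t) \<bullet> g t + ell c (u t) \<bullet> h t) =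
        lam (\<gamma> r) (X r) - lam (\<gamma> l) (X l) - integral {l..r} (\<lambda>t. action_density \<gamma> t (X t))" by simp
    have "((\<lambda>s. integral {l..r} (?f s)) has_real_derivative
        lam (\<gamma> r) (X r) - lam (\<gamma> l) (X l) - integral {l..r} (\<lambda>t. action_density \<gamma> t (X t))) (at 0)"
      using D(1) unfolding \<sigma>0 val[symmetric] u_def[abs_def] x_def[abs_def] g_def h_def .
    then have "((\<lambda>s. integral {l..r} (?L s)) has_real_derivative
        lam (\<gamma> r) (X r) - lam (\<gamma> l) (X l) - integral {l..r} (\<lambda>t. action_density \<gamma> t (X t))) (at 0)"
      by (subst DERIV_cong_ev[OF refl eqi refl])
    with i show "(\<forall>\<^sub>F s in nhds 0. ?L s integrable_on {l..r}) \<and> ((\<lambda>s. integral {l..r} (?L s)) has_real_derivative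
        lam (\<gamma> r) (X r) - lam (\<gamma> l) (X l) - integral {l..r} (\<lambda>t. action_density \<gamma> t (X t))) (at 0)"
      by blast
  qed
qed

lemma has_loop_differential_action:
  assumes p: "p \<ge> 1" and \<gamma>: "\<gamma> \<in> loop_space A p"
  shows "has_loop_differential A p (action A lam) \<gamma> (\<lambda>X. integral {0..1} (\<lambda>t. action_density \<gamma> t (X t)))"
  unfolding has_loop_differential_def
proof (intro conjI ballI allI impI)
  note i = action_density_integrable[OF p \<gamma>]
  show "integral {0..1} (\<lambda>t. action_density \<gamma> t (\<lambda>c. a *\<^sub>R X t c + b *\<^sub>R Y t c)) =
      a * integral {0..1} (\<lambda>t. action_density \<gamma> t (X t)) + b * integral {0..1} (\<lambda>t. action_density \<gamma> t (Y t))"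
    if X: "X \<in> loop_tangent A p \<gamma>" and Y: "Y \<in> loop_tangent A p \<gamma>" for X Y a b
    unfolding action_density_combination[where \<gamma> = \<gamma>, OF loop_tangentD(1)[OF X] loop_tangentD(1)[OF Y]]
    by (subst Henstock_Kurzweil_Integration.integral_add) (auto intro!: integrable_on_mult_right i X Y)
  fix \<sigma> X assume P: "loop_path A p \<sigma> \<gamma> X"
  then have X: "X \<in> loop_tangent A p \<gamma>" unfolding loop_path_def by blast
  let ?L = "\<lambda>s t. lam (\<sigma> s t) (loop_velocity A (\<sigma> s) t)"
  \<comment> \<open>The boundary terms are part of the predicate given to Bolzano's principle: they
    are additive over adjacent intervals and cancel only over a full period.\<close>
  let ?D = "\<lambda>l r. lam (\<gamma> r) (X r) - lam (\<gamma> l) (X l) - integral {l..r} (\<lambda>t. action_density \<gamma> t (X t))"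
  have "(\<forall>\<^sub>F s in nhds 0. ?L s integrable_on {0..1}) \<and>
      ((\<lambda>s. integral {0..1} (?L s)) has_real_derivative ?D 0 1) (at 0)"
  proof (rule Bolzano[where P = "\<lambda>l r. (\<forall>\<^sub>F s in nhds 0. ?L s integrable_on {l..r}) \<and>
      ((\<lambda>s. integral {l..r} (?L s)) has_real_derivative ?D l r) (at 0)"])
    fix l m r :: real
    assume H: "(\<forall>\<^sub>F s in nhds 0. ?L s integrable_on {l..m}) \<and> ((\<lambda>s. integral {l..m} (?L s)) has_real_derivative ?D l m) (at 0)"
      "(\<forall>\<^sub>F s in nhds 0. ?L s integrable_on {m..r}) \<and> ((\<lambda>s. integral {m..r} (?L s)) has_real_derivative ?D m r) (at 0)"
      and le: "l \<le> m" "m \<le> r"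
    have "?D l m + ?D m r = ?D l r"
      using Henstock_Kurzweil_Integration.integral_combine[OF le i[OF X]] by simp
    from integral_derivative_join[OF le conjunct1[OF H(1)] conjunct1[OF H(2)] conjunct2[OF H(1)] conjunct2[OF H(2)], unfolded this]
    show "(\<forall>\<^sub>F s in nhds 0. ?L s integrable_on {l..r}) \<and> ((\<lambda>s. integral {l..r} (?L s)) has_real_derivative ?D l r) (at 0)"
      by (rule conjI)
  qed (auto intro: action_local_derivative[OF p P])
  \<comment> \<open>Periodicity of \<gamma> and \<open>X\<close> cancels the boundary terms; the
    minus sign in \<open>action\<close> then absorbs the remaining one.\<close>
  moreover have "\<gamma> 1 = \<gamma> 0" "X 1 = X 0" using loop_spaceD(2)[OF \<gamma>, of 0] loop_tangentD(2)[OF X, of 0] by simp_all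
  ultimately have "((\<lambda>s. integral {0..1} (?L s)) has_real_derivative - integral {0..1} (\<lambda>t. action_density \<gamma> t (X t))) (at 0)"
    by simp
  from DERIV_minus[OF this] show "((\<lambda>s. action A lam (\<sigma> s)) has_real_derivative integral {0..1} (\<lambda>t. action_density \<gamma> t (X t))) (at 0)"
    unfolding action_def by simp
qed

end

section \<open>The differential of the Rabinowitz action functional\<close>

context smooth_manifold
begin

lemma has_ext_differential_rabinowitz:
  assumes a: "has_loop_differential A p (action A lam) \<gamma> La"
    and h: "has_loop_differential A p (mean_energy H) \<gamma> Lh"
  shows "has_ext_differential A p (rabinowitz_action A lam H) (\<gamma>, \<tau>)
    (\<lambda>(X, l). La X + \<tau> * Lh X + mean_energy H \<gamma> * l)"
  unfolding has_ext_differential_def fst_conv snd_conv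
proof (intro conjI ballI allI impI)
  fix X Y k l c d assume X: "X \<in> loop_tangent A p \<gamma>" and Y: "Y \<in> loop_tangent A p \<gamma>"
  have "La (\<lambda>t e. c *\<^sub>R X t e + d *\<^sub>R Y t e) = c * La X + d * La Y"
    "Lh (\<lambda>t e. c *\<^sub>R X t e + d *\<^sub>R Y t e) = c * Lh X + d * Lh Y"
    using a h X Y unfolding has_loop_differential_def by blast+
  then show "(case (\<lambda>t e. c *\<^sub>R X t e + d *\<^sub>R Y t e, c * k + d * l) of (X, l) \<Rightarrow> La X + \<tau> * Lh X + mean_energy H \<gamma> * l) =
      c * (case (X, k) of (X, l) \<Rightarrow> La X + \<tau> * Lh X + mean_energy H \<gamma> * l) +
      d * (case (Y, l) of (X, l) \<Rightarrow> La X + \<tau> * Lh X + mean_energy H \<gamma> * l)"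
    by (simp add: algebra_simps)
next
  fix \<sigma> X \<theta> l
  assume P: "loop_path A p \<sigma> \<gamma> X \<and> \<theta> 0 = \<tau> \<and> (\<theta> has_real_derivative l) (at 0)"
  then have "((\<lambda>s. action A lam (\<sigma> s)) has_real_derivative La X) (at 0)"
    "((\<lambda>s. mean_energy H (\<sigma> s)) has_real_derivative Lh X) (at 0)"
    using a h unfolding has_loop_differential_def by blast+
  moreover have "\<sigma> 0 = \<gamma>" using P unfolding loop_path_def by blast
  ultimately show "((\<lambda>s. rabinowitz_action A lam H (\<sigma> s, \<theta> s)) has_real_derivative
      (case (X, l) of (X, l) \<Rightarrow> La X + \<tau> * Lh X + mean_energy H \<gamma> * l)) (at 0)"
    unfolding rabinowitz_action_def using P by (auto intro!: derivative_eq_intros simp: algebra_simps)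
qed

end

section \<open>Positivity of the differential of the mean energy on the gradient\<close>

context compatible_manifold
begin

text \<open>The integrand is the squared length of the gradient, continuous and nonnegative, so its
  integral is 0 only if it vanishes at every time. At a time where \<open>H\<close> is 0 the
  gradient would then be 0, and so would the differential of \<open>H\<close>, against
  regularity.\<close>

lemma integral_dfun_gradient_pos:
  assumes p: "p \<ge> 1" and H: "smooth_fun A H" and reg: "regular_value A H 0"
    and \<gamma>: "\<gamma> \<in> loop_space A p" and zero: "mean_energy H \<gamma> = 0"
  shows "integral {0..1} (\<lambda>t. dfun A H (\<gamma> t) (grad H (\<gamma> t))) > 0"
proof -
  let ?G = "\<lambda>x. grad H x"
  let ?f = "\<lambda>t. dfun A H (\<gamma> t) (?G (\<gamma> t))"
  have f: "?f t = om (\<gamma> t) (?G (\<gamma> t)) (J (\<gamma> t) (?G (\<gamma> t)))" for t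
    by (rule gradient(2)[OF H gradient(1)[OF H], symmetric])
  have f0: "?f t \<ge> 0" for t
  proof (cases "?G (\<gamma> t) = (\<lambda>_. 0)")
    case True
    have "dfun A H (\<gamma> t) (\<lambda>_. 0) = 0"
      using dfun_combination[OF H zero_in_tangent_space zero_in_tangent_space, of "\<gamma> t" 0 0] by simp
    then show ?thesis using True by simp
  next
    case False
    then show ?thesis unfolding f using metric_pos[OF gradient(1)[OF H]] by (simp add: less_imp_le)
  qed
  have cf: "continuous_on {0..1} ?f"
    by (rule continuous_on_subset[OF continuous_on_dfun_loop[OF p H \<gamma> gradient_loop_tangent[OF p \<gamma> H]]]) simp
  have cH: "continuous_on {0..1} (\<lambda>t. H (\<gamma> t))"
  proof (rule continuous_at_imp_continuous_on, rule ballI)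
    fix t :: real
    obtain c where "c \<in> charts_at A (\<gamma> t)" using ex_chart_at by blast
    then have c: "c \<in> A" "\<gamma> t \<in> cdom c" using charts_atD by auto
    let ?U = "\<gamma> -` cdom c"
    have "continuous_on ?U (\<lambda>t. cmap c (\<gamma> t))"
      by (rule continuous_on_compose2[OF chart(3)[OF c(1)] continuous_on_subset[OF loop_spaceD(1)[OF \<gamma>]]]) auto
    then have "continuous_on ?U (\<lambda>t. (H \<circ> cinv c) (cmap c (\<gamma> t)))"
      by (rule continuous_on_compose2[OF C1_on_imp_continuous_on[OF smooth_fun_C1_on[OF H c(1)]]]) auto
    then have "continuous_on ?U (\<lambda>t. H (\<gamma> t))"
      by (subst continuous_on_cong[OF refl, where g = "\<lambda>t. (H \<circ> cinv c) (cmap c (\<gamma> t))"]) (simp_all add: chart(5)[OF c(1)])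
    moreover have "open ?U" "t \<in> ?U" using loop_open_vimage[OF \<gamma> c(1)] c(2) by auto
    ultimately show "isCont (\<lambda>t. H (\<gamma> t)) t" using continuous_on_eq_continuous_at by blast
  qed
  \<comment> \<open>A continuous function without zeros on {0..1} has constant sign by
    connectedness; a function of constant sign with integral 0 vanishes identically, a
    contradiction.\<close>
  obtain t0 where t0: "t0 \<in> {0..1}" "H (\<gamma> t0) = 0"
  proof (rule ccontr)
    assume "\<not> thesis"
    then have nz: "H (\<gamma> t) \<noteq> 0" if "t \<in> {0..1}" for t using that \<open>\<And>t0. t0 \<in> {0..1} \<Longrightarrow> H (\<gamma> t0) = 0 \<Longrightarrow> thesis\<close> by blast
    have conn: "connected ((\<lambda>t. H (\<gamma> t)) ` {0..1})" by (intro connected_continuous_image cH) auto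
    have "(\<forall>t\<in>{0..1}. H (\<gamma> t) \<ge> 0) \<or> (\<forall>t\<in>{0..1}. - H (\<gamma> t) \<ge> 0)"
    proof (rule ccontr)
      assume "\<not> ?thesis"
      then obtain s t where st: "s \<in> {0..1}" "t \<in> {0..1}" "H (\<gamma> s) < 0" "H (\<gamma> t) > 0" by (auto simp: not_le)
      have "0 \<in> (\<lambda>t. H (\<gamma> t)) ` {0..1}"
        by (rule connectedD_interval[OF conn imageI[OF st(1)] imageI[OF st(2)]]) (use st in auto)
      then show False using nz by auto
    qed
    then show False
    proof
      assume "\<forall>t\<in>{0..1}. H (\<gamma> t) \<ge> 0"
      then have "\<forall>t\<in>{0..1}. H (\<gamma> t) = 0"
        using zero integral_eq_0_iff[OF cH] unfolding mean_energy_def by simp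
      then show False using nz[of 0] by simp
    next
      assume "\<forall>t\<in>{0..1}. - H (\<gamma> t) \<ge> 0"
      then have "\<forall>t\<in>{0..1}. - H (\<gamma> t) = 0"
        using zero integral_eq_0_iff[OF continuous_on_minus[OF cH]] unfolding mean_energy_def by simp
      then show False using nz[of 0] by simp
    qed
  qed
  have "integral {0..1} ?f \<noteq> 0"
  proof
    assume "integral {0..1} ?f = 0"
    then have "?f t0 = 0" using integral_eq_0_iff[OF cf] f0 t0(1) by simp
    then have G0: "?G (\<gamma> t0) = (\<lambda>_. 0)" unfolding f by (rule metric_definite[OF gradient(1)[OF H]])
    obtain w where w: "w \<in> tangent_space A (\<gamma> t0)" "dfun A H (\<gamma> t0) w \<noteq> 0"
      using reg t0(2) unfolding regular_value_def by blast
    have "om (\<gamma> t0) (\<lambda>_. 0) (J (\<gamma> t0) w) = 0"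
      using om_linear_left[OF zero_in_tangent_space zero_in_tangent_space J_tangent[OF w(1)], of 0 0] by simp
    then show False using gradient(2)[OF H w(1)] w(2) unfolding G0 by simp
  qed
  moreover have "integral {0..1} ?f \<ge> 0"
    by (intro Henstock_Kurzweil_Integration.integral_nonneg integrable_continuous_real cf f0)
  ultimately show ?thesis by simp
qed

end

theorem theorem1p13:
  fixes A :: "('a::{t2_space, second_countable_topology}, 'e::euclidean_space) chart set"
    and lam :: "('a, 'e) one_form" and om :: "('a, 'e) two_form" and J :: "('a, 'e) endo_field"
    and H :: "'a \<Rightarrow> real" and p :: real and \<gamma> :: "real \<Rightarrow> 'a" and \<tau> :: real
  assumes "smooth_atlas A"
    and "exact_symplectic A lam om"
    and "almost_complex A J" and "compatible A om J"
    and "smooth_fun A H" and "regular_value A H 0"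
    and "p > 1"
    and "\<gamma> \<in> loop_space A p"
  shows "(\<gamma>, \<tau>) \<in> crit_rabinowitz A p lam H \<longleftrightarrow>
    \<gamma> \<in> crit_constrained A p lam H \<and> \<tau> = constraint_factor A p lam om J H \<gamma>"
proof -
  interpret compatible_manifold A om J
    using assms(1-4) by unfold_locales (simp_all add: exact_symplectic_def)
  interpret exact_manifold A om lam
    using assms(2) by unfold_locales (simp_all add: exact_symplectic_def)
  note H = assms(5) and reg = assms(6) and \<gamma> = assms(8)
  have p: "p \<ge> 1" using assms(7) by simp
  define a where "a X = integral {0..1} (\<lambda>t. action_density \<gamma> t (X t))" for X
  define b where "b X = integral {0..1} (\<lambda>t. dfun A H (\<gamma> t) (X t))" for X
  have da: "has_loop_differential A p (action A lam) \<gamma> a"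
    using has_loop_differential_action[OF p \<gamma>] unfolding a_def[abs_def] .
  have db: "has_loop_differential A p (mean_energy H) \<gamma> b"
    using has_loop_differential_mean_energy[OF p H \<gamma>] unfolding b_def[abs_def] .
  note ea = loop_differential_eq[OF p \<gamma> da] and eb = loop_differential_eq[OF p \<gamma> db]
  note ee = ext_differential_eq[OF p \<gamma> has_ext_differential_rabinowitz[OF da db]]
  define G where "G = (\<lambda>t. gradient A (compatible_metric om J) H (\<gamma> t))"
  have G: "G \<in> loop_tangent A p \<gamma>" unfolding G_def by (rule gradient_loop_tangent[OF p \<gamma> H])
  have bG: "b G > 0" if "mean_energy H \<gamma> = 0"
    using integral_dfun_gradient_pos[OF p H reg \<gamma> that] unfolding b_def G_def .
  have chi: "constraint_factor A p lam om J H \<gamma> = - a G / b G"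
    unfolding constraint_factor_def Let_def G_def[symmetric] ea[OF G] eb[OF G] ..
  \<comment> \<open>From here on the differentials are the explicit functionals \<open>a\<close> and
    \<open>b\<close>: all vector fields in the two critical point conditions range over
    \<open>loop_tangent\<close>, where the values agree.\<close>
  have cr: "(\<gamma>, \<tau>) \<in> crit_rabinowitz A p lam H \<longleftrightarrow>
      (\<forall>X\<in>loop_tangent A p \<gamma>. \<forall>l. a X + \<tau> * b X + mean_energy H \<gamma> * l = 0)"
    using \<gamma> by (simp add: crit_rabinowitz_def ee)
  have cc: "\<gamma> \<in> crit_constrained A p lam H \<longleftrightarrow>
      mean_energy H \<gamma> = 0 \<and> (\<forall>X\<in>loop_tangent A p \<gamma>. b X = 0 \<longrightarrow> a X = 0)"
    using \<gamma> by (auto simp: crit_constrained_def constrained_loops_def constrained_tangent_def ea eb)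
  show ?thesis
    unfolding cr cc chi
  proof
    assume L: "\<forall>X\<in>loop_tangent A p \<gamma>. \<forall>l. a X + \<tau> * b X + mean_energy H \<gamma> * l = 0"
    \<comment> \<open>Comparing l = 0 with l = 1 isolates the coefficient of
      \<open>l\<close>.\<close>
    have h0: "mean_energy H \<gamma> = 0"
      using L[rule_format, OF G, of 0] L[rule_format, OF G, of 1] by simp
    have eq: "a X = - \<tau> * b X" if "X \<in> loop_tangent A p \<gamma>" for X
      using L[rule_format, OF that, of 0] by simp
    then have "\<tau> = - a G / b G" using eq[OF G] bG[OF h0] by simp
    then show "(mean_energy H \<gamma> = 0 \<and> (\<forall>X\<in>loop_tangent A p \<gamma>. b X = 0 \<longrightarrow> a X = 0)) \<and> \<tau> = - a G / b G"
      using h0 eq by simp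
  next
    assume R: "(mean_energy H \<gamma> = 0 \<and> (\<forall>X\<in>loop_tangent A p \<gamma>. b X = 0 \<longrightarrow> a X = 0)) \<and> \<tau> = - a G / b G"
    then have bG': "b G > 0" using bG by blast
    show "\<forall>X\<in>loop_tangent A p \<gamma>. \<forall>l. a X + \<tau> * b X + mean_energy H \<gamma> * l = 0"
    proof (intro ballI allI)
      fix X l assume X: "X \<in> loop_tangent A p \<gamma>"
      \<comment> \<open>The component of \<open>X\<close> in the kernel of \<open>b\<close>. With
        \<tau> = - a G / b G, the equation a Y = 0 reads a X = - \<tau> * b X.\<close>
      define Y where "Y = (\<lambda>t c. 1 *\<^sub>R X t c + (- (b X / b G)) *\<^sub>R G t c)"
      have Y: "Y \<in> loop_tangent A p \<gamma>" unfolding Y_def by (rule loop_tangent_combination[OF p X G])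
      have "b Y = 1 * b X + (- (b X / b G)) * b G" "a Y = 1 * a X + (- (b X / b G)) * a G"
        using da db X G unfolding has_loop_differential_def Y_def by blast+
      then have "b Y = 0" "a Y = a X - b X / b G * a G" using bG' by simp_all
      moreover have "a Y = 0" using R Y \<open>b Y = 0\<close> by blast
      ultimately show "a X + \<tau> * b X + mean_energy H \<gamma> * l = 0" using R by simp
    qed
  qed
qed

end
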